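(* Let $d,n\in\mathbb{N}$, $\mathcal{V}=\{1,\ldots,n\}$, and let $(\mathcal{G}(t))_{t\in\mathbb{N}_0}$, $(w_{ij}(t))_{i,j\in\mathcal{V},\,t\in\mathbb{N}_0}$ be a time-varying network with weights satisfying the standing assumptions (A1)–(A4) listed in the context. Let $\mu_1(0),\ldots,\mu_n(0)\in \mathcal{P}_{q,ac}(\mathbb{R}^d)$ for some $q\in(2,\infty)$, and suppose that the measures $\mu_i(t)$ follow the update rule $$\mu_i(t+1)=\operatorname{bar}\big(\{(\mu_j(t),w_{ij}(t))\}_{j\in \mathcal{N}_i(t)}\big),\qquad i\in\mathcal{V},\ t\in\mathbb{N}_0.$$ Then there exists $\mu^*\in\mathcal{P}_2(\mathbb{R}^d)$ such that $$\lim_{t\to\infty}W_2(\mu_i(t),\mu^* )=0$$ for all $i\in\mathcal{V}$.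
   Context: $\mathbb{N}$ is the set of positive integers and $\mathbb{N}_0=\mathbb{N}\cup\{0\}$. $\mathcal{P}(\mathbb{R}^d)$ is the set of probability measures on $\mathbb{R}^d$ with the Euclidean distance; for $p\in[1,\infty)$, $\mathcal{P}_p(\mathbb{R}^d)=\{\mu\in\mathcal{P}(\mathbb{R}^d):\int|x|^p\,d\mu<\infty\}$, and $\mathcal{P}_{p,ac}(\mathbb{R}^d)$ is the set of measures in $\mathcal{P}_p(\mathbb{R}^d)$ that are absolutely continuous (with respect to Lebesgue measure). For $\mu,\nu\in\mathcal{P}_p(\mathbb{R}^d)$, the $p$-Wasserstein distance is $W_p(\mu,\nu)=\min_{\gamma\in\Pi(\mu,\nu)}\big(\int|x-y|^p\,d\gamma(x,y)\big)^{1/p}$, where $\Pi(\mu,\nu)$ is the set of probability measures on $\mathbb{R}^d\times\mathbb{R}^d$ with first marginal $\mu$ and second marginal $\nu$. Wasserstein barycenter: for a nonempty finite set $E\subset\mathbb{N}$, measures $\mu_j\in\mathcal{P}_2(\mathbb{R}^d)$ and weights $\lambda_j>0$ ($j\in E$) with $\sum_{j\in E}\lambda_j=1$, $\operatorname{bar}(\{(\mu_j,\lambda_j)\}_{j\in E}):=\operatorname{argmin}_{\nu\in\mathcal{P}_2(\mathbb{R}^d)}\sum_{j\in E}\lambda_jW_2^2(\mu_j,\nu)$. Network and standing assumptions. The agents are indexed by $\mathcal{V}=\{1,\ldots,n\}$. (A1) For each $t\in\mathbb{N}_0$, $\mathcal{G}(t)=(\mathcal{V},\mathcal{E}(t))$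 is an undirected graph, i.e. $\mathcal{E}(t)\subset\mathcal{V}\times\mathcal{V}$ is symmetric, and $(i,i)\in\mathcal{E}(t)$ for all $i\in\mathcal{V}$. The neighbor set of $i$ at time $t$ is $\mathcal{N}_i(t)=\{j\in\mathcal{V}:(i,j)\in\mathcal{E}(t)\}$; thus $i\in\mathcal{N}_i(t)$. (A2) The weights $w_{ij}(t)$ are real numbers with $w_{ij}(t)>0$ if $(i,j)\in\mathcal{E}(t)$, $w_{ij}(t)=0$ otherwise, and $\sum_{j\in\mathcal{N}_i(t)}w_{ij}(t)=1$ for all $i\in\mathcal{V}$, $t\in\mathbb{N}_0$. (A3) There is a constant $\delta\in(0,1)$ such that $w_{ij}(t)\ge\delta$ whenever $j\in\mathcal{N}_i(t)$, for all $i,j\in\mathcal{V}$, $t\in\mathbb{N}_0$. (A4) There are integers $0=\tau_0<\tau_1<\tau_2<\cdots$ (an infinite sequence) with $\sup_i|\tau_i-\tau_{i-1}|=L<\infty$ such that for each $i\in\mathbb{N}_0$ the collection $\{\mathcal{G}(\tau_i),\ldots,\mathcal{G}(\tau_{i+1}-1)\}$ is jointly connected, meaning that the union graph $(\mathcal{V},\bigcup_{t=\tau_i}^{\tau_{i+1}-1}\mathcal{E}(t))$ is connected. *)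

theory Defs
  imports "HOL-Probability.Probability"
begin

definition prob_moment :: "real \<Rightarrow> 'a::euclidean_space measure set" where
  "prob_moment p =
    {\<mu>. prob_space \<mu> \<and> sets \<mu> = sets borel \<and> integrable \<mu> (\<lambda>x. norm x powr p)}"

definition prob_moment_ac :: "real \<Rightarrow> 'a::euclidean_space measure set" where
  "prob_moment_ac p = {\<mu> \<in> prob_moment p. absolutely_continuous lborel \<mu>}"

definition couplings ::
    "'a::euclidean_space measure \<Rightarrow> 'a measure \<Rightarrow> ('a \<times> 'a) measure set" where
  "couplings \<mu> \<nu> =
    {\<gamma>. prob_space \<gamma> \<and> sets \<gamma> = sets (borel \<Otimes>\<^sub>M borel) \<and>
        distr \<gamma> borel fst = \<mu> \<and> distr \<gamma> borel snd = \<nu>}"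

text \<open>
  Intended for \<open>p \<ge> 1\<close> and \<open>\<mu>\<close>, \<open>\<nu>\<close> in \<open>prob_moment p\<close>. Then there is a coupling (the product
  measure), the cost is integrable under every coupling, and the infimum is attained, so that
  it is the minimum. Outside \<open>prob_moment p\<close> the value has no meaning, since the Bochner integral
  of a non-integrable function is 0.
\<close>
definition wasserstein ::
    "real \<Rightarrow> 'a::euclidean_space measure \<Rightarrow> 'a measure \<Rightarrow> real" where
  "wasserstein p \<mu> \<nu> =
    (INF \<gamma>\<in>couplings \<mu> \<nu>. (LINT z|\<gamma>. norm (fst z - snd z) powr p) powr (1 / p))"

text \<open>The barycenter is an argmin, rendered as the set of all minimizers.\<close>
definition barycenters ::
    "nat set \<Rightarrow> (nat \<Rightarrow> 'a::euclidean_space measure) \<Rightarrow> (nat \<Rightarrow> real) \<Rightarrow> 'a measure set" where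
  "barycenters J \<mu> c =
    {\<nu>. is_arg_min (\<lambda>\<nu>'. \<Sum>j\<in>J. c j * (wasserstein 2 (\<mu> j) \<nu>')\<^sup>2)
          (\<lambda>\<nu>'. \<nu>' \<in> prob_moment 2) \<nu>}"

definition neighbors :: "nat set \<Rightarrow> (nat \<times> nat) set \<Rightarrow> nat \<Rightarrow> nat set" where
  "neighbors V E i = {j \<in> V. (i, j) \<in> E}"

text \<open>
  Used only for symmetric \<open>E \<subseteq> V \<times> V\<close>, where it says that any two vertices are joined by a path.
\<close>
definition connected_graph :: "nat set \<Rightarrow> (nat \<times> nat) set \<Rightarrow> bool" where
  "connected_graph V E \<longleftrightarrow> (\<forall>i\<in>V. \<forall>j\<in>V. (i, j) \<in> E\<^sup>*)"

text \<open>
  \<open>E t\<close> is the edge set at time \<open>t\<close> and \<open>w i j t\<close> the weight \<open>w\<^sub>i\<^sub>j(t)\<close>; values of \<open>w\<close> at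
  indices outside \<open>V\<close> are irrelevant.
\<close>
locale network =
  fixes V :: "nat set"
    and E :: "nat \<Rightarrow> (nat \<times> nat) set"
    and w :: "nat \<Rightarrow> nat \<Rightarrow> nat \<Rightarrow> real"
  assumes edges: "\<And>t. E t \<subseteq> V \<times> V"
    and sym_edges: "\<And>t. sym (E t)"
    and self_loops: "\<And>i t. i \<in> V \<Longrightarrow> (i, i) \<in> E t"
    and weight_pos: "\<And>i j t. (i, j) \<in> E t \<Longrightarrow> w i j t > 0"
    and weight_zero:
      "\<And>i j t. i \<in> V \<Longrightarrow> j \<in> V \<Longrightarrow> (i, j) \<notin> E t \<Longrightarrow> w i j t = 0"
    and weight_sum: "\<And>i t. i \<in> V \<Longrightarrow> (\<Sum>j\<in>neighbors V (E t) i. w i j t) = 1"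
    and weight_lower_bound:
      "\<exists>\<delta>. 0 < \<delta> \<and> \<delta> < 1 \<and> (\<forall>t. \<forall>i\<in>V. \<forall>j\<in>neighbors V (E t) i. \<delta> \<le> w i j t)"
    and jointly_connected:
      "\<exists>\<tau> :: nat \<Rightarrow> nat. \<tau> 0 = 0 \<and> strict_mono \<tau> \<and>
         bdd_above (range (\<lambda>i. \<tau> (Suc i) - \<tau> i)) \<and>
         (\<forall>i. connected_graph V (\<Union>t\<in>{\<tau> i..<\<tau> (Suc i)}. E t))"

end

theory Submission
  imports Defs
begin

text \<open>
  The proof tests the measures against convex functions. Let \<open>\<phi>\<close> be convex with subgradients of
  linear growth. If \<open>\<nu>\<close> is a barycenter of the \<open>\<mu> j\<close> with weights \<open>c j\<close>, then
  \<open>\<integral>\<phi> d\<nu> \<le> (\<Sum>j. c j * \<integral>\<phi> d\<mu> j)\<close> (\<open>barycenter_jensen\<close>). Hence the numbers \<open>\<integral>\<phi> d\<mu> i t\<close> obey a scalar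
  averaging inequality along the network. Whenever they are bounded below, connectivity over
  bounded windows forces them to converge to one limit that is common to all agents
  (\<open>averaging_below_consensus\<close>). This turns a consensus problem in a positively curved space into
  a linear one.

  There are enough such \<open>\<phi>\<close>. A bounded function \<open>f\<close> with bounded Lipschitz gradient becomes convex
  after adding a multiple of \<open>(norm x)\<^sup>2\<close>, which is convex itself; so \<open>\<integral>f d\<mu> i t\<close> has a common limit as
  well. The functions \<open>(max 0 (norm x - R))\<^sup>2\<close> show that the second moments stay uniformly
  integrable. On a uniformly square integrable set, the Wasserstein distance is small as soon as the
  masses of finitely many small bumps almost agree: mass is exchanged within the bumps, and the
  little that remains is transported arbitrarily (\<open>wasserstein_2_small_if_bumps_agree\<close>). The
  agents therefore approach each other and each of them is a Cauchy sequence; the limit exists because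
  the Wasserstein space is complete (\<open>wasserstein_2_complete\<close>).

  Jensen's inequality, the triangle inequality and completeness all need several couplings
  realized on one probability space. This is the purpose of \<open>tree_realization\<close>, which works with
  couplings that are optimal up to an arbitrarily small error.
\<close>

section \<open>Realizing several couplings on one probability space\<close>

text \<open>
  The cell of \<open>x\<close> is the index of the first point of a countable dense set that is close to \<open>x\<close>.
\<close>
lemma exists_countable_cell_map:
  fixes e :: real
  assumes "e > 0"
  obtains cell :: "'a::euclidean_space \<Rightarrow> nat"
  where "cell \<in> measurable borel (count_space UNIV)"
    and "\<And>x y. cell x = cell y \<Longrightarrow> dist x y < e"
proof -
  obtain D :: "'a set" where D: "countable D" "\<And>X. open X \<Longrightarrow> X \<noteq> {} \<Longrightarrow> \<exists>d\<in>D. d \<in> X"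
    using countable_dense_setE by metis
  have "D \<noteq> {}" using D(2)[of UNIV] by auto
  define d where "d = from_nat_into D"
  have near: "\<exists>n. dist x (d n) < e / 2" for x
  proof -
    obtain a where "a \<in> D" "a \<in> ball x (e/2)" using D(2)[of "ball x (e/2)"] assms by auto
    then show ?thesis
      by (metis D(1) d_def from_nat_into_surj mem_ball)
  qed
  define cell where "cell x = (LEAST n. dist x (d n) < e / 2)" for x
  have "cell \<in> measurable borel (count_space UNIV)"
    unfolding cell_def by measurable
  moreover have "dist x y < e" if "cell x = cell y" for x y
  proof -
    have "dist x (d (cell x)) < e/2" "dist y (d (cell y)) < e/2"
      unfolding cell_def using near LeastI_ex by (metis (mono_tags, lifting))+
    then show ?thesis using that by (metis dist_triangle_half_r dist_commute)
  qed
  ultimately show ?thesis using that by blast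
qed

lemma nn_integral_split_by_label:
  assumes c[measurable]: "c \<in> measurable M (count_space (UNIV::nat set))"
    and f[measurable]: "f \<in> borel_measurable M"
  shows "(\<integral>\<^sup>+x. f x \<partial>M) = (\<Sum>k. \<integral>\<^sup>+x. f x * indicator {x. c x = k} x \<partial>M)"
proof -
  have "f x = (\<Sum>k. f x * indicator {x. c x = k} x)" for x
    using suminf_finite[of "{c x}" "\<lambda>k. f x * indicator {x. c x = k} x"]
    by (simp add: indicator_def)
  then have "(\<integral>\<^sup>+x. f x \<partial>M) = (\<integral>\<^sup>+x. (\<Sum>k. f x * indicator {x. c x = k} x) \<partial>M)"
    by simp
  also have "\<dots> = (\<Sum>k. \<integral>\<^sup>+x. f x * indicator {x. c x = k} x \<partial>M)"
    by (rule nn_integral_suminf) measurable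
  finally show ?thesis .
qed

text \<open>
  A coupling can be traded for a Markov kernel at an arbitrarily small additional cost. Cut the space into countably many cells of diameter below \<open>d\<close> and let
  \<open>K x\<close> be the law of the second coordinate, given that the first one lies in the cell of \<open>x\<close>. Averaging
  \<open>K x\<close> over \<open>\<mu>\<close> still gives \<open>\<nu>\<close> exactly, because on every cell the conditional laws are
  averaged with their own weights. Only the joint law changes: \<open>x\<close> is replaced by a point of the same
  cell, which moves it by less than \<open>d\<close>.
\<close>
lemma coupling_approx_by_kernel:
  fixes \<gamma> :: "('a::euclidean_space \<times> 'a) measure"
  assumes \<gamma>: "\<gamma> \<in> couplings \<mu> \<nu>" and e: "e > 0"
    and fin: "(\<integral>\<^sup>+z. ennreal ((norm (fst z - snd z))\<^sup>2) \<partial>\<gamma>) = ennreal c" "c \<ge> 0"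
  obtains K where "K \<in> measurable borel (subprob_algebra borel)" "\<And>x. prob_space (K x)"
    and "\<And>f. f \<in> borel_measurable borel \<Longrightarrow> (\<integral>\<^sup>+x. \<integral>\<^sup>+y. f y \<partial>K x \<partial>\<mu>) = (\<integral>\<^sup>+y. f y \<partial>\<nu>)"
    and "(\<integral>\<^sup>+x. \<integral>\<^sup>+y. ennreal ((norm (x - y))\<^sup>2) \<partial>K x \<partial>\<mu>) \<le> ennreal (c + e)"
proof -
  interpret prob_space \<gamma> using \<gamma> by (auto simp: couplings_def)
  have s\<gamma>[measurable_cong]: "sets \<gamma> = sets (borel \<Otimes>\<^sub>M borel)"
    and \<mu>: "distr \<gamma> borel fst = \<mu>" and \<nu>: "distr \<gamma> borel snd = \<nu>" using \<gamma> by (auto simp: couplings_def)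
  \<comment> \<open>By Young's inequality, moving \<open>x\<close> by less than \<open>d\<close> turns the cost \<open>c\<close> into at most
    \<open>(1 + s) c + (1 + 1/s) d\<^sup>2\<close>; the parameters make each of the two errors at most \<open>e / 2\<close>.\<close>
  define s where "s = e / (2 * c + 2)"
  define d where "d = sqrt (e / (2 * (1 + 1 / s)))"
  have s: "s > 0" using e fin by (auto simp: s_def)
  have d: "d > 0" using s e by (simp add: d_def add_pos_pos)
  have "1 + 1/s > 0" using s by (simp add: add_pos_pos)
  moreover have "a * (sqrt (e / (2 * a)))\<^sup>2 = e / 2" if "a > 0" for a using that e by simp
  ultimately have d2: "(1 + 1/s) * d\<^sup>2 = e / 2" unfolding d_def by blast
  have sc: "s * c \<le> e / 2" using e fin(2) by (auto simp: s_def field_simps)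
  obtain cell :: "'a \<Rightarrow> nat" where cell[measurable]: "cell \<in> measurable borel (count_space UNIV)"
    and cd: "\<And>x y. cell x = cell y \<Longrightarrow> dist x y < d" using exists_countable_cell_map[OF d, where ?'a = 'a] by blast
  define Q where "Q k = {z \<in> space \<gamma>. cell (fst z) = k}" for k
  have Q[measurable]: "Q k \<in> sets \<gamma>" for k unfolding Q_def by measurable
  have sp: "space \<gamma> = UNIV" using sets_eq_imp_space_eq[OF s\<gamma>] by (simp add: space_pair_measure)
  \<comment> \<open>On null cells any probability measure will do; it only keeps the kernel Markov.\<close>
  define U where "U k = (if emeasure \<gamma> (Q k) = 0 then return \<gamma> (0, 0) else uniform_measure \<gamma> (Q k))" for k
  define L where "L k = distr (U k) borel snd" for k
  have sU[measurable_cong, simp]: "sets (U k) = sets (borel \<Otimes>\<^sub>M borel)" for k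
    by (simp add: U_def s\<gamma>)
  have UP: "prob_space (U k)" for k
    unfolding U_def using emeasure_finite
    by (auto intro!: prob_space_return prob_space_uniform_measure simp: sp)
  have LP: "prob_space (L k)" for k
    unfolding L_def by (rule prob_space.prob_space_distr[OF UP]) measurable
  have sL[measurable_cong, simp]: "sets (L k) = sets borel" for k by (simp add: L_def)
  have LM[measurable]: "L \<in> measurable (count_space UNIV) (subprob_algebra borel)"
    using LP by (auto simp: space_subprob_algebra prob_space_imp_subprob_space)
  define K where "K x = L (cell x)" for x
  have KM[measurable]: "K \<in> measurable borel (subprob_algebra borel)"
    unfolding K_def using measurable_compose[OF cell LM] .
  have mass: "(\<integral>\<^sup>+x. indicator {x. cell x = k} x \<partial>\<mu>) = emeasure \<gamma> (Q k)" for k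
  proof -
    have "(\<integral>\<^sup>+x. indicator {x. cell x = k} x \<partial>\<mu>) = (\<integral>\<^sup>+z. indicator (Q k) z \<partial>\<gamma>)"
      unfolding \<mu>[symmetric] by (subst nn_integral_distr) (auto simp: Q_def sp indicator_def intro!: nn_integral_cong)
    then show ?thesis by simp
  qed
  have cell_pos: "AE x in \<mu>. emeasure \<gamma> (Q (cell x)) \<noteq> 0"
  proof -
    have "AE x in \<mu>. cell x = k \<longrightarrow> emeasure \<gamma> (Q k) \<noteq> 0" for k
    proof (cases "emeasure \<gamma> (Q k) = 0")
      case True
      have "AE x in \<mu>. (indicator {x. cell x = k} x :: ennreal) = 0"
        using nn_integral_0_iff_AE[of "indicator {x. cell x = k}" \<mu>] mass[of k] True
        by (simp add: \<mu>[symmetric])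
      then show ?thesis by eventually_elim (auto simp: indicator_def split: if_splits)
    qed simp
    then have "AE x in \<mu>. \<forall>k. cell x = k \<longrightarrow> emeasure \<gamma> (Q k) \<noteq> 0"
      by (intro AE_all_countable[THEN iffD2] allI)
    then show ?thesis by eventually_elim auto
  qed
  have key: "(\<integral>\<^sup>+x. (\<integral>\<^sup>+z. F z \<partial>U (cell x)) * indicator {x. cell x = k} x \<partial>\<mu>)
    = (\<integral>\<^sup>+z. F z * indicator {z. cell (fst z) = k} z \<partial>\<gamma>)"
    if F[measurable]: "F \<in> borel_measurable (borel \<Otimes>\<^sub>M borel)" for F k
  proof -
    have I: "(\<integral>\<^sup>+x. (\<integral>\<^sup>+z. F z \<partial>U (cell x)) * indicator {x. cell x = k} x \<partial>\<mu>)
      = (\<integral>\<^sup>+z. F z \<partial>U k) * emeasure \<gamma> (Q k)"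
    proof -
      have "(\<integral>\<^sup>+x. (\<integral>\<^sup>+z. F z \<partial>U (cell x)) * indicator {x. cell x = k} x \<partial>\<mu>)
        = (\<integral>\<^sup>+x. (\<integral>\<^sup>+z. F z \<partial>U k) * indicator {x. cell x = k} x \<partial>\<mu>)"
        by (intro nn_integral_cong) (auto simp: indicator_def)
      also have "\<dots> = (\<integral>\<^sup>+z. F z \<partial>U k) * (\<integral>\<^sup>+x. indicator {x. cell x = k} x \<partial>\<mu>)"
        unfolding \<mu>[symmetric] by (rule nn_integral_cmult) measurable
      finally show ?thesis by (simp add: mass)
    qed
    have R: "(\<integral>\<^sup>+z. F z * indicator {z. cell (fst z) = k} z \<partial>\<gamma>) = (\<integral>\<^sup>+z. F z * indicator (Q k) z \<partial>\<gamma>)"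
      by (intro nn_integral_cong) (auto simp: Q_def sp indicator_def)
    show ?thesis
    proof (cases "emeasure \<gamma> (Q k) = 0")
      case True
      then have "AE z in \<gamma>. z \<notin> Q k"
        by (intro AE_I'[of "Q k"]) (auto simp: null_sets_def)
      then have "(\<integral>\<^sup>+z. F z * indicator (Q k) z \<partial>\<gamma>) = 0"
        by (subst nn_integral_0_iff_AE) (auto simp: indicator_def)
      then show ?thesis using I R True by simp
    next
      case False
      have "(\<integral>\<^sup>+z. F z \<partial>U k) = (\<integral>\<^sup>+z. F z * indicator (Q k) z \<partial>\<gamma>) / emeasure \<gamma> (Q k)"
        using False by (simp add: U_def nn_integral_uniform_measure)
      then show ?thesis unfolding I R using False emeasure_finite
        by (simp add: ennreal_divide_times ennreal_divide_self less_top[symmetric])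
    qed
  qed
  have total: "(\<integral>\<^sup>+x. \<integral>\<^sup>+z. F z \<partial>U (cell x) \<partial>\<mu>) = (\<integral>\<^sup>+z. F z \<partial>\<gamma>)"
    if F[measurable]: "F \<in> borel_measurable (borel \<Otimes>\<^sub>M borel)" for F
  proof -
    have "(\<integral>\<^sup>+x. \<integral>\<^sup>+z. F z \<partial>U (cell x) \<partial>\<mu>)
        = (\<Sum>k. \<integral>\<^sup>+x. (\<integral>\<^sup>+z. F z \<partial>U (cell x)) * indicator {x. cell x = k} x \<partial>\<mu>)"
      using measurable_compose[OF cell, of "\<lambda>k. \<integral>\<^sup>+z. F z \<partial>U k" borel]
      unfolding \<mu>[symmetric] by (intro nn_integral_split_by_label) auto
    also have "\<dots> = (\<Sum>k. \<integral>\<^sup>+z. F z * indicator {z. cell (fst z) = k} z \<partial>\<gamma>)"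
      by (simp add: key[OF F])
    also have "\<dots> = (\<integral>\<^sup>+z. F z \<partial>\<gamma>)"
      by (rule nn_integral_split_by_label[symmetric]) measurable
    finally show ?thesis .
  qed
  have KU: "(\<integral>\<^sup>+y. f y \<partial>K x) = (\<integral>\<^sup>+z. f (snd z) \<partial>U (cell x))"
    if "f \<in> borel_measurable borel" for f x
    unfolding K_def L_def using that by (subst nn_integral_distr) auto
  define G where "G z = ennreal ((1 + s) * (norm (fst z - snd z))\<^sup>2 + e / 2)" for z :: "'a \<times> 'a"
  have Gm[measurable]: "G \<in> borel_measurable (borel \<Otimes>\<^sub>M borel)" unfolding G_def by measurable
  have young: "(norm (x - y))\<^sup>2 \<le> (1 + s) * (norm (x' - y))\<^sup>2 + e / 2" if "dist x x' < d" for x x' y :: 'a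
  proof -
    have "norm (x - y) \<le> norm (x' - y) + d"
      using that norm_triangle_ineq[of "x' - y" "x - x'"] by (simp add: dist_norm)
    then have "(norm (x - y))\<^sup>2 \<le> (norm (x' - y) + d)\<^sup>2" by (simp add: power_mono)
    also have "\<dots> \<le> (1 + s) * (norm (x' - y))\<^sup>2 + (1 + 1/s) * d\<^sup>2"
    proof -
      have "0 \<le> (s * norm (x' - y) - d)\<^sup>2 / s" using s by simp
      also have "\<dots> = s * (norm (x' - y))\<^sup>2 - 2 * norm (x' - y) * d + d\<^sup>2 / s"
        using s by (simp add: field_simps power2_eq_square)
      finally show ?thesis by (simp add: algebra_simps power2_sum)
    qed
    finally show ?thesis using d2 by simp
  qed
  show ?thesis
  proof (rule that[of K])
    show "K \<in> measurable borel (subprob_algebra borel)" by fact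
    show "prob_space (K x)" for x using LP by (simp add: K_def)
    show "(\<integral>\<^sup>+x. \<integral>\<^sup>+y. f y \<partial>K x \<partial>\<mu>) = (\<integral>\<^sup>+y. f y \<partial>\<nu>)" if "f \<in> borel_measurable borel" for f
            using that KU[OF that] total[of "\<lambda>z. f (snd z)"] unfolding \<nu>[symmetric] by (simp add: nn_integral_distr)
    have "(\<integral>\<^sup>+x. \<integral>\<^sup>+y. ennreal ((norm (x - y))\<^sup>2) \<partial>K x \<partial>\<mu>) \<le> (\<integral>\<^sup>+x. \<integral>\<^sup>+z. G z \<partial>U (cell x) \<partial>\<mu>)"
      using cell_pos
    proof (intro nn_integral_mono_AE, eventually_elim)
      fix x assume pos: "emeasure \<gamma> (Q (cell x)) \<noteq> 0"
      have "AE z in U (cell x). z \<in> Q (cell x)"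
        using pos unfolding U_def by (simp, intro AE_uniform_measureI) auto
      then have "AE z in U (cell x). ennreal ((norm (x - snd z))\<^sup>2) \<le> G z"
        by eventually_elim (auto simp: Q_def G_def intro!: ennreal_leI young cd)
      then show "(\<integral>\<^sup>+y. ennreal ((norm (x - y))\<^sup>2) \<partial>K x) \<le> (\<integral>\<^sup>+z. G z \<partial>U (cell x))"
        by (subst KU) (auto intro!: nn_integral_mono_AE)
    qed
    also have "\<dots> = (\<integral>\<^sup>+z. G z \<partial>\<gamma>)" by (rule total) measurable
    also have "\<dots> = ennreal ((1 + s) * c + e / 2)"
    proof -
      have "(\<integral>\<^sup>+z. G z \<partial>\<gamma>) = (\<integral>\<^sup>+z. ennreal (1 + s) * ennreal ((norm (fst z - snd z))\<^sup>2) + ennreal (e / 2) \<partial>\<gamma>)"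
        unfolding G_def using s e by (intro nn_integral_cong) (simp add: ennreal_plus ennreal_mult)
      also have "\<dots> = ennreal (1 + s) * ennreal c + ennreal (e / 2)"
        by (subst nn_integral_add) (auto simp: nn_integral_cmult fin emeasure_space_1)
      finally show ?thesis using s e fin(2) by (simp add: ennreal_plus ennreal_mult)
    qed
    also have "\<dots> \<le> ennreal (c + e)" using sc by (intro ennreal_leI) (simp add: algebra_simps)
    finally show "(\<integral>\<^sup>+x. \<integral>\<^sup>+y. ennreal ((norm (x - y))\<^sup>2) \<partial>K x \<partial>\<mu>) \<le> ennreal (c + e)" .
  qed
qed

lemma prob_moment_2_iff:
  "\<mu> \<in> prob_moment 2 \<longleftrightarrow> prob_space \<mu> \<and> sets \<mu> = sets borel \<and> integrable \<mu> (\<lambda>x. (norm x)\<^sup>2)"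
proof -
  have "norm x powr 2 = (norm x)\<^sup>2" for x :: 'a
    by (cases "x = 0") (auto simp: powr_numeral)
  then show ?thesis by (simp add: prob_moment_def)
qed

lemma wasserstein_2_eq:
  "wasserstein 2 \<mu> \<nu> = (INF \<gamma>\<in>couplings \<mu> \<nu>. sqrt (LINT z|\<gamma>. (norm (fst z - snd z))\<^sup>2))"
proof -
  have "norm x powr 2 = (norm x)\<^sup>2" for x :: 'a
    by (cases "x = 0") (auto simp: powr_numeral)
  then show ?thesis unfolding wasserstein_def
    by (intro INF_cong refl) (simp add: powr_half_sqrt)
qed

lemma product_coupling:
  assumes "prob_space \<mu>" "prob_space \<nu>" "sets \<mu> = sets borel" "sets \<nu> = sets borel"
  shows "\<mu> \<Otimes>\<^sub>M \<nu> \<in> couplings \<mu> \<nu>"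
proof -
  interpret \<mu>: prob_space \<mu> by fact
  interpret \<nu>: prob_space \<nu> by fact
  interpret pair_prob_space \<mu> \<nu> ..
  have [measurable_cong]: "sets \<mu> = sets borel" "sets \<nu> = sets borel" by fact+
  have sp[simp]: "space \<mu> = UNIV" "space \<nu> = UNIV" 
    using sets_eq_imp_space_eq[OF assms(3)] sets_eq_imp_space_eq[OF assms(4)] by simp_all
  have "distr (\<mu> \<Otimes>\<^sub>M \<nu>) borel fst = \<mu>"
  proof (rule measure_eqI)
    fix A assume "A \<in> sets (distr (\<mu> \<Otimes>\<^sub>M \<nu>) borel fst)"
    then have [measurable]: "A \<in> sets borel" by simp
    have "fst -` A \<inter> space (\<mu> \<Otimes>\<^sub>M \<nu>) = A \<times> UNIV" by (auto simp: space_pair_measure)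
    then show "emeasure (distr (\<mu> \<Otimes>\<^sub>M \<nu>) borel fst) A = emeasure \<mu> A"
      using \<nu>.emeasure_space_1
      by (subst emeasure_distr) (auto simp: \<nu>.emeasure_pair_measure_Times assms)
  qed (simp add: assms)
  moreover have "distr (\<mu> \<Otimes>\<^sub>M \<nu>) borel snd = \<nu>"
  proof (rule measure_eqI)
    fix A assume "A \<in> sets (distr (\<mu> \<Otimes>\<^sub>M \<nu>) borel snd)"
    then have [measurable]: "A \<in> sets borel" by simp
    have "snd -` A \<inter> space (\<mu> \<Otimes>\<^sub>M \<nu>) = UNIV \<times> A" by (auto simp: space_pair_measure)
    then show "emeasure (distr (\<mu> \<Otimes>\<^sub>M \<nu>) borel snd) A = emeasure \<nu> A"
      using \<mu>.emeasure_space_1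
      by (subst emeasure_distr) (auto simp: \<nu>.emeasure_pair_measure_Times assms)
  qed (simp add: assms)
  ultimately show ?thesis
    unfolding couplings_def using assms by (auto intro: prob_space_axioms cong: sets_pair_measure_cong)
qed

lemma wasserstein_2_nonneg:
  assumes "\<mu> \<in> prob_moment 2" "\<nu> \<in> prob_moment 2"
  shows "0 \<le> wasserstein 2 \<mu> \<nu>"
  unfolding wasserstein_2_eq using product_coupling[of \<mu> \<nu>] assms
  by (intro cINF_greatest) (auto simp: prob_moment_2_iff)

lemma near_optimal_coupling:
  assumes "\<mu> \<in> prob_moment 2" "\<nu> \<in> prob_moment 2" "e > 0"
  obtains \<gamma> where "\<gamma> \<in> couplings \<mu> \<nu>"
    "(LINT z|\<gamma>. (norm (fst z - snd z))\<^sup>2) \<le> (wasserstein 2 \<mu> \<nu>)\<^sup>2 + e"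
proof -
  let ?W = "wasserstein 2 \<mu> \<nu>"
  have "couplings \<mu> \<nu> \<noteq> {}" using product_coupling[of \<mu> \<nu>] assms by (auto simp: prob_moment_2_iff)
  moreover have "?W < sqrt (?W\<^sup>2 + e)"
    using assms wasserstein_2_nonneg[OF assms(1,2)] by (intro real_less_rsqrt) simp
  ultimately obtain \<gamma> where "\<gamma> \<in> couplings \<mu> \<nu>"
    "sqrt (LINT z|\<gamma>. (norm (fst z - snd z))\<^sup>2) < sqrt (?W\<^sup>2 + e)"
    unfolding wasserstein_2_eq
    by (subst (asm) cINF_less_iff) (auto intro!: bdd_belowI2[of _ 0])
  then show ?thesis using that[of \<gamma>] by simp
qed

lemma wasserstein_2_sq_le:
  assumes "prob_space M" and [measurable]: "X \<in> borel_measurable M" "Y \<in> borel_measurable M"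
    and "distr M borel X = \<mu>" "distr M borel Y = \<nu>"
  shows "(wasserstein 2 \<mu> \<nu>)\<^sup>2 \<le> (LINT \<omega>|M. (norm (X \<omega> - Y \<omega>))\<^sup>2)"
proof -
  interpret prob_space M by fact
  let ?\<gamma> = "distr M (borel \<Otimes>\<^sub>M borel) (\<lambda>\<omega>. (X \<omega>, Y \<omega>))"
  have c: "?\<gamma> \<in> couplings \<mu> \<nu>"
    unfolding couplings_def using assms(4,5)
    by (auto intro!: prob_space_distr simp: distr_distr comp_def)
  have "wasserstein 2 \<mu> \<nu> \<le> sqrt (LINT z|?\<gamma>. (norm (fst z - snd z))\<^sup>2)"
    unfolding wasserstein_2_eq by (rule cINF_lower[OF _ c]) (auto intro!: bdd_belowI2[of _ 0])
  also have "(LINT z|?\<gamma>. (norm (fst z - snd z))\<^sup>2) = (LINT \<omega>|M. (norm (X \<omega> - Y \<omega>))\<^sup>2)"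
    by (subst integral_distr) auto
  finally have *: "wasserstein 2 \<mu> \<nu> \<le> sqrt (LINT \<omega>|M. (norm (X \<omega> - Y \<omega>))\<^sup>2)" .
  have 0: "0 \<le> wasserstein 2 \<mu> \<nu>"
    unfolding wasserstein_2_eq using c by (intro cINF_greatest) auto
  show "(wasserstein 2 \<mu> \<nu>)\<^sup>2 \<le> (LINT \<omega>|M. (norm (X \<omega> - Y \<omega>))\<^sup>2)"
    using power_mono[OF * 0, of 2] by simp
qed

lemma wasserstein_2_commute:
  assumes \<mu>: "\<mu> \<in> prob_moment 2" and \<nu>: "\<nu> \<in> prob_moment 2"
  shows "wasserstein 2 \<mu> \<nu> = wasserstein 2 \<nu> \<mu>"
proof -
  have *: "(wasserstein 2 \<nu> \<mu>)\<^sup>2 \<le> (wasserstein 2 \<mu> \<nu>)\<^sup>2"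
    if P: "\<mu> \<in> prob_moment 2" "\<nu> \<in> prob_moment 2" for \<mu> \<nu> :: "'a measure"
  proof (rule field_le_epsilon)
    fix e :: real assume "e > 0"
    then obtain \<gamma> where \<gamma>: "\<gamma> \<in> couplings \<mu> \<nu>"
      "(LINT z|\<gamma>. (norm (fst z - snd z))\<^sup>2) \<le> (wasserstein 2 \<mu> \<nu>)\<^sup>2 + e"
      using near_optimal_coupling[OF P] by blast
    have [measurable_cong]: "sets \<gamma> = sets (borel \<Otimes>\<^sub>M borel)" using \<gamma> by (simp add: couplings_def)
    have "(wasserstein 2 \<nu> \<mu>)\<^sup>2 \<le> (LINT z|\<gamma>. (norm (snd z - fst z))\<^sup>2)"
      using \<gamma>(1) by (intro wasserstein_2_sq_le) (auto simp: couplings_def)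
    then show "(wasserstein 2 \<nu> \<mu>)\<^sup>2 \<le> (wasserstein 2 \<mu> \<nu>)\<^sup>2 + e"
      using \<gamma>(2) by (simp add: norm_minus_commute)
  qed
  show ?thesis
    by (rule power2_eq_imp_eq[OF antisym[OF *[OF \<nu> \<mu>] *[OF \<mu> \<nu>]]
        wasserstein_2_nonneg[OF \<mu> \<nu>] wasserstein_2_nonneg[OF \<nu> \<mu>]])
qed

lemma norm_diff_sq_le: "(norm (x - y))\<^sup>2 \<le> 2 * (norm x)\<^sup>2 + 2 * (norm y)\<^sup>2" for x y :: "'a::real_normed_vector"
proof -
  have "(norm (x - y))\<^sup>2 \<le> (norm x + norm y)\<^sup>2" by (simp add: norm_triangle_ineq4 power_mono)
  also have "\<dots> \<le> 2 * (norm x)\<^sup>2 + 2 * (norm y)\<^sup>2"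
    using sum_squares_bound[of "norm x" "norm y"] by (simp add: power2_sum)
  finally show ?thesis .
qed

lemma integrable_norm_diff_sq:
  fixes X Y :: "'b \<Rightarrow> 'a::euclidean_space"
  assumes [measurable]: "X \<in> borel_measurable M" "Y \<in> borel_measurable M"
    and "integrable M (\<lambda>\<omega>. (norm (X \<omega>))\<^sup>2)" "integrable M (\<lambda>\<omega>. (norm (Y \<omega>))\<^sup>2)"
  shows "integrable M (\<lambda>\<omega>. (norm (X \<omega> - Y \<omega>))\<^sup>2)"
  by (rule Bochner_Integration.integrable_bound[of M "\<lambda>\<omega>. 2 * (norm (X \<omega>))\<^sup>2 + 2 * (norm (Y \<omega>))\<^sup>2"])
     (use assms norm_diff_sq_le in auto)

lemma integrable_of_law:
  fixes f :: "'a::euclidean_space \<Rightarrow> real"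
  assumes "X \<in> borel_measurable M" "distr M borel X = \<mu>" "integrable \<mu> f" "f \<in> borel_measurable borel"
  shows "integrable M (\<lambda>\<omega>. f (X \<omega>))"
  using assms integrable_distr_eq[of X M borel f] by auto

text \<open>
  Gluing of couplings along a tree. The vertices are the natural numbers and \<open>p i\<close> is the parent of
  \<open>Suc i\<close>, so that \<open>\<omega> (Suc i)\<close> can be drawn from a kernel that looks at \<open>\<omega> (p i)\<close> alone. The
  theorem of Ionescu-Tulcea provides the joint law of all coordinates. The constant map \<open>p = 0\<close>
  couples many measures to one (barycenters); the identity couples consecutive measures
  (triangle inequality, completeness).
\<close>
lemma tree_realization:
  fixes m :: "nat \<Rightarrow> 'a::euclidean_space measure" and p :: "nat \<Rightarrow> nat"
  assumes m: "\<And>i. m i \<in> prob_moment 2" and p: "\<And>i. p i \<le> i" and e: "\<And>i. 0 < e i"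
  obtains M :: "(nat \<Rightarrow> 'a) measure" where "prob_space M" "\<And>i. (\<lambda>\<omega>. \<omega> i) \<in> borel_measurable M"
    "\<And>i. distr M borel (\<lambda>\<omega>. \<omega> i) = m i"
    "\<And>i. (LINT \<omega>|M. (norm (\<omega> (p i) - \<omega> (Suc i)))\<^sup>2) \<le> (wasserstein 2 (m (p i)) (m (Suc i)))\<^sup>2 + e i"
proof -
  have mP: "prob_space (m i)" and mS: "sets (m i) = sets borel"
    and m2: "integrable (m i) (\<lambda>x. (norm x)\<^sup>2)" for i using m[of i] unfolding prob_moment_2_iff by auto
  let ?W = "\<lambda>i. (wasserstein 2 (m (p i)) (m (Suc i)))\<^sup>2"
  \<comment> \<open>Half of \<open>e i\<close> pays for a coupling that is only almost optimal, the other half for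
    replacing it by a kernel.\<close>
  define ok where "ok i K \<longleftrightarrow> K \<in> measurable borel (subprob_algebra borel) \<and> (\<forall>x. prob_space (K x)) \<and>
     (\<forall>f. f \<in> borel_measurable borel \<longrightarrow> (\<integral>\<^sup>+x. \<integral>\<^sup>+y. f y \<partial>K x \<partial>m (p i)) = (\<integral>\<^sup>+y. f y \<partial>m (Suc i))) \<and>
     (\<integral>\<^sup>+x. \<integral>\<^sup>+y. ennreal ((norm (x - y))\<^sup>2) \<partial>K x \<partial>m (p i)) \<le> ennreal (?W i + e i)" for i and K :: "'a \<Rightarrow> 'a measure"
  have "\<exists>K. ok i K" for i
  proof -
    obtain \<gamma> where \<gamma>: "\<gamma> \<in> couplings (m (p i)) (m (Suc i))"
      and c: "(LINT z|\<gamma>. (norm (fst z - snd z))\<^sup>2) \<le> ?W i + e i / 2"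
      by (rule near_optimal_coupling[OF m[of "p i"] m[of "Suc i"] half_gt_zero[OF e[of i]]])
    have s\<gamma>[measurable_cong]: "sets \<gamma> = sets (borel \<Otimes>\<^sub>M borel)"
      and laws: "distr \<gamma> borel fst = m (p i)" "distr \<gamma> borel snd = m (Suc i)" using \<gamma> by (auto simp: couplings_def)
    have int: "integrable \<gamma> (\<lambda>z. (norm (fst z - snd z))\<^sup>2)"
      by (intro integrable_norm_diff_sq integrable_of_law[OF _ laws(1) m2] integrable_of_law[OF _ laws(2) m2]) measurable
    obtain K where "K \<in> measurable borel (subprob_algebra borel)" "\<And>x. prob_space (K x)"
      "\<And>f. f \<in> borel_measurable borel \<Longrightarrow> (\<integral>\<^sup>+x. \<integral>\<^sup>+y. f y \<partial>K x \<partial>m (p i)) = (\<integral>\<^sup>+y. f y \<partial>m (Suc i))"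
      and b: "(\<integral>\<^sup>+x. \<integral>\<^sup>+y. ennreal ((norm (x - y))\<^sup>2) \<partial>K x \<partial>m (p i))
         \<le> ennreal ((LINT z|\<gamma>. (norm (fst z - snd z))\<^sup>2) + e i / 2)"
      by (rule coupling_approx_by_kernel[OF \<gamma> half_gt_zero[OF e[of i]] nn_integral_eq_integral[OF int]]) auto
    moreover have "ennreal ((LINT z|\<gamma>. (norm (fst z - snd z))\<^sup>2) + e i / 2) \<le> ennreal (?W i + e i)"
      using c by (intro ennreal_leI) simp
    ultimately have "ok i K" unfolding ok_def using order_trans by blast
    then show ?thesis by (intro exI[of _ K])
  qed
  then obtain K where K: "\<And>i. ok i (K i)" by metis
  have [measurable]: "K i \<in> measurable borel (subprob_algebra borel)" for i using K by (simp add: ok_def)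
  define P where "P i \<omega> = (case i of 0 \<Rightarrow> m 0 | Suc j \<Rightarrow> K j (\<omega> (p j)))" for i and \<omega> :: "nat \<Rightarrow> 'a"
  have PM: "P i \<in> measurable (PiM {0..<i} (\<lambda>_. borel)) (subprob_algebra borel)" for i
  proof (cases i)
    case 0
    then show ?thesis using mP[of 0] mS[of 0]
      by (simp add: P_def[abs_def] space_subprob_algebra prob_space_imp_subprob_space)
  next
    case (Suc j)
    have "p j \<in> {0..<i}" using p[of j] Suc by auto
    then have "(\<lambda>\<omega>. \<omega> (p j)) \<in> measurable (PiM {0..<i} (\<lambda>_. borel)) borel" by measurable
    then have "(\<lambda>\<omega>. K j (\<omega> (p j))) \<in> measurable (PiM {0..<i} (\<lambda>_. borel)) (subprob_algebra borel)"
      by (rule measurable_compose) measurable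
    then show ?thesis using Suc by (simp add: P_def[abs_def])
  qed
  have PP: "prob_space (P i \<omega>)" for i \<omega>
  proof (cases i)
    case (Suc j)
    then show ?thesis using K[of j] unfolding ok_def P_def by simp
  qed (simp add: P_def mP)
  interpret IT: Ionescu_Tulcea P "\<lambda>_. borel"
    by (rule Ionescu_Tulcea.intro, rule PM, rule PP)
  let ?M = "IT.PF.lim"
  have sM[measurable_cong]: "sets ?M = sets (PiM UNIV (\<lambda>_. borel))" by (rule IT.PF.sets_lim)
  interpret L: prob_space ?M
  proof (rule prob_space_distrD)
    show "(\<lambda>\<omega>. restrict \<omega> {}) \<in> measurable ?M (PiM {} (\<lambda>_. borel))" by measurable
    show "prob_space (distr ?M (PiM {} (\<lambda>_. borel)) (\<lambda>\<omega>. restrict \<omega> {}))"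
      unfolding IT.distr_lim[OF finite.emptyI] by (rule IT.PF.prob_space_P) auto
  qed
  have coord[measurable]: "(\<lambda>\<omega>. \<omega> i) \<in> borel_measurable ?M" for i
    by measurable
  have push: "(\<integral>\<^sup>+x. h x \<partial>distr ?M borel (\<lambda>\<omega>. \<omega> i)) = (\<integral>\<^sup>+\<omega>. h (\<omega> i) \<partial>?M)"
    if "h \<in> borel_measurable borel" for h :: "'a \<Rightarrow> ennreal" and i
    using that by (intro nn_integral_distr coord) simp
  have restr: "(\<integral>\<^sup>+\<omega>. f (restrict \<omega> {0..<n}) \<partial>?M) = (\<integral>\<^sup>+\<omega>. f \<omega> \<partial>IT.C 0 n (\<lambda>_. undefined))"
    if f[measurable]: "f \<in> borel_measurable (PiM {0..<n} (\<lambda>_. borel))" for f n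
  proof -
    have u: "IT.up_to {0..<n} = n"
    proof (rule antisym)
      show "IT.up_to {0..<n} \<le> n" by (subst IT.up_to_iff_Ico) auto
      show "n \<le> IT.up_to {0..<n}" using IT.up_to[of "{0..<n}"] by (cases "n = 0") auto
    qed
    have "(\<integral>\<^sup>+\<omega>. f (restrict \<omega> {0..<n}) \<partial>?M) = (\<integral>\<^sup>+\<omega>. f \<omega> \<partial>IT.CI {0..<n})"
      unfolding IT.distr_lim[symmetric, OF finite_atLeastLessThan]
      by (subst nn_integral_distr) auto
    also have "\<dots> = (\<integral>\<^sup>+\<omega>. f (restrict \<omega> {0..<n}) \<partial>IT.C 0 n (\<lambda>_. undefined))"
      unfolding IT.CI_def u
      by (subst nn_integral_distr) (auto cong: measurable_cong_sets simp: IT.sets_C)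
    also have "\<dots> = (\<integral>\<^sup>+\<omega>. f \<omega> \<partial>IT.C 0 n (\<lambda>_. undefined))"
      by (intro nn_integral_cong) (auto simp: IT.space_C space_PiM)
    finally show ?thesis .
  qed
  have step0: "(\<integral>\<^sup>+\<omega>. g (\<omega> 0) \<partial>?M) = (\<integral>\<^sup>+x. g x \<partial>m 0)"
    if g[measurable]: "g \<in> borel_measurable borel" for g
  proof -
    have "(\<integral>\<^sup>+\<omega>. g (\<omega> 0) \<partial>?M) = (\<integral>\<^sup>+\<omega>. g (restrict \<omega> {0..<Suc 0} 0) \<partial>?M)"
      by simp
    also have "\<dots> = (\<integral>\<^sup>+\<omega>. g (\<omega> 0) \<partial>IT.C 0 (Suc 0) (\<lambda>_. undefined))"
      by (rule restr) measurable
    also have "\<dots> = (\<integral>\<^sup>+\<omega>. g (\<omega> 0) \<partial>IT.eP 0 (\<lambda>_. undefined))"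
      using IT.measurable_eP[of 0] by (simp add: bind_return)
    also have "\<dots> = (\<integral>\<^sup>+x. g x \<partial>m 0)"
      by (subst IT.nn_integral_eP) (auto simp: P_def)
    finally show ?thesis .
  qed
  have KI: "(\<lambda>x. \<integral>\<^sup>+y. g x y \<partial>K i x) \<in> borel_measurable borel"
    if "case_prod g \<in> borel_measurable (borel \<Otimes>\<^sub>M borel)" for g :: "'a \<Rightarrow> 'a \<Rightarrow> ennreal" and i
    by (rule nn_integral_measurable_subprob_algebra2[where N = borel, OF that]) measurable
  have stepS: "(\<integral>\<^sup>+\<omega>. g (\<omega> (p i)) (\<omega> (Suc i)) \<partial>?M) = (\<integral>\<^sup>+\<omega>. \<integral>\<^sup>+y. g (\<omega> (p i)) y \<partial>K i (\<omega> (p i)) \<partial>?M)"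
    if g[measurable]: "case_prod g \<in> borel_measurable (borel \<Otimes>\<^sub>M borel)" for g i
  proof -
    have pi: "p i \<in> {0..<Suc i}" "p i \<in> {0..<Suc (Suc i)}" "p i \<noteq> Suc i" using p[of i] by auto
    have m1[measurable]: "(\<lambda>\<omega>. \<omega> (p i)) \<in> measurable (PiM {0..<Suc i} (\<lambda>_. borel)) borel"
      using pi by measurable
    have "(\<integral>\<^sup>+\<omega>. g (\<omega> (p i)) (\<omega> (Suc i)) \<partial>?M)
      = (\<integral>\<^sup>+\<omega>. (\<lambda>\<omega>. g (\<omega> (p i)) (\<omega> (Suc i))) (restrict \<omega> {0..<Suc (Suc i)}) \<partial>?M)"
      using pi by simp
    also have "\<dots> = (\<integral>\<^sup>+\<omega>. g (\<omega> (p i)) (\<omega> (Suc i)) \<partial>IT.C 0 (Suc (Suc i)) (\<lambda>_. undefined))"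
      using pi by (intro restr) measurable
    also have "\<dots> = (\<integral>\<^sup>+\<omega>. \<integral>\<^sup>+\<omega>'. g (\<omega>' (p i)) (\<omega>' (Suc i)) \<partial>IT.eP (Suc i) \<omega> \<partial>IT.C 0 (Suc i) (\<lambda>_. undefined))"
    proof -
      have "(\<lambda>\<omega>. g (\<omega> (p i)) (\<omega> (Suc i))) \<in> borel_measurable (PiM {0..<Suc (Suc i)} (\<lambda>_. borel))"
        using pi by measurable
      then show ?thesis
        unfolding IT.C.simps(2)[of 0 "Suc i"] using IT.measurable_eP[of "Suc i"] 
        by (subst nn_integral_bind[where B="PiM {0..<Suc (Suc i)} (\<lambda>_. borel)"])
           (auto cong: measurable_cong_sets simp: IT.sets_C simp del: IT.C.simps)
    qed
    also have "\<dots> = (\<integral>\<^sup>+\<omega>. \<integral>\<^sup>+y. g (\<omega> (p i)) y \<partial>K i (\<omega> (p i)) \<partial>IT.C 0 (Suc i) (\<lambda>_. undefined))"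
    proof (rule nn_integral_cong)
      fix \<omega> assume "\<omega> \<in> space (IT.C 0 (Suc i) (\<lambda>_. undefined))"
      then have \<omega>: "\<omega> \<in> space (PiM {0..<Suc i} (\<lambda>_. borel))" by (subst (asm) IT.space_C) auto
      have "(\<lambda>\<omega>. g (\<omega> (p i)) (\<omega> (Suc i))) \<in> borel_measurable (PiM {0..<Suc (Suc i)} (\<lambda>_. borel))"
        using pi by measurable
      then show "(\<integral>\<^sup>+\<omega>'. g (\<omega>' (p i)) (\<omega>' (Suc i)) \<partial>IT.eP (Suc i) \<omega>) = (\<integral>\<^sup>+y. g (\<omega> (p i)) y \<partial>K i (\<omega> (p i)))"
        using pi by (subst IT.nn_integral_eP[OF \<omega>]) (auto simp: P_def)
    qed
    also have "\<dots> = (\<integral>\<^sup>+\<omega>. (\<lambda>\<omega>. \<integral>\<^sup>+y. g (\<omega> (p i)) y \<partial>K i (\<omega> (p i))) (restrict \<omega> {0..<Suc i}) \<partial>?M)"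
      by (rule restr[OF measurable_compose[OF m1 KI[OF g]], symmetric])
    also have "\<dots> = (\<integral>\<^sup>+\<omega>. \<integral>\<^sup>+y. g (\<omega> (p i)) y \<partial>K i (\<omega> (p i)) \<partial>?M)"
      using pi by simp
    finally show ?thesis .
  qed
  have law: "distr ?M borel (\<lambda>\<omega>. \<omega> i) = m i" for i
  proof (induction i rule: less_induct)
    case (less i)
    have "(\<integral>\<^sup>+\<omega>. g (\<omega> i) \<partial>?M) = (\<integral>\<^sup>+x. g x \<partial>m i)" if g[measurable]: "g \<in> borel_measurable borel" for g
    proof (cases i)
      case 0 then show ?thesis using step0[OF g] by simp
    next
      case (Suc j)
      have pj: "distr ?M borel (\<lambda>\<omega>. \<omega> (p j)) = m (p j)" using less p[of j] Suc by simp
      have "(\<integral>\<^sup>+\<omega>. g (\<omega> i) \<partial>?M) = (\<integral>\<^sup>+\<omega>. \<integral>\<^sup>+y. g y \<partial>K j (\<omega> (p j)) \<partial>?M)"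
        using stepS[of "\<lambda>_ y. g y" j] Suc by simp
      also have "\<dots> = (\<integral>\<^sup>+x. \<integral>\<^sup>+y. g y \<partial>K j x \<partial>m (p j))"
        unfolding pj[symmetric] by (rule push[OF KI, symmetric]) measurable
      also have "\<dots> = (\<integral>\<^sup>+x. g x \<partial>m i)" using K[of j] g Suc by (auto simp: ok_def)
      finally show ?thesis .
    qed
    note * = this
    show ?case
    proof (rule measure_eqI)
      fix A assume "A \<in> sets (distr ?M borel (\<lambda>\<omega>. \<omega> i))"
      then have [measurable]: "A \<in> sets borel" by simp
      have "emeasure (distr ?M borel (\<lambda>\<omega>. \<omega> i)) A = (\<integral>\<^sup>+x. indicator A x \<partial>distr ?M borel (\<lambda>\<omega>. \<omega> i))"
        by simp
      also have "\<dots> = (\<integral>\<^sup>+\<omega>. indicator A (\<omega> i) \<partial>?M)" by (rule push) measurable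
      also have "\<dots> = emeasure (m i) A" using *[of "indicator A"] mS by simp
      finally show "emeasure (distr ?M borel (\<lambda>\<omega>. \<omega> i)) A = emeasure (m i) A" .
    qed (simp add: mS)
  qed
  have cost: "(LINT \<omega>|?M. (norm (\<omega> (p i) - \<omega> (Suc i)))\<^sup>2) \<le> ?W i + e i" for i
  proof -
    have "(\<integral>\<^sup>+\<omega>. ennreal ((norm (\<omega> (p i) - \<omega> (Suc i)))\<^sup>2) \<partial>?M)
       = (\<integral>\<^sup>+\<omega>. \<integral>\<^sup>+y. ennreal ((norm (\<omega> (p i) - y))\<^sup>2) \<partial>K i (\<omega> (p i)) \<partial>?M)"
      by (rule stepS) measurable
    also have "\<dots> = (\<integral>\<^sup>+x. \<integral>\<^sup>+y. ennreal ((norm (x - y))\<^sup>2) \<partial>K i x \<partial>m (p i))"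
      unfolding law[symmetric, of "p i"] by (rule push[OF KI, symmetric]) measurable
    also have "\<dots> \<le> ennreal (?W i + e i)" using K[of i] by (simp add: ok_def)
    finally show ?thesis
      using e[of i] by (intro integral_real_bounded) (auto intro: add_nonneg_nonneg less_imp_le)
  qed
  show ?thesis by (rule that[OF L.prob_space_axioms coord law cost])
qed

section \<open>Jensen's inequality for barycenters\<close>

text \<open>
  Convex functions with subgradients of at most linear growth. The growth condition makes the
  integral finite under every measure with second moment, and stable under small perturbations
  in mean square.
\<close>
definition subgradient_test_function :: "('a::euclidean_space \<Rightarrow> real) \<Rightarrow> bool" where
  "subgradient_test_function \<phi> \<longleftrightarrow> (\<exists>g C. \<forall>x. norm (g x) \<le> C * (1 + norm x) \<and>
     (\<forall>y. \<phi> x + g x \<bullet> (y - x) \<le> \<phi> y))"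

lemma subgradient_test_functionE:
  assumes "subgradient_test_function \<phi>"
  obtains g C where "C > 0" "\<And>x. norm (g x) \<le> C * (1 + norm x)"
    "\<And>x y. \<phi> x + g x \<bullet> (y - x) \<le> \<phi> y"
proof -
  obtain g C where g: "\<And>x. norm (g x) \<le> C * (1 + norm x)" "\<And>x y. \<phi> x + g x \<bullet> (y - x) \<le> \<phi> y"
    using assms by (auto simp: subgradient_test_function_def)
  have "norm (g x) \<le> max C 1 * (1 + norm x)" for x
    using g(1)[of x] mult_right_mono[of C "max C 1" "1 + norm x"] by simp
  then show ?thesis using that[of "max C 1" g] g by auto
qed

lemma subgradient_test_function_lipschitz:
  assumes "\<And>x. norm (g x) \<le> C * (1 + norm x)" "\<And>x y. \<phi> x + g x \<bullet> (y - x) \<le> \<phi> y" "C > 0"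
  shows "\<bar>\<phi> x - \<phi> y\<bar> \<le> C * (1 + norm x + norm y) * norm (x - y)"
proof -
  have *: "\<phi> x - \<phi> y \<le> C * (1 + norm x + norm y) * norm (x - y)" for x y
  proof -
    have "\<phi> x - \<phi> y \<le> g x \<bullet> (x - y)" using assms(2)[of x y] by (simp add: inner_diff_right)
    also have "\<dots> \<le> norm (g x) * norm (x - y)" by (rule norm_cauchy_schwarz)
    also have "\<dots> \<le> C * (1 + norm x + norm y) * norm (x - y)"
      using assms(1)[of x] assms(3)
      by (intro mult_right_mono order_trans[OF assms(1)] mult_left_mono) auto
    finally show ?thesis .
  qed
  show ?thesis using *[of x y] *[of y x] by (simp add: abs_le_iff norm_minus_commute algebra_simps)
qed

lemma subgradient_test_function_continuous:
  assumes "subgradient_test_function \<phi>"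
  shows "continuous_on UNIV \<phi>"
proof -
  obtain g C where g: "C > 0" "\<And>x. norm (g x) \<le> C * (1 + norm x)" "\<And>x y. \<phi> x + g x \<bullet> (y - x) \<le> \<phi> y"
    by (rule subgradient_test_functionE[OF assms]) (rule that)
  have "(\<phi> \<longlongrightarrow> \<phi> x) (at x)" for x
  proof -
    have "((\<lambda>y. C * (1 + norm y + norm x) * norm (y - x)) \<longlongrightarrow> C * (1 + norm x + norm x) * norm (x - x)) (at x)"
      by (intro tendsto_intros)
    then have lim: "((\<lambda>y. C * (1 + norm y + norm x) * norm (y - x)) \<longlongrightarrow> 0) (at x)" by simp
    have "norm (\<phi> y - \<phi> x) \<le> C * (1 + norm y + norm x) * norm (y - x)" for y
      unfolding real_norm_def by (rule subgradient_test_function_lipschitz[OF g(2,3,1)])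
    then have "((\<lambda>y. \<phi> y - \<phi> x) \<longlongrightarrow> 0) (at x)"
      by (intro Lim_null_comparison[OF _ lim] always_eventually allI)
    then show ?thesis by (simp add: LIM_zero_iff)
  qed
  then show ?thesis by (simp add: continuous_on_def)
qed

lemma subgradient_test_function_measurable:
  "subgradient_test_function \<phi> \<Longrightarrow> \<phi> \<in> borel_measurable borel"
  using subgradient_test_function_continuous by (rule borel_measurable_continuous_onI)

lemma subgradient_test_function_integrable:
  fixes \<phi> :: "'a::euclidean_space \<Rightarrow> real"
  assumes \<phi>: "subgradient_test_function \<phi>" and "\<mu> \<in> prob_moment 2"
  shows "integrable \<mu> \<phi>"
proof -
  interpret prob_space \<mu> using assms by (simp add: prob_moment_2_iff)
  have s: "sets \<mu> = sets borel" and i: "integrable \<mu> (\<lambda>x. (norm x)\<^sup>2)" using assms by (auto simp: prob_moment_2_iff)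
  obtain g C where g: "C > 0" "\<And>x. norm (g x) \<le> C * (1 + norm x)" "\<And>x y. \<phi> x + g x \<bullet> (y - x) \<le> \<phi> y"
    by (rule subgradient_test_functionE[OF \<phi>]) (rule that)
  have b: "norm (\<phi> x) \<le> \<bar>\<phi> 0\<bar> + 2 * C * (1 + (norm x)\<^sup>2)" for x
  proof -
    have "\<bar>\<phi> x\<bar> \<le> \<bar>\<phi> 0\<bar> + C * ((1 + norm x) * norm x)"
      using subgradient_test_function_lipschitz[OF g(2,3,1), of x 0] by (simp add: algebra_simps)
    also have "(1 + norm x) * norm x \<le> 2 * (1 + (norm x)\<^sup>2)"
      using zero_le_power2[of "norm x - 1 / 2"]
      by (simp add: algebra_simps power2_eq_square)
    finally show ?thesis using g(1) by (simp add: mult_left_mono algebra_simps)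
  qed
  show ?thesis
  proof (rule Bochner_Integration.integrable_bound)
    show "integrable \<mu> (\<lambda>x. \<bar>\<phi> 0\<bar> + 2 * C * (1 + (norm x)\<^sup>2))" using i by simp
    show "\<phi> \<in> borel_measurable \<mu>"
      using subgradient_test_function_measurable[OF \<phi>] s by (simp cong: measurable_cong_sets)
    show "AE x in \<mu>. norm (\<phi> x) \<le> norm (\<bar>\<phi> 0\<bar> + 2 * C * (1 + (norm x)\<^sup>2))"
      using b g(1) by (intro AE_I2) (smt (verit) real_norm_def)
  qed
qed

text \<open>
  The parallel axis identity: the mean square distance to \<open>y\<close> is the variance about the weighted mean
  \<open>z\<close> plus the squared distance from \<open>z\<close> to \<open>y\<close>.
\<close>
lemma weighted_square_split:
  fixes x :: "'i \<Rightarrow> 'a::real_inner"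
  assumes "finite J" "(\<Sum>j\<in>J. c j) = 1" and z: "z = (\<Sum>j\<in>J. c j *\<^sub>R x j)"
  shows "(\<Sum>j\<in>J. c j * (norm (x j - y))\<^sup>2) = (\<Sum>j\<in>J. c j * (norm (x j - z))\<^sup>2) + (norm (z - y))\<^sup>2"
proof -
  have "(norm (x j - y))\<^sup>2 = (norm (x j - z))\<^sup>2 + 2 * ((x j - z) \<bullet> (z - y)) + (norm (z - y))\<^sup>2" for j
    by (simp add: power2_norm_eq_inner algebra_simps inner_commute)
  then have "(\<Sum>j\<in>J. c j * (norm (x j - y))\<^sup>2) = (\<Sum>j\<in>J. c j * (norm (x j - z))\<^sup>2)
      + 2 * (\<Sum>j\<in>J. c j * ((x j - z) \<bullet> (z - y))) + (\<Sum>j\<in>J. c j) * (norm (z - y))\<^sup>2"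
    by (simp only: distrib_left sum.distrib sum_distrib_left sum_distrib_right mult.left_commute[of _ 2])
  also have "(\<Sum>j\<in>J. c j * ((x j - z) \<bullet> (z - y))) = (\<Sum>j\<in>J. c j *\<^sub>R (x j - z)) \<bullet> (z - y)"
    by (simp add: inner_sum_left)
  also have "(\<Sum>j\<in>J. c j *\<^sub>R (x j - z)) = 0"
    using assms by (simp add: scaleR_diff_right sum_subtractf scaleR_sum_left[symmetric])
  finally show ?thesis using assms by simp
qed

text \<open>
  Jensen's inequality for Wasserstein barycenters. Realize \<open>\<nu>\<close> as the law of \<open>Y\<close> and all \<open>\<mu> j\<close> as
  laws of \<open>X j\<close> on one probability space, each pair \<open>(Y, X j)\<close> being almost optimal, and put
  \<open>Z = (\<Sum>j\<in>J. c j *\<^sub>R X j)\<close>. The law of \<open>Z\<close> competes with \<open>\<nu>\<close> in the barycenter problem, and by the parallel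
  axis identity it is cheaper by the mean square of \<open>Z - Y\<close>. Minimality of \<open>\<nu>\<close> hence forces \<open>Z - Y\<close> to be
  small in mean square, and the claim is the pointwise convexity inequality at \<open>Z\<close>, up to an error
  which vanishes in the limit.
\<close>
lemma barycenter_jensen:
  fixes \<phi> :: "'a::euclidean_space \<Rightarrow> real" and J :: "nat set"
  assumes \<nu>: "\<nu> \<in> barycenters J \<mu> c" and J: "finite J" and c: "\<And>j. j \<in> J \<Longrightarrow> 0 \<le> c j" "(\<Sum>j\<in>J. c j) = 1"
    and \<mu>: "\<And>j. j \<in> J \<Longrightarrow> \<mu> j \<in> prob_moment 2" and \<phi>: "subgradient_test_function \<phi>"
  shows "(LINT x|\<nu>. \<phi> x) \<le> (\<Sum>j\<in>J. c j * (LINT x|\<mu> j. \<phi> x))"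
proof -
  have \<nu>2: "\<nu> \<in> prob_moment 2" 
    and opt: "\<And>\<nu>'. \<nu>' \<in> prob_moment 2 \<Longrightarrow>
      (\<Sum>j\<in>J. c j * (wasserstein 2 (\<mu> j) \<nu>)\<^sup>2) \<le> (\<Sum>j\<in>J. c j * (wasserstein 2 (\<mu> j) \<nu>')\<^sup>2)"
    using \<nu> by (auto simp: barycenters_def is_arg_min_def not_less)
  obtain g C where g: "C > 0" "\<And>x. norm (g x) \<le> C * (1 + norm x)" "\<And>x y. \<phi> x + g x \<bullet> (y - x) \<le> \<phi> y"
    by (rule subgradient_test_functionE[OF \<phi>]) (rule that)
  \<comment> \<open>Collects the two error terms of \<open>pointwise\<close> below, integrated and divided by \<open>s\<close>.\<close>
  define B where "B = C * (LINT x|\<nu>. 2 + (norm x)\<^sup>2) + C / 2"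
  have approx: "(LINT x|\<nu>. \<phi> x) \<le> (\<Sum>j\<in>J. c j * (LINT x|\<mu> j. \<phi> x)) + B * s" if s: "s > 0" for s :: real
  proof -
    \<comment> \<open>Coordinate \<open>0\<close> plays the role of \<open>Y\<close> and coordinate \<open>Suc j\<close> that of \<open>X j\<close>; the other
      coordinates are filled with copies of \<open>\<nu>\<close>.\<close>
    define m where "m i = (case i of 0 \<Rightarrow> \<nu> | Suc j \<Rightarrow> if j \<in> J then \<mu> j else \<nu>)" for i
    have m: "m i \<in> prob_moment 2" for i using \<mu> \<nu>2 by (auto simp: m_def split: nat.split)
    obtain M :: "(nat \<Rightarrow> 'a) measure" where M: "prob_space M" and coord[measurable]: "\<And>i. (\<lambda>\<omega>. \<omega> i) \<in> borel_measurable M"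
      and law: "\<And>i. distr M borel (\<lambda>\<omega>. \<omega> i) = m i"
      and cost: "\<And>i. (LINT \<omega>|M. (norm (\<omega> 0 - \<omega> (Suc i)))\<^sup>2) \<le> (wasserstein 2 (m 0) (m (Suc i)))\<^sup>2 + s\<^sup>2"
      using tree_realization[of m "\<lambda>_. 0" "\<lambda>_. s\<^sup>2", OF m] s by auto
    interpret prob_space M by fact
    define Z where "Z \<omega> = (\<Sum>j\<in>J. c j *\<^sub>R \<omega> (Suc j))" for \<omega> :: "nat \<Rightarrow> 'a"
    have Z[measurable]: "Z \<in> borel_measurable M" unfolding Z_def by measurable
    have sq: "integrable M (\<lambda>\<omega>. (norm (\<omega> i))\<^sup>2)" for i
      by (rule integrable_of_law[OF coord law]) (use m[of i] in \<open>auto simp: prob_moment_2_iff\<close>)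
    have split: "(\<Sum>j\<in>J. c j * (norm (\<omega> (Suc j) - y))\<^sup>2) = (\<Sum>j\<in>J. c j * (norm (\<omega> (Suc j) - Z \<omega>))\<^sup>2) + (norm (Z \<omega> - y))\<^sup>2" for \<omega> y
      by (rule weighted_square_split[OF J c(2)]) (simp add: Z_def)
    have sqZ: "integrable M (\<lambda>\<omega>. (norm (Z \<omega>))\<^sup>2)"
    proof (rule Bochner_Integration.integrable_bound)
      show "integrable M (\<lambda>\<omega>. \<Sum>j\<in>J. c j * (norm (\<omega> (Suc j)))\<^sup>2)" using sq by simp
      show "AE \<omega> in M. norm ((norm (Z \<omega>))\<^sup>2) \<le> norm (\<Sum>j\<in>J. c j * (norm (\<omega> (Suc j)))\<^sup>2)"
      proof (rule AE_I2)
        fix \<omega>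
        have "0 \<le> (\<Sum>j\<in>J. c j * (norm (\<omega> (Suc j) - Z \<omega>))\<^sup>2)" using c by (intro sum_nonneg) auto
        then show "norm ((norm (Z \<omega>))\<^sup>2) \<le> norm (\<Sum>j\<in>J. c j * (norm (\<omega> (Suc j)))\<^sup>2)"
          using split[of \<omega> 0] by simp
      qed
    qed measurable
    note diff = integrable_norm_diff_sq[OF _ _ sq sq] integrable_norm_diff_sq[OF _ _ sq sqZ] integrable_norm_diff_sq[OF _ _ sqZ sq]
    define \<zeta> where "\<zeta> = distr M borel Z"
    have \<zeta>: "\<zeta> \<in> prob_moment 2"
      unfolding prob_moment_2_iff \<zeta>_def using sqZ by (auto intro: prob_space_distr simp: integrable_distr_eq)
    have dist_ZY: "(LINT \<omega>|M. (norm (Z \<omega> - \<omega> 0))\<^sup>2) \<le> s\<^sup>2"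
    proof -
      have lawJ: "distr M borel (\<lambda>\<omega>. \<omega> (Suc j)) = \<mu> j" if "j \<in> J" for j using law[of "Suc j"] that by (simp add: m_def)
      have "(\<Sum>j\<in>J. c j * (LINT \<omega>|M. (norm (\<omega> (Suc j) - Z \<omega>))\<^sup>2)) + (LINT \<omega>|M. (norm (Z \<omega> - \<omega> 0))\<^sup>2)
        = (LINT \<omega>|M. (\<Sum>j\<in>J. c j * (norm (\<omega> (Suc j) - Z \<omega>))\<^sup>2) + (norm (Z \<omega> - \<omega> 0))\<^sup>2)"
        using diff by simp
      also have "\<dots> = (LINT \<omega>|M. (\<Sum>j\<in>J. c j * (norm (\<omega> (Suc j) - \<omega> 0))\<^sup>2))"
        unfolding split[symmetric] ..
      also have "\<dots> = (\<Sum>j\<in>J. c j * (LINT \<omega>|M. (norm (\<omega> (Suc j) - \<omega> 0))\<^sup>2))"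
        using diff by simp
      also have "\<dots> \<le> (\<Sum>j\<in>J. c j * ((wasserstein 2 (\<mu> j) \<nu>)\<^sup>2 + s\<^sup>2))"
      proof (intro sum_mono mult_left_mono c(1))
        fix j assume "j \<in> J"
        then have "(LINT \<omega>|M. (norm (\<omega> 0 - \<omega> (Suc j)))\<^sup>2) \<le> (wasserstein 2 \<nu> (\<mu> j))\<^sup>2 + s\<^sup>2"
          using cost[of j] by (simp add: m_def)
        then show "(LINT \<omega>|M. (norm (\<omega> (Suc j) - \<omega> 0))\<^sup>2) \<le> (wasserstein 2 (\<mu> j) \<nu>)\<^sup>2 + s\<^sup>2"
          using wasserstein_2_commute[OF \<nu>2 \<mu>[OF \<open>j \<in> J\<close>]] by (simp add: norm_minus_commute)
      qed
      also have "\<dots> = (\<Sum>j\<in>J. c j * (wasserstein 2 (\<mu> j) \<nu>)\<^sup>2) + s\<^sup>2"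
        using c(2) by (simp add: distrib_left sum.distrib sum_distrib_right[symmetric])
      also have "(\<Sum>j\<in>J. c j * (wasserstein 2 (\<mu> j) \<nu>)\<^sup>2) \<le> (\<Sum>j\<in>J. c j * (wasserstein 2 (\<mu> j) \<zeta>)\<^sup>2)"
        by (rule opt[OF \<zeta>])
      also have "\<dots> \<le> (\<Sum>j\<in>J. c j * (LINT \<omega>|M. (norm (\<omega> (Suc j) - Z \<omega>))\<^sup>2))"
        using lawJ by (intro sum_mono mult_left_mono c(1) wasserstein_2_sq_le[OF M]) (auto simp: \<zeta>_def)
      finally show ?thesis by simp
    qed
    have int\<phi>: "integrable M (\<lambda>\<omega>. \<phi> (\<omega> i))" for i
      by (rule integrable_of_law[OF coord law]) (use subgradient_test_function_integrable[OF \<phi> m] subgradient_test_function_measurable[OF \<phi>] in auto)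
    have law_int: "(LINT \<omega>|M. \<phi> (\<omega> i)) = (LINT x|m i. \<phi> x)" for i
      unfolding law[symmetric] using subgradient_test_function_measurable[OF \<phi>] by (subst integral_distr) auto
    have pointwise: "\<phi> (\<omega> 0) \<le> (\<Sum>j\<in>J. c j * \<phi> (\<omega> (Suc j))) + C * s * (2 + (norm (\<omega> 0))\<^sup>2) + C / (2 * s) * (norm (Z \<omega> - \<omega> 0))\<^sup>2" for \<omega>
    proof -
      have "\<phi> (Z \<omega>) = (\<Sum>j\<in>J. c j * (\<phi> (Z \<omega>) + g (Z \<omega>) \<bullet> (\<omega> (Suc j) - Z \<omega>)))"
      proof -
        have "(\<Sum>j\<in>J. c j * (g (Z \<omega>) \<bullet> (\<omega> (Suc j) - Z \<omega>))) = g (Z \<omega>) \<bullet> (\<Sum>j\<in>J. c j *\<^sub>R (\<omega> (Suc j) - Z \<omega>))"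
          by (simp add: inner_sum_right)
        also have "(\<Sum>j\<in>J. c j *\<^sub>R (\<omega> (Suc j) - Z \<omega>)) = 0"
          using c(2) by (simp add: scaleR_diff_right sum_subtractf scaleR_sum_left[symmetric] Z_def)
        finally show ?thesis using c(2) by (simp add: distrib_left sum.distrib sum_distrib_right[symmetric])
      qed
      also have "\<dots> \<le> (\<Sum>j\<in>J. c j * \<phi> (\<omega> (Suc j)))"
        by (intro sum_mono mult_left_mono g c(1))
      finally have 1: "\<phi> (Z \<omega>) \<le> (\<Sum>j\<in>J. c j * \<phi> (\<omega> (Suc j)))" .
      define n where "n = norm (\<omega> 0)"
      define k where "k = norm (Z \<omega> - \<omega> 0)"
      have "\<bar>g (\<omega> 0) \<bullet> (Z \<omega> - \<omega> 0)\<bar> \<le> norm (g (\<omega> 0)) * k" unfolding k_def by (rule Cauchy_Schwarz_ineq2)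
      also have "\<dots> \<le> C * ((1 + n) * k)"
        using g(2)[of "\<omega> 0"] mult_right_mono[of _ _ k] by (simp add: n_def k_def mult.assoc[symmetric] mult_right_mono)
      finally have "\<phi> (\<omega> 0) \<le> \<phi> (Z \<omega>) + C * ((1 + n) * k)" using g(3)[of "\<omega> 0" "Z \<omega>"] by linarith
      also have "(1 + n) * k \<le> s * (2 + n\<^sup>2) + k\<^sup>2 / (2 * s)"
      proof -
        have "0 \<le> (s * (1 + n) - k)\<^sup>2 / (2 * s)" using s by simp
        also have "\<dots> = s * (1 + n)\<^sup>2 / 2 - (1 + n) * k + k\<^sup>2 / (2 * s)"
          using s by (simp add: field_simps power2_eq_square)
        also have "s * (1 + n)\<^sup>2 / 2 \<le> s * (2 + n\<^sup>2)"
          using s sum_squares_bound[of 1 n] by (simp add: power2_sum)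
        finally show ?thesis by simp
      qed
      finally have "\<phi> (\<omega> 0) \<le> \<phi> (Z \<omega>) + C * (s * (2 + n\<^sup>2) + k\<^sup>2 / (2 * s))" using g(1) by simp
      then show ?thesis using 1 by (simp add: n_def k_def algebra_simps)
    qed
    have "(LINT x|\<nu>. \<phi> x) = (LINT \<omega>|M. \<phi> (\<omega> 0))" using law_int[of 0] by (simp add: m_def)
    also have "\<dots> \<le> (LINT \<omega>|M. (\<Sum>j\<in>J. c j * \<phi> (\<omega> (Suc j))) + C * s * (2 + (norm (\<omega> 0))\<^sup>2) + C / (2 * s) * (norm (Z \<omega> - \<omega> 0))\<^sup>2)"
      using int\<phi> sq diff by (intro integral_mono pointwise) auto
    also have "\<dots> = (\<Sum>j\<in>J. c j * (LINT \<omega>|M. \<phi> (\<omega> (Suc j)))) + C * s * (LINT \<omega>|M. 2 + (norm (\<omega> 0))\<^sup>2) + C / (2 * s) * (LINT \<omega>|M. (norm (Z \<omega> - \<omega> 0))\<^sup>2)"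
      using int\<phi> sq diff by simp
    also have "(\<Sum>j\<in>J. c j * (LINT \<omega>|M. \<phi> (\<omega> (Suc j)))) = (\<Sum>j\<in>J. c j * (LINT x|\<mu> j. \<phi> x))"
      unfolding law_int by (intro sum.cong) (auto simp: m_def)
    also have "(LINT \<omega>|M. 2 + (norm (\<omega> 0))\<^sup>2) = (LINT x|\<nu>. 2 + (norm x)\<^sup>2)"
    proof -
      have "\<nu> = distr M borel (\<lambda>\<omega>. \<omega> 0)" using law[of 0] by (simp add: m_def)
      then show ?thesis by (simp add: integral_distr)
    qed
    also have "C / (2 * s) * (LINT \<omega>|M. (norm (Z \<omega> - \<omega> 0))\<^sup>2) \<le> C / (2 * s) * s\<^sup>2"
      using g(1) s dist_ZY by (intro mult_left_mono) auto
    finally show ?thesis using s by (simp add: B_def algebra_simps power2_eq_square)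
  qed
  have "(\<lambda>k. (\<Sum>j\<in>J. c j * (LINT x|\<mu> j. \<phi> x)) + B * inverse (real (Suc k)))
     \<longlonglongrightarrow> (\<Sum>j\<in>J. c j * (LINT x|\<mu> j. \<phi> x)) + B * 0"
    by (intro tendsto_intros LIMSEQ_inverse_real_of_nat)
  then show ?thesis using approx by (intro LIMSEQ_le_const[of _ _ "LINT x|\<nu>. \<phi> x"]) auto
qed

section \<open>Test functions and smooth partitions of unity\<close>

lemma subgradient_test_function_norm_sq: "subgradient_test_function (\<lambda>x. (norm x)\<^sup>2)"
  unfolding subgradient_test_function_def
proof (intro exI[of _ "\<lambda>x. 2 *\<^sub>R x"] exI[of _ 2] allI conjI)
  fix x y :: 'a
  have "0 \<le> (norm (y - x))\<^sup>2" by simp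
  then show "(norm x)\<^sup>2 + 2 *\<^sub>R x \<bullet> (y - x) \<le> (norm y)\<^sup>2"
    by (simp add: power2_norm_eq_inner algebra_simps inner_commute)
qed simp

text \<open>
  These functions measure the second moment that is carried by the complement of a ball, so that their
  decay in \<open>R\<close> controls uniform integrability of \<open>(norm x)\<^sup>2\<close>.
\<close>
lemma subgradient_test_function_excess:
  assumes "0 \<le> R"
  shows "subgradient_test_function (\<lambda>x. (max 0 (norm x - R))\<^sup>2)"
  unfolding subgradient_test_function_def
proof (intro exI[of _ "\<lambda>x. (2 * max 0 (norm x - R)) *\<^sub>R sgn x"] exI[of _ 2] allI conjI)
  fix x y :: 'a
  show "norm ((2 * max 0 (norm x - R)) *\<^sub>R sgn x) \<le> 2 * (1 + norm x)"
    using assms norm_ge_zero[of x] by (simp add: norm_sgn max_def)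
  define u where "u = max 0 (norm x - R)"
  define v where "v = max 0 (norm y - R)"
  have "u * (sgn x \<bullet> (y - x)) \<le> u * (v - u)"
  proof (cases "u = 0")
    case False
    then have u: "u > 0" "u = norm x - R" "x \<noteq> 0" using assms by (auto simp: u_def max_def split: if_splits)
    have "sgn x \<bullet> x = norm x" using u by (simp add: sgn_div_norm dot_square_norm power2_eq_square)
    moreover have "sgn x \<bullet> y \<le> norm y" using norm_cauchy_schwarz[of "sgn x" y] u by (simp add: norm_sgn)
    ultimately have "sgn x \<bullet> (y - x) \<le> v - u" using u by (simp add: inner_diff_right v_def)
    then show ?thesis using u by (simp add: mult_left_mono)
  qed simp
  moreover have "u\<^sup>2 + 2 * (u * (v - u)) \<le> v\<^sup>2"
    using zero_le_power2[of "v - u"] by (simp add: power2_eq_square algebra_simps)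
  ultimately have "u\<^sup>2 + 2 * (u * (sgn x \<bullet> (y - x))) \<le> v\<^sup>2" by linarith
  then show "(max 0 (norm x - R))\<^sup>2 + (2 * max 0 (norm x - R)) *\<^sub>R sgn x \<bullet> (y - x) \<le> (max 0 (norm y - R))\<^sup>2"
    by (simp add: u_def v_def)
qed

text \<open>
  Bounded functions with bounded Lipschitz gradient, described by a two-sided Taylor estimate. The
  lower half of the estimate says that the function becomes convex after adding a multiple
  of \<open>(norm x)\<^sup>2\<close>; with both halves the class is an algebra, so that it contains bump functions.
\<close>
definition bounded_C11 :: "('a::euclidean_space \<Rightarrow> real) \<Rightarrow> bool" where
  "bounded_C11 f \<longleftrightarrow> (\<exists>g C. \<forall>x. \<bar>f x\<bar> \<le> C \<and> norm (g x) \<le> C \<and>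
     (\<forall>y. \<bar>f y - f x - g x \<bullet> (y - x)\<bar> \<le> C * (norm (y - x))\<^sup>2))"

lemma bounded_C11I:
  assumes "\<And>x. \<bar>f x\<bar> \<le> A" "\<And>x. norm (g x) \<le> B" "\<And>x y. \<bar>f y - f x - g x \<bullet> (y - x)\<bar> \<le> D * (norm (y - x))\<^sup>2"
  shows "bounded_C11 f"
proof -
  define C where "C = max A (max B D)"
  have "\<bar>f y - f x - g x \<bullet> (y - x)\<bar> \<le> C * (norm (y - x))\<^sup>2" for x y
    by (rule order_trans[OF assms(3)]) (simp add: C_def mult_right_mono)
  moreover have "\<bar>f x\<bar> \<le> C" "norm (g x) \<le> C" for x using assms(1,2)[of x] by (auto simp: C_def)
  ultimately show ?thesis unfolding bounded_C11_def by blast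
qed

text \<open>
  The Lipschitz bound comes from the Taylor estimate for \<open>norm (y - x) \<le> 1\<close> and from boundedness of
  \<open>f\<close> otherwise.
\<close>
lemma bounded_C11E:
  assumes "bounded_C11 f"
  obtains C g where "C \<ge> 0" "\<And>x. \<bar>f x\<bar> \<le> C" "\<And>x. norm (g x) \<le> C"
    "\<And>x y. \<bar>f y - f x - g x \<bullet> (y - x)\<bar> \<le> C * (norm (y - x))\<^sup>2" "\<And>x y. \<bar>f y - f x\<bar> \<le> 2 * C * norm (y - x)"
proof -
  obtain g C where gC: "\<And>x. \<bar>f x\<bar> \<le> C" "\<And>x. norm (g x) \<le> C"
    "\<And>x y. \<bar>f y - f x - g x \<bullet> (y - x)\<bar> \<le> C * (norm (y - x))\<^sup>2"
    using assms unfolding bounded_C11_def by blast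
  have C: "C \<ge> 0" using gC(1)[of 0] by linarith
  have "\<bar>f y - f x\<bar> \<le> 2 * C * norm (y - x)" for x y
  proof (cases "norm (y - x) \<le> 1")
    case True
    have "\<bar>g x \<bullet> (y - x)\<bar> \<le> norm (g x) * norm (y - x)" by (rule Cauchy_Schwarz_ineq2)
    also have "\<dots> \<le> C * norm (y - x)" using gC(2) by (simp add: mult_right_mono)
    finally have 1: "\<bar>g x \<bullet> (y - x)\<bar> \<le> C * norm (y - x)" .
    have "C * (norm (y - x))\<^sup>2 \<le> C * norm (y - x)"
      using True C mult_left_le[of "norm (y - x)" "norm (y - x)"] by (intro mult_left_mono) (auto simp: power2_eq_square)
    then show ?thesis using 1 gC(3)[of y x] by linarith
  next
    case False
    then have "2 * C * 1 \<le> 2 * C * norm (y - x)" using C by (intro mult_left_mono) auto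
    then show ?thesis using gC(1)[of x] gC(1)[of y] by linarith
  qed
  then show ?thesis using that[of C g] gC C by blast
qed

lemma bounded_C11_const: "bounded_C11 (\<lambda>_. c)"
  by (rule bounded_C11I[of _ "\<bar>c\<bar>" "\<lambda>_. 0" 0 0]) auto

lemma bounded_C11_add:
  assumes "bounded_C11 f" "bounded_C11 h" shows "bounded_C11 (\<lambda>x. f x + h x)"
proof -
  obtain C g where f: "C \<ge> 0" "\<And>x. \<bar>f x\<bar> \<le> C" "\<And>x. norm (g x) \<le> C"
    "\<And>x y. \<bar>f y - f x - g x \<bullet> (y - x)\<bar> \<le> C * (norm (y - x))\<^sup>2" "\<And>x y. \<bar>f y - f x\<bar> \<le> 2 * C * norm (y - x)"
    by (rule bounded_C11E[OF assms(1)]) (rule that)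
  obtain D k where h: "D \<ge> 0" "\<And>x. \<bar>h x\<bar> \<le> D" "\<And>x. norm (k x) \<le> D"
    "\<And>x y. \<bar>h y - h x - k x \<bullet> (y - x)\<bar> \<le> D * (norm (y - x))\<^sup>2" "\<And>x y. \<bar>h y - h x\<bar> \<le> 2 * D * norm (y - x)"
    by (rule bounded_C11E[OF assms(2)]) (rule that)
  show ?thesis
  proof (rule bounded_C11I)
    show "\<bar>f x + h x\<bar> \<le> C + D" for x using f(2)[of x] h(2)[of x] by linarith
    show "norm (g x + k x) \<le> C + D" for x using f(3) h(3) by (rule norm_triangle_mono)
    show "\<bar>f y + h y - (f x + h x) - (g x + k x) \<bullet> (y - x)\<bar> \<le> (C + D) * (norm (y - x))\<^sup>2" for x y
      using f(4)[of y x] h(4)[of y x] unfolding inner_add_left distrib_right by linarith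
  qed
qed

lemma bounded_C11_mult:
  assumes "bounded_C11 f" "bounded_C11 h" shows "bounded_C11 (\<lambda>x. f x * h x)"
proof -
  obtain C g where f: "C \<ge> 0" "\<And>x. \<bar>f x\<bar> \<le> C" "\<And>x. norm (g x) \<le> C"
    "\<And>x y. \<bar>f y - f x - g x \<bullet> (y - x)\<bar> \<le> C * (norm (y - x))\<^sup>2" "\<And>x y. \<bar>f y - f x\<bar> \<le> 2 * C * norm (y - x)"
    by (rule bounded_C11E[OF assms(1)]) (rule that)
  obtain D k where h: "D \<ge> 0" "\<And>x. \<bar>h x\<bar> \<le> D" "\<And>x. norm (k x) \<le> D"
    "\<And>x y. \<bar>h y - h x - k x \<bullet> (y - x)\<bar> \<le> D * (norm (y - x))\<^sup>2" "\<And>x y. \<bar>h y - h x\<bar> \<le> 2 * D * norm (y - x)"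
    by (rule bounded_C11E[OF assms(2)]) (rule that)
  show ?thesis
  proof (rule bounded_C11I)
    fix x y
    show "\<bar>f x * h x\<bar> \<le> C * D" unfolding abs_mult using f h by (intro mult_mono) auto
    have "norm (f x *\<^sub>R k x) \<le> C * D" unfolding norm_scaleR using f h by (intro mult_mono) auto
    moreover have "norm (h x *\<^sub>R g x) \<le> D * C" unfolding norm_scaleR using f h by (intro mult_mono) auto
    ultimately show "norm (f x *\<^sub>R k x + h x *\<^sub>R g x) \<le> C * D + D * C" by (rule norm_triangle_mono)
    define n where "n = (norm (y - x))\<^sup>2"
    have 1: "\<bar>(f y - f x) * (h y - h x)\<bar> \<le> (2 * C * norm (y - x)) * (2 * D * norm (y - x))"
      unfolding abs_mult using f(5) h(5) f(1) by (intro mult_mono) auto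
    have 2: "\<bar>f x * (h y - h x - k x \<bullet> (y - x))\<bar> \<le> C * (D * n)"
      unfolding abs_mult n_def using f(2) h(4) f(1) by (intro mult_mono) auto
    have 3: "\<bar>h x * (f y - f x - g x \<bullet> (y - x))\<bar> \<le> D * (C * n)"
      unfolding abs_mult n_def using h(2) f(4) h(1) by (intro mult_mono) auto
    have "f y * h y - f x * h x - (f x *\<^sub>R k x + h x *\<^sub>R g x) \<bullet> (y - x)
      = (f y - f x) * (h y - h x) + f x * (h y - h x - k x \<bullet> (y - x)) + h x * (f y - f x - g x \<bullet> (y - x))"
      by (simp add: inner_add_left algebra_simps)
    then have "\<bar>f y * h y - f x * h x - (f x *\<^sub>R k x + h x *\<^sub>R g x) \<bullet> (y - x)\<bar>
      \<le> (2 * C * norm (y - x)) * (2 * D * norm (y - x)) + C * (D * n) + D * (C * n)"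
      using 1 2 3 by linarith
    also have "\<dots> = (6 * C * D) * n" by (simp add: n_def power2_eq_square)
    finally show "\<bar>f y * h y - f x * h x - (f x *\<^sub>R k x + h x *\<^sub>R g x) \<bullet> (y - x)\<bar> \<le> (6 * C * D) * (norm (y - x))\<^sup>2"
      by (simp add: n_def)
  qed
qed

lemma bounded_C11_diff:
  assumes "bounded_C11 f" "bounded_C11 h" shows "bounded_C11 (\<lambda>x. f x - h x)"
  using bounded_C11_add[OF assms(1) bounded_C11_mult[OF bounded_C11_const[of "-1"] assms(2)]] by simp

lemma bounded_C11_prod:
  "finite I \<Longrightarrow> (\<And>i. i \<in> I \<Longrightarrow> bounded_C11 (f i)) \<Longrightarrow> bounded_C11 (\<lambda>x. \<Prod>i\<in>I. f i x)"
  by (induction I rule: finite_induct) (auto intro: bounded_C11_const bounded_C11_mult)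

lemma positive_part_sq_taylor:
  fixes u v :: real
  shows "\<bar>(max 0 v)\<^sup>2 - (max 0 u)\<^sup>2 - 2 * max 0 u * (v - u)\<bar> \<le> (v - u)\<^sup>2"
proof -
  consider "u \<ge> 0" "v \<ge> 0" | "u < 0" "v < 0" | "u \<ge> 0" "v < 0" | "u < 0" "v \<ge> 0" by linarith
  then show ?thesis
  proof cases
    case 1
    then have "(max 0 v)\<^sup>2 - (max 0 u)\<^sup>2 - 2 * max 0 u * (v - u) = (v - u)\<^sup>2"
      by (simp add: power2_eq_square algebra_simps)
    then show ?thesis by simp
  next
    case 3
    have e: "(max 0 v)\<^sup>2 - (max 0 u)\<^sup>2 - 2 * max 0 u * (v - u) = (v - u)\<^sup>2 - v\<^sup>2"
      using 3 by (simp add: power2_eq_square algebra_simps)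
    have "v\<^sup>2 \<le> (v - u)\<^sup>2 * 1" using 3 power_mono[of "-v" "u - v" 2] by (simp add: power2_commute)
    then show ?thesis unfolding e by (simp add: abs_le_iff)
  next
    case 4
    have "v\<^sup>2 \<le> (v - u)\<^sup>2" using 4 by (intro power_mono) auto
    then show ?thesis using 4 by simp
  qed simp
qed

text \<open>
  The square of the positive part has a Lipschitz derivative and truncates to exactly zero. It
  turns strictly decaying functions into compactly supported ones.
\<close>
lemma bounded_C11_positive_part_sq:
  assumes "bounded_C11 f" shows "bounded_C11 (\<lambda>x. (max 0 (f x))\<^sup>2)"
proof -
  obtain C g where f: "C \<ge> 0" "\<And>x. \<bar>f x\<bar> \<le> C" "\<And>x. norm (g x) \<le> C"
    "\<And>x y. \<bar>f y - f x - g x \<bullet> (y - x)\<bar> \<le> C * (norm (y - x))\<^sup>2" "\<And>x y. \<bar>f y - f x\<bar> \<le> 2 * C * norm (y - x)"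
    by (rule bounded_C11E[OF assms(1)]) (rule that)
  have p: "\<bar>max 0 (f x)\<bar> \<le> C" for x using f(2)[of x] f(1) by auto
  show ?thesis
  proof (rule bounded_C11I)
    fix x y
    show "\<bar>(max 0 (f x))\<^sup>2\<bar> \<le> C\<^sup>2" using power_mono[OF p[of x], of 2] by simp
    show "norm ((2 * max 0 (f x)) *\<^sub>R g x) \<le> (2 * C) * C"
      unfolding norm_scaleR using p[of x] f by (intro mult_mono) auto
    have "(f y - f x)\<^sup>2 \<le> (2 * C * norm (y - x))\<^sup>2" using power_mono[OF f(5)[of y x], of 2] by simp
    then have 1: "\<bar>(max 0 (f y))\<^sup>2 - (max 0 (f x))\<^sup>2 - 2 * max 0 (f x) * (f y - f x)\<bar> \<le> 4 * C\<^sup>2 * (norm (y - x))\<^sup>2"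
      using positive_part_sq_taylor[of "f y" "f x"] by (simp add: power_mult_distrib)
    have 2: "\<bar>(2 * max 0 (f x)) * (f y - f x - g x \<bullet> (y - x))\<bar> \<le> (2 * C) * (C * (norm (y - x))\<^sup>2)"
      unfolding abs_mult[of "2 * max 0 (f x)"] using p[of x] f(4)[of y x] f(1) by (intro mult_mono) auto
    have "(max 0 (f y))\<^sup>2 - (max 0 (f x))\<^sup>2 - ((2 * max 0 (f x)) *\<^sub>R g x) \<bullet> (y - x)
      = ((max 0 (f y))\<^sup>2 - (max 0 (f x))\<^sup>2 - 2 * max 0 (f x) * (f y - f x)) + (2 * max 0 (f x)) * (f y - f x - g x \<bullet> (y - x))"
      by (simp add: algebra_simps)
    also have "\<bar>\<dots>\<bar> \<le> 4 * C\<^sup>2 * (norm (y - x))\<^sup>2 + (2 * C) * (C * (norm (y - x))\<^sup>2)"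
      by (rule order_trans[OF abs_triangle_ineq add_mono[OF 1 2]])
    finally show "\<bar>(max 0 (f y))\<^sup>2 - (max 0 (f x))\<^sup>2 - ((2 * max 0 (f x)) *\<^sub>R g x) \<bullet> (y - x)\<bar> \<le> (6 * C\<^sup>2) * (norm (y - x))\<^sup>2"
      by (simp add: power2_eq_square)
  qed
qed

text \<open>
  The seed of the bump functions: a bounded function that decreases strictly with the distance
  to \<open>p\<close>.
\<close>
lemma bounded_C11_inverse_quadratic: "bounded_C11 (\<lambda>x. 1 / (1 + (norm (x - p))\<^sup>2))"
proof (rule bounded_C11I[where A = 1 and B = 1 and D = 9 and g = "\<lambda>x. (- 2 / (1 + (norm (x - p))\<^sup>2)\<^sup>2) *\<^sub>R (x - p)"])
  fix x y :: 'a
  define u where "u = norm (x - p)"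
  define v where "v = norm (y - p)"
  define n where "n = norm (y - x)"
  define i where "i = (x - p) \<bullet> (y - x)"
  have [simp]: "u \<ge> 0" "v \<ge> 0" "n \<ge> 0" by (auto simp: u_def v_def n_def)
  define S where "S = 1 + u\<^sup>2"
  define T where "T = 1 + v\<^sup>2"
  have S: "S \<ge> 1" and T: "T \<ge> 1" by (auto simp: S_def T_def)
  have u2: "2 * u \<le> S" using zero_le_power2[of "u - 1"] by (simp add: S_def power2_diff)
  show "\<bar>1 / (1 + (norm (x - p))\<^sup>2)\<bar> \<le> 1" by (simp add: add_pos_nonneg)
  have "2 * u \<le> S\<^sup>2" using u2 mult_mono[of 1 S "2 * u" S] S by (simp add: power2_eq_square)
  then show "norm ((- 2 / (1 + (norm (x - p))\<^sup>2)\<^sup>2) *\<^sub>R (x - p)) \<le> 1"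
    using S unfolding u_def[symmetric] S_def[symmetric] norm_scaleR by simp
  have vS: "v\<^sup>2 = u\<^sup>2 + 2 * i + n\<^sup>2"
    unfolding u_def v_def n_def i_def by (simp add: power2_norm_eq_inner algebra_simps inner_commute)
  have i: "\<bar>i\<bar> \<le> u * n" unfolding i_def u_def n_def by (rule Cauchy_Schwarz_ineq2)
  have nuv: "n \<le> u + v"
    using norm_triangle_ineq4[of "y - p" "x - p"] by (simp add: u_def v_def n_def)
  have TS: "T = S + 2 * i + n\<^sup>2" by (simp add: S_def T_def vS)
  have id: "1 / T - 1 / S + 2 * i / S\<^sup>2 = (4 * i\<^sup>2 + 2 * i * n\<^sup>2) / (S\<^sup>2 * T) - n\<^sup>2 / (S * T)"
  proof -
    have "1 / T - 1 / S + 2 * i / S\<^sup>2 = (S\<^sup>2 - S * T + 2 * i * T) / (S\<^sup>2 * T)"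
      using S T by (simp add: field_simps power2_eq_square)
    also have "S\<^sup>2 - S * T + 2 * i * T = (4 * i\<^sup>2 + 2 * i * n\<^sup>2) - S * n\<^sup>2"
      by (simp add: TS power2_eq_square algebra_simps)
    also have "((4 * i\<^sup>2 + 2 * i * n\<^sup>2) - S * n\<^sup>2) / (S\<^sup>2 * T)
        = (4 * i\<^sup>2 + 2 * i * n\<^sup>2) / (S\<^sup>2 * T) - n\<^sup>2 / (S * T)"
      using S by (subst diff_divide_distrib) (simp add: power2_eq_square)
    finally show ?thesis .
  qed
  have "i\<^sup>2 \<le> (u * n)\<^sup>2" using power_mono[OF i, of 2] by simp
  also have "\<dots> \<le> (S\<^sup>2 * T) * n\<^sup>2"
  proof -
    have "u\<^sup>2 \<le> S * S * T" using S T mult_mono[of 1 "S * T" "u\<^sup>2" S] mult_mono[of 1 S 1 T] by (simp add: S_def mult.commute mult.left_commute)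
    then show ?thesis unfolding power_mult_distrib by (intro mult_right_mono) (auto simp: power2_eq_square)
  qed
  finally have i2: "4 * i\<^sup>2 \<le> 4 * ((S\<^sup>2 * T) * n\<^sup>2)" by simp
  have "\<bar>2 * i * n\<^sup>2\<bar> \<le> 2 * (u * n) * n\<^sup>2" using i by (simp add: abs_mult mult_right_mono)
  also have "2 * (u * n) \<le> 2 * (u * (u + v))" using nuv by (simp add: mult_left_mono)
  also have "\<dots> \<le> 4 * (S\<^sup>2 * T)"
  proof -
    have "2 * (u * v) \<le> u\<^sup>2 + v\<^sup>2" using sum_squares_bound[of u v] by (simp add: mult.assoc)
    then have "2 * (u * (u + v)) \<le> 3 * S + T"
      by (simp add: S_def T_def algebra_simps power2_eq_square)
    also have "\<dots> \<le> 4 * (S\<^sup>2 * T)"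
    proof -
      have "1 \<le> S * T" "1 \<le> S * S" using mult_mono[of 1 S 1 T] mult_mono[of 1 S 1 S] S T by auto
      then have "S * 1 \<le> S * (S * T)" "1 * T \<le> (S * S) * T" using S T by (auto intro: mult_left_mono mult_right_mono)
      then show ?thesis by (simp add: power2_eq_square mult.assoc)
    qed
    finally show ?thesis .
  qed
  finally have i3: "\<bar>2 * i * n\<^sup>2\<bar> \<le> 4 * ((S\<^sup>2 * T) * n\<^sup>2)" by (simp add: mult_right_mono)
  have 8: "\<bar>(4 * i\<^sup>2 + 2 * i * n\<^sup>2) / (S\<^sup>2 * T)\<bar> \<le> 8 * n\<^sup>2"
  proof -
    have "\<bar>4 * i\<^sup>2\<bar> \<le> 4 * ((S\<^sup>2 * T) * n\<^sup>2)" using i2 by simp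
    from order_trans[OF abs_triangle_ineq add_mono[OF this i3]]
    have "\<bar>4 * i\<^sup>2 + 2 * i * n\<^sup>2\<bar> \<le> 8 * n\<^sup>2 * (S\<^sup>2 * T)"
      by (simp add: mult.commute mult.left_commute)
    then show ?thesis using S T by (simp add: abs_divide pos_divide_le_eq)
  qed
  have 1: "\<bar>n\<^sup>2 / (S * T)\<bar> \<le> n\<^sup>2"
    using S T mult_mono[of 1 S 1 T] mult_left_mono[of 1 "S * T" "n\<^sup>2"] by (simp add: abs_divide divide_le_eq)
  have "\<bar>1 / T - 1 / S + 2 * i / S\<^sup>2\<bar> \<le> 8 * n\<^sup>2 + n\<^sup>2" unfolding id
    by (rule order_trans[OF abs_triangle_ineq4 add_mono[OF 8 1]])
  then show "\<bar>1 / (1 + (norm (y - p))\<^sup>2) - 1 / (1 + (norm (x - p))\<^sup>2) - ((- 2 / (1 + (norm (x - p))\<^sup>2)\<^sup>2) *\<^sub>R (x - p)) \<bullet> (y - x)\<bar> \<le> 9 * (norm (y - x))\<^sup>2"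
    by (simp add: S_def T_def u_def v_def n_def i_def)
qed

text \<open>
  Truncate the seed from below at its value \<open>c\<close> at distance \<open>e\<close>, which produces the zeros, and then from above
  at the level that it reaches at distance \<open>e / 2\<close>, which produces the plateau.
\<close>
lemma bump_function:
  fixes p :: "'a::euclidean_space"
  assumes e: "e > 0"
  obtains \<beta> where "bounded_C11 \<beta>" "\<And>x. 0 \<le> \<beta> x" "\<And>x. \<beta> x \<le> 1"
    "\<And>x. dist x p \<le> e / 2 \<Longrightarrow> \<beta> x = 1" "\<And>x. e \<le> dist x p \<Longrightarrow> \<beta> x = 0"
proof -
  define f where "f x = 1 / (1 + (norm (x - p))\<^sup>2)" for x :: 'a
  define c where "c = 1 / (1 + e\<^sup>2)"
  define c' where "c' = 1 / (1 + (e / 2)\<^sup>2)"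
  define a where "a = 1 / (c' - c)\<^sup>2"
  define \<beta> where "\<beta> x = 1 - (max 0 (1 - a * (max 0 (f x - c))\<^sup>2))\<^sup>2" for x
  have "(e / 2)\<^sup>2 < e\<^sup>2" using e by (simp add: power2_eq_square)
  then have cc: "c < c'" unfolding c_def c'_def by (intro divide_strict_left_mono mult_pos_pos) (auto intro: add_pos_nonneg)
  then have a: "a > 0" by (simp add: a_def)
  have "bounded_C11 f" unfolding f_def by (rule bounded_C11_inverse_quadratic)
  then have "bounded_C11 \<beta>" unfolding \<beta>_def
    by (intro bounded_C11_diff bounded_C11_const bounded_C11_positive_part_sq bounded_C11_mult)
  moreover have "0 \<le> \<beta> x \<and> \<beta> x \<le> 1" for x
  proof -
    have "max 0 (1 - a * (max 0 (f x - c))\<^sup>2) \<le> 1" using a by simp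
    then have "(max 0 (1 - a * (max 0 (f x - c))\<^sup>2))\<^sup>2 \<le> 1" by (simp add: power_le_one)
    then show ?thesis by (simp add: \<beta>_def)
  qed
  moreover have "\<beta> x = 1" if "dist x p \<le> e / 2" for x
  proof -
    have "(norm (x - p))\<^sup>2 \<le> (e / 2)\<^sup>2" using that by (intro power_mono) (auto simp: dist_norm)
    then have "c' \<le> f x" unfolding f_def c'_def by (intro divide_left_mono mult_pos_pos) (auto intro: add_pos_nonneg)
    then have "(c' - c)\<^sup>2 \<le> (max 0 (f x - c))\<^sup>2" using cc by (intro power_mono) auto
    then have "a * (c' - c)\<^sup>2 \<le> a * (max 0 (f x - c))\<^sup>2" using a by (intro mult_left_mono) auto
    then show ?thesis using cc by (simp add: \<beta>_def a_def)
  qed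
  moreover have "\<beta> x = 0" if "e \<le> dist x p" for x
  proof -
    have "e\<^sup>2 \<le> (norm (x - p))\<^sup>2" using that e by (intro power_mono) (auto simp: dist_norm)
    then have "f x \<le> c" unfolding f_def c_def by (intro divide_left_mono mult_pos_pos) (auto intro: add_pos_nonneg)
    then show ?thesis by (simp add: \<beta>_def)
  qed
  ultimately show ?thesis using that by blast
qed

text \<open>
  With bumps \<open>B p\<close> at the points of a finite net of the ball, each \<open>h k\<close> takes the share \<open>B (p k)\<close> of what
  the earlier bumps have left over. What remains at the end is \<open>(\<Prod>l<K. 1 - B (p l) x)\<close>, which vanishes
  wherever some bump is \<open>1\<close>.
\<close>
lemma smooth_partition:
  fixes R e :: real
  assumes e: "e > 0"
  obtains K :: nat and h :: "nat \<Rightarrow> 'a::euclidean_space \<Rightarrow> real"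
  where "\<And>k. bounded_C11 (h k)" "\<And>k x. 0 \<le> h k x" "\<And>x. (\<Sum>k<K. h k x) \<le> 1"
    "\<And>x. norm x \<le> R \<Longrightarrow> (\<Sum>k<K. h k x) = 1"
    "\<And>k x y. h k x \<noteq> 0 \<Longrightarrow> h k y \<noteq> 0 \<Longrightarrow> dist x y < e"
proof -
  have "\<forall>p::'a. \<exists>\<beta>. bounded_C11 \<beta> \<and> (\<forall>x. 0 \<le> \<beta> x \<and> \<beta> x \<le> 1 \<and>
    (dist x p \<le> e / 4 \<longrightarrow> \<beta> x = 1) \<and> (e / 2 \<le> dist x p \<longrightarrow> \<beta> x = 0))"
  proof
    fix p :: 'a
    have "e / 2 > 0" using e by simp
    then obtain \<beta> where "bounded_C11 \<beta>" "\<And>x. 0 \<le> \<beta> x" "\<And>x. \<beta> x \<le> 1"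
      "\<And>x. dist x p \<le> e / 2 / 2 \<Longrightarrow> \<beta> x = 1" "\<And>x. e / 2 \<le> dist x p \<Longrightarrow> \<beta> x = 0"
      by (rule bump_function[of "e / 2" p]) (rule that)
    then show "\<exists>\<beta>. bounded_C11 \<beta> \<and> (\<forall>x. 0 \<le> \<beta> x \<and> \<beta> x \<le> 1 \<and>
      (dist x p \<le> e / 4 \<longrightarrow> \<beta> x = 1) \<and> (e / 2 \<le> dist x p \<longrightarrow> \<beta> x = 0))"
      by (intro exI[of _ \<beta>]) simp
  qed
  then obtain B where B: "\<And>p::'a. bounded_C11 (B p)" "\<And>p x. 0 \<le> B p x" "\<And>p x. B p x \<le> 1"
    "\<And>p x. dist x p \<le> e / 4 \<Longrightarrow> B p x = 1" "\<And>p x. e / 2 \<le> dist x p \<Longrightarrow> B p x = 0" by metis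
  obtain Q :: "'a set" where Q: "finite Q" "cball 0 R \<subseteq> (\<Union>p\<in>Q. ball p (e / 4))"
  proof -
    have "compact (cball (0::'a) R)" by simp
    then show ?thesis
      using compactE_image[of "cball (0::'a) R" UNIV "\<lambda>p. ball p (e / 4)"] e that
      by (metis (no_types, lifting) UNIV_I UN_I centre_in_ball open_ball subsetI zero_less_divide_iff zero_less_numeral)
  qed
  define K where "K = card Q"
  obtain p where p: "bij_betw p {..<K} Q"
    using ex_bij_betw_nat_finite[OF Q(1)] by (auto simp: K_def atLeast0LessThan)
  define h where "h k x = B (p k) x * (\<Prod>l<k. 1 - B (p l) x)" for k x
  have sum: "(\<Sum>k<m. h k x) = 1 - (\<Prod>l<m. 1 - B (p l) x)" for m x
    by (induction m) (auto simp: h_def algebra_simps)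
  have pr: "0 \<le> (\<Prod>l<m. 1 - B (p l) x)" for m x by (intro prod_nonneg) (simp add: B)
  show ?thesis
  proof (rule that[of h K])
    show "bounded_C11 (h k)" for k unfolding h_def
      by (intro bounded_C11_mult bounded_C11_prod bounded_C11_diff bounded_C11_const B) auto
    show "0 \<le> h k x" for k x unfolding h_def using pr B(2) by simp
    show "(\<Sum>k<K. h k x) \<le> 1" for x unfolding sum using pr by simp
    show "(\<Sum>k<K. h k x) = 1" if "norm x \<le> R" for x
    proof -
      have "x \<in> (\<Union>p\<in>Q. ball p (e / 4))" using Q(2) that by (auto simp only: mem_cball_0 subset_iff)
      then obtain q where q: "q \<in> Q" "dist q x < e / 4" by auto
      then obtain l where "l < K" "q = p l" using p by (auto simp: bij_betw_def)
      then have "\<exists>l\<in>{..<K}. 1 - B (p l) x = 0" using q B(4)[of x q] by (auto simp: dist_commute)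
      then show ?thesis unfolding sum by (simp add: prod_zero)
    qed
    show "dist x y < e" if "h k x \<noteq> 0" "h k y \<noteq> 0" for k x y
    proof -
      have "dist x (p k) < e / 2" "dist y (p k) < e / 2"
        using that B(5)[of x "p k"] B(5)[of y "p k"] by (auto simp: h_def not_le[symmetric])
      then show ?thesis by (metis dist_commute dist_triangle_half_l)
    qed
  qed
qed

text \<open>
  Because of \<open>(norm y)\<^sup>2 = (norm x)\<^sup>2 + 2 * (x \<bullet> (y - x)) + (norm (y - x))\<^sup>2\<close>, the quadratic term absorbs the
  Taylor error exactly.
\<close>
lemma bounded_C11_plus_norm_sq:
  assumes "bounded_C11 f"
  obtains C where "0 \<le> C" "\<And>x. \<bar>f x\<bar> \<le> C" "subgradient_test_function (\<lambda>x. f x + C * (norm x)\<^sup>2)"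
proof -
  obtain C g where f: "C \<ge> 0" "\<And>x. \<bar>f x\<bar> \<le> C" "\<And>x. norm (g x) \<le> C"
    "\<And>x y. \<bar>f y - f x - g x \<bullet> (y - x)\<bar> \<le> C * (norm (y - x))\<^sup>2" "\<And>x y. \<bar>f y - f x\<bar> \<le> 2 * C * norm (y - x)"
    by (rule bounded_C11E[OF assms]) (rule that)
  have "subgradient_test_function (\<lambda>x. f x + C * (norm x)\<^sup>2)"
    unfolding subgradient_test_function_def
  proof (intro exI[of _ "\<lambda>x. g x + (2 * C) *\<^sub>R x"] exI[of _ "2 * C"] allI conjI)
    fix x y
    have "norm (g x + (2 * C) *\<^sub>R x) \<le> C + (2 * C) * norm x"
      using f(1,3) by (intro norm_triangle_mono) auto
    then show "norm (g x + (2 * C) *\<^sub>R x) \<le> 2 * C * (1 + norm x)" using f(1) by (simp add: algebra_simps)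
    have "C * (norm y)\<^sup>2 - C * (norm x)\<^sup>2 - (2 * C) * (x \<bullet> (y - x)) = C * (norm (y - x))\<^sup>2"
      by (simp add: power2_norm_eq_inner algebra_simps inner_commute)
    then show "f x + C * (norm x)\<^sup>2 + (g x + (2 * C) *\<^sub>R x) \<bullet> (y - x) \<le> f y + C * (norm y)\<^sup>2"
      using f(4)[of y x] unfolding inner_add_left inner_scaleR_left by linarith
  qed
  then show ?thesis by (rule that[OF f(1,2)])
qed

lemma bounded_C11_measurable: "bounded_C11 f \<Longrightarrow> f \<in> borel_measurable borel"
proof -
  assume "bounded_C11 f"
  then obtain C where C: "subgradient_test_function (\<lambda>x. f x + C * (norm x)\<^sup>2)"
    by (rule bounded_C11_plus_norm_sq) (rule that)
  have "(\<lambda>x. (f x + C * (norm x)\<^sup>2) - C * (norm x)\<^sup>2) \<in> borel_measurable borel"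
    by (rule borel_measurable_diff[OF subgradient_test_function_measurable[OF C]]) measurable
  then show ?thesis by simp
qed

lemma bounded_C11_integrable:
  assumes f: "bounded_C11 f" and \<mu>: "prob_space \<mu>" "sets \<mu> = sets borel"
  shows "integrable \<mu> f"
proof -
  interpret prob_space \<mu> by fact
  obtain C where C: "\<And>x. \<bar>f x\<bar> \<le> C" by (rule bounded_C11_plus_norm_sq[OF f]) (rule that)
  have "f \<in> borel_measurable \<mu>" using bounded_C11_measurable[OF f] \<mu>(2) by (simp cong: measurable_cong_sets)
  then show ?thesis using C by (intro integrable_const_bound[of _ C]) auto
qed

section \<open>Coupling measures that give similar mass to small bumps\<close>

text \<open>Outside the ball of radius \<open>2 * R\<close>, the norm is at most twice the excess over \<open>R\<close>.\<close>
lemma excess_moment_bound: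
  fixes x :: "'a::real_normed_vector"
  assumes "0 \<le> R"
  shows "(norm x)\<^sup>2 \<le> 4 * R\<^sup>2 + 4 * (max 0 (norm x - R))\<^sup>2"
proof (cases "norm x \<le> 2 * R")
  case True
  then have "(norm x)\<^sup>2 \<le> (2 * R)\<^sup>2" by (intro power_mono) auto
  then show ?thesis by (simp add: power_mult_distrib add_increasing2)
next
  case False
  then have "(norm x)\<^sup>2 \<le> (2 * max 0 (norm x - R))\<^sup>2" using assms by (intro power_mono) auto
  then show ?thesis by (simp add: power_mult_distrib add_increasing)
qed

lemma integral_product_measure_mult:
  fixes f :: "'a \<Rightarrow> real" and g :: "'b \<Rightarrow> real"
  assumes "prob_space \<mu>" "prob_space \<nu>" and f: "integrable \<mu> f" and g: "integrable \<nu> g"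
  shows "integrable (\<mu> \<Otimes>\<^sub>M \<nu>) (\<lambda>z. f (fst z) * g (snd z))"
    and "(LINT z|(\<mu> \<Otimes>\<^sub>M \<nu>). f (fst z) * g (snd z)) = (LINT x|\<mu>. f x) * (LINT y|\<nu>. g y)"
proof -
  interpret \<mu>: prob_space \<mu> by fact
  interpret \<nu>: prob_space \<nu> by fact
  interpret pair_prob_space \<mu> \<nu> ..
  have [measurable]: "f \<in> borel_measurable \<mu>" "g \<in> borel_measurable \<nu>" using f g by auto
  show i: "integrable (\<mu> \<Otimes>\<^sub>M \<nu>) (\<lambda>z. f (fst z) * g (snd z))"
    by (rule Fubini_integrable) (use f g in \<open>auto simp: abs_mult\<close>)
  show "(LINT z|(\<mu> \<Otimes>\<^sub>M \<nu>). f (fst z) * g (snd z)) = (LINT x|\<mu>. f x) * (LINT y|\<nu>. g y)"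
    using integral_fst'[OF i] by simp
qed

lemma density_coupling:
  fixes D :: "'a::euclidean_space \<times> 'a \<Rightarrow> ennreal"
  assumes \<mu>: "prob_space \<mu>" "sets \<mu> = sets borel" and \<nu>: "prob_space \<nu>" "sets \<nu> = sets borel"
    and D[measurable]: "D \<in> borel_measurable (borel \<Otimes>\<^sub>M borel)"
    and m1: "AE x in \<mu>. (\<integral>\<^sup>+y. D (x, y) \<partial>\<nu>) = 1" and m2: "AE y in \<nu>. (\<integral>\<^sup>+x. D (x, y) \<partial>\<mu>) = 1"
  shows "density (\<mu> \<Otimes>\<^sub>M \<nu>) D \<in> couplings \<mu> \<nu>"
proof -
  interpret \<mu>: prob_space \<mu> by fact
  interpret \<nu>: prob_space \<nu> by fact
  interpret pair_prob_space \<mu> \<nu> ..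
  have [measurable_cong]: "sets \<mu> = sets borel" "sets \<nu> = sets borel" by fact+
  let ?G = "density (\<mu> \<Otimes>\<^sub>M \<nu>) D"
  have fst: "distr ?G borel fst = \<mu>"
  proof (rule measure_eqI)
    fix A assume "A \<in> sets (distr ?G borel fst)"
    then have A[measurable]: "A \<in> sets borel" by simp
    have "emeasure (distr ?G borel fst) A = (\<integral>\<^sup>+x. indicator A x \<partial>distr ?G borel fst)" by simp
    also have "\<dots> = (\<integral>\<^sup>+z. D z * indicator A (fst z) \<partial>(\<mu> \<Otimes>\<^sub>M \<nu>))"
      by (subst nn_integral_distr, measurable, subst nn_integral_density) auto
    also have "\<dots> = (\<integral>\<^sup>+x. \<integral>\<^sup>+y. D (x, y) * indicator A x \<partial>\<nu> \<partial>\<mu>)"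
      by (subst \<nu>.nn_integral_fst[symmetric]) auto
    also have "\<dots> = (\<integral>\<^sup>+x. indicator A x \<partial>\<mu>)"
    proof (rule nn_integral_cong_AE)
      show "AE x in \<mu>. (\<integral>\<^sup>+y. D (x, y) * indicator A x \<partial>\<nu>) = indicator A x"
        using m1 by eventually_elim (simp add: nn_integral_multc)
    qed
    finally show "emeasure (distr ?G borel fst) A = emeasure \<mu> A" using \<mu>(2) by simp
  qed (simp add: \<mu>)
  have snd: "distr ?G borel snd = \<nu>"
  proof (rule measure_eqI)
    fix A assume "A \<in> sets (distr ?G borel snd)"
    then have A[measurable]: "A \<in> sets borel" by simp
    have "emeasure (distr ?G borel snd) A = (\<integral>\<^sup>+x. indicator A x \<partial>distr ?G borel snd)" by simp
    also have "\<dots> = (\<integral>\<^sup>+z. D z * indicator A (snd z) \<partial>(\<mu> \<Otimes>\<^sub>M \<nu>))"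
      by (subst nn_integral_distr, measurable, subst nn_integral_density) auto
    also have "\<dots> = (\<integral>\<^sup>+y. \<integral>\<^sup>+x. D (x, y) * indicator A y \<partial>\<mu> \<partial>\<nu>)"
      by (subst nn_integral_snd[symmetric]) auto
    also have "\<dots> = (\<integral>\<^sup>+y. indicator A y \<partial>\<nu>)"
    proof (rule nn_integral_cong_AE)
      show "AE y in \<nu>. (\<integral>\<^sup>+x. D (x, y) * indicator A y \<partial>\<mu>) = indicator A y"
        using m2 by eventually_elim (simp add: nn_integral_multc)
    qed
    finally show "emeasure (distr ?G borel snd) A = emeasure \<nu> A" using \<nu>(2) by simp
  qed (simp add: \<nu>)
  have "prob_space (distr ?G borel fst)" unfolding fst by fact
  then have "prob_space ?G" by (rule prob_space_distrD[rotated]) measurable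
  moreover have "sets ?G = sets (borel \<Otimes>\<^sub>M borel)" using \<mu>(2) \<nu>(2) by (simp cong: sets_pair_measure_cong)
  ultimately show ?thesis using fst snd by (simp add: couplings_def)
qed

text \<open>The mass that can be transported from \<open>\<mu>\<close> to \<open>\<nu>\<close> within the bump \<open>f\<close>.\<close>
definition overlap :: "'a measure \<Rightarrow> 'a measure \<Rightarrow> ('a \<Rightarrow> real) \<Rightarrow> real" where
  "overlap \<mu> \<nu> f = min (LINT x|\<mu>. f x) (LINT x|\<nu>. f x)"

locale bump_family =
  fixes h :: "nat \<Rightarrow> 'a::euclidean_space \<Rightarrow> real" and K :: nat
  assumes h_measurable [measurable]: "\<And>k. h k \<in> borel_measurable borel"
    and h_nonneg: "\<And>k x. 0 \<le> h k x" and h_sum: "\<And>x. (\<Sum>k<K. h k x) \<le> 1"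
begin

text \<open>
  The measures \<open>\<mu>\<close> and \<open>\<nu>\<close> are coupled in two stages. Within each bump, the common mass \<open>overlap\<close> is
  transported by the product of the two normalized restrictions. The rest of \<open>\<mu>\<close>, with density
  \<open>leftover \<mu> \<nu>\<close> and total mass \<open>deficit \<mu> \<nu>\<close>, is sent to the rest of \<open>\<nu>\<close> by a product coupling.
  If a bump or the rest has mass zero, the corresponding quotient is \<open>0\<close>, as it should be.
\<close>

definition leftover :: "'a measure \<Rightarrow> 'a measure \<Rightarrow> 'a \<Rightarrow> real" where
  "leftover \<mu> \<nu> x = 1 - (\<Sum>k<K. overlap \<mu> \<nu> (h k) / (LINT x|\<mu>. h k x) * h k x)"

definition deficit :: "'a measure \<Rightarrow> 'a measure \<Rightarrow> real" where
  "deficit \<mu> \<nu> = 1 - (\<Sum>k<K. overlap \<mu> \<nu> (h k))"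

definition coupling_density :: "'a measure \<Rightarrow> 'a measure \<Rightarrow> 'a \<Rightarrow> 'a \<Rightarrow> real" where
  "coupling_density \<mu> \<nu> x y =
    (\<Sum>k<K. overlap \<mu> \<nu> (h k) / ((LINT x|\<mu>. h k x) * (LINT x|\<nu>. h k x)) * (h k x * h k y))
      + leftover \<mu> \<nu> x * leftover \<nu> \<mu> y / deficit \<mu> \<nu>"

lemma overlap_commute: "overlap \<mu> \<nu> f = overlap \<nu> \<mu> f"
  by (simp add: overlap_def min.commute)

lemma deficit_commute: "deficit \<mu> \<nu> = deficit \<nu> \<mu>"
  unfolding deficit_def by (subst overlap_commute) simp

lemma coupling_density_commute: "coupling_density \<mu> \<nu> x y = coupling_density \<nu> \<mu> y x"
  unfolding coupling_density_def deficit_commute[of \<mu> \<nu>] overlap_commute[of \<mu> \<nu>] by (simp add: mult.commute)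

lemma leftover_measurable [measurable]: "leftover \<mu> \<nu> \<in> borel_measurable borel"
  unfolding leftover_def by measurable

lemma coupling_density_measurable [measurable]:
  "(\<lambda>z. coupling_density \<mu> \<nu> (fst z) (snd z)) \<in> borel_measurable (borel \<Otimes>\<^sub>M borel)"
  unfolding coupling_density_def by measurable

lemma h_le_1: "k < K \<Longrightarrow> h k x \<le> 1"
  using member_le_sum[of k "{..<K}" "\<lambda>k. h k x"] h_nonneg h_sum[of x] by simp

lemma mass_nonneg: "0 \<le> (LINT x|\<mu>. h k x)"
  by (simp add: h_nonneg)

lemma overlap_nonneg: "0 \<le> overlap \<mu> \<nu> (h k)"
  by (simp add: overlap_def mass_nonneg)

lemma overlap_div_mult: "overlap \<mu> \<nu> (h k) / (LINT x|\<mu>. h k x) * (LINT x|\<mu>. h k x) = overlap \<mu> \<nu> (h k)"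
  using overlap_nonneg[of \<mu> \<nu> k] by (cases "(LINT x|\<mu>. h k x) = 0") (auto simp: overlap_def)

lemma overlap_ratio: "0 \<le> overlap \<mu> \<nu> (h k) / (LINT x|\<mu>. h k x)" "overlap \<mu> \<nu> (h k) / (LINT x|\<mu>. h k x) \<le> 1"
  using overlap_nonneg[of \<mu> \<nu> k] mass_nonneg[of \<mu> k] by (auto simp: overlap_def divide_le_eq_1)

lemma leftover_nonneg: "0 \<le> leftover \<mu> \<nu> x" and leftover_le_1: "leftover \<mu> \<nu> x \<le> 1"
proof -
  have "(\<Sum>k<K. overlap \<mu> \<nu> (h k) / (LINT x|\<mu>. h k x) * h k x) \<le> (\<Sum>k<K. h k x)"
    using overlap_ratio h_nonneg by (intro sum_mono mult_left_le_one_le) auto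
  then show "0 \<le> leftover \<mu> \<nu> x" using h_sum[of x] unfolding leftover_def by linarith
  have "0 \<le> (\<Sum>k<K. overlap \<mu> \<nu> (h k) / (LINT x|\<mu>. h k x) * h k x)"
    by (intro sum_nonneg mult_nonneg_nonneg overlap_ratio h_nonneg)
  then show "leftover \<mu> \<nu> x \<le> 1" unfolding leftover_def by linarith
qed

context
  fixes \<mu> :: "'a measure"
  assumes \<mu>: "prob_space \<mu>" "sets \<mu> = sets borel"
begin

lemma integrable_h: "k < K \<Longrightarrow> integrable \<mu> (h k)"
proof -
  interpret prob_space \<mu> by (rule \<mu>)
  assume "k < K"
  then show ?thesis using h_le_1 h_nonneg \<mu>(2)
    by (intro integrable_const_bound[of _ 1]) (auto cong: measurable_cong_sets)
qed

lemma integrable_h_combination: "integrable \<mu> (\<lambda>x. \<Sum>k<K. c k * h k x)"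
  by (intro Bochner_Integration.integrable_sum integrable_mult_right integrable_h) auto

lemma integral_h_combination: "(LINT x|\<mu>. (\<Sum>k<K. c k * h k x)) = (\<Sum>k<K. c k * (LINT x|\<mu>. h k x))"
  by (subst Bochner_Integration.integral_sum) (auto intro: integrable_mult_right integrable_h)

lemma integrable_leftover: "integrable \<mu> (leftover \<mu> \<nu>)"
  and integral_leftover: "(LINT x|\<mu>. leftover \<mu> \<nu> x) = deficit \<mu> \<nu>"
proof -
  interpret prob_space \<mu> by (rule \<mu>)
  show "integrable \<mu> (leftover \<mu> \<nu>)" unfolding leftover_def
    by (intro Bochner_Integration.integrable_diff integrable_h_combination) simp
  show "(LINT x|\<mu>. leftover \<mu> \<nu> x) = deficit \<mu> \<nu>"
    unfolding leftover_def deficit_def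
    by (subst Bochner_Integration.integral_diff)
       (simp_all only: integrable_const integrable_h_combination integral_h_combination overlap_div_mult lebesgue_integral_const prob_space, simp)
qed

lemma deficit_nonneg: "0 \<le> deficit \<mu> \<nu>"
  unfolding integral_leftover[symmetric] by (simp add: leftover_nonneg)

lemma coupling_density_nonneg: "0 \<le> coupling_density \<mu> \<nu> x y"
  unfolding coupling_density_def
  using overlap_nonneg mass_nonneg h_nonneg leftover_nonneg deficit_nonneg
  by (intro add_nonneg_nonneg sum_nonneg mult_nonneg_nonneg divide_nonneg_nonneg) auto

end

text \<open>
  Integrating out \<open>y\<close> gives \<open>1 - leftover \<mu> \<nu> x\<close> from the bumps and \<open>leftover \<mu> \<nu> x\<close> from the rest. If the deficit is
  zero, the second contribution is \<open>0\<close>, and the leftover vanishes almost everywhere.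
\<close>
lemma coupling_density_marginal:
  assumes \<mu>: "prob_space \<mu>" "sets \<mu> = sets borel" and \<nu>: "prob_space \<nu>" "sets \<nu> = sets borel"
  shows "AE x in \<mu>. (\<integral>\<^sup>+y. ennreal (coupling_density \<mu> \<nu> x y) \<partial>\<nu>) = 1"
proof -
  have *: "overlap \<mu> \<nu> (h k) / ((LINT x|\<mu>. h k x) * (LINT x|\<nu>. h k x)) * h k x * (LINT x|\<nu>. h k x)
     = overlap \<mu> \<nu> (h k) / (LINT x|\<mu>. h k x) * h k x" for k x
    using overlap_nonneg[of \<mu> \<nu> k] mass_nonneg[of \<mu> k]
    by (cases "(LINT x|\<nu>. h k x) = 0") (auto simp: overlap_def)
  have "AE x in \<mu>. leftover \<mu> \<nu> x / deficit \<mu> \<nu> * deficit \<mu> \<nu> = leftover \<mu> \<nu> x"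
  proof (cases "deficit \<mu> \<nu> = 0")
    case True
    then have "(LINT x|\<mu>. leftover \<mu> \<nu> x) = 0" by (simp add: integral_leftover[OF \<mu>])
    then have "AE x in \<mu>. leftover \<mu> \<nu> x = 0"
      using integral_nonneg_eq_0_iff_AE[OF integrable_leftover[OF \<mu>]] leftover_nonneg by simp
    then show ?thesis using True by simp
  qed simp
  then show ?thesis
  proof eventually_elim
    case (elim x)
    define c where "c k = overlap \<mu> \<nu> (h k) / ((LINT x|\<mu>. h k x) * (LINT x|\<nu>. h k x)) * h k x" for k
    have eq: "coupling_density \<mu> \<nu> x y
        = (\<Sum>k<K. c k * h k y) + leftover \<mu> \<nu> x / deficit \<mu> \<nu> * leftover \<nu> \<mu> y" for y
      unfolding coupling_density_def c_def by (simp add: mult.assoc)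
    have i2: "integrable \<nu> (\<lambda>y. leftover \<mu> \<nu> x / deficit \<mu> \<nu> * leftover \<nu> \<mu> y)"
      by (intro integrable_mult_right integrable_leftover \<nu>)
    have int: "integrable \<nu> (\<lambda>y. coupling_density \<mu> \<nu> x y)"
      unfolding eq by (intro Bochner_Integration.integrable_add integrable_h_combination \<nu> i2)
    have "(LINT y|\<nu>. coupling_density \<mu> \<nu> x y)
      = (\<Sum>k<K. c k * (LINT x|\<nu>. h k x)) + leftover \<mu> \<nu> x / deficit \<mu> \<nu> * deficit \<mu> \<nu>"
      unfolding eq Bochner_Integration.integral_add[OF integrable_h_combination[OF \<nu>] i2] integral_h_combination[OF \<nu>]
        integral_mult_right_zero integral_leftover[OF \<nu>] deficit_commute[of \<nu> \<mu>] ..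
    also have "\<dots> = 1" unfolding elim c_def * by (simp add: leftover_def)
    finally show ?case
      using coupling_density_nonneg[OF \<mu>] by (subst nn_integral_eq_integral[OF int]) auto
  qed
qed

text \<open>
  In this coupling, mass transported within a bump moves by at most \<open>d\<close>. For the rest, the cost is
  bounded by the second moments of both rests, which are small if the
  deficit is small and little mass lies far out.
\<close>
lemma wasserstein_2_sq_le_deficit:
  assumes P: "\<mu> \<in> prob_moment 2" "\<nu> \<in> prob_moment 2" and R: "0 \<le> R" and d: "0 \<le> d"
    and diam: "\<And>k x y. k < K \<Longrightarrow> h k x \<noteq> 0 \<Longrightarrow> h k y \<noteq> 0 \<Longrightarrow> dist x y \<le> d"
    and int: "integrable \<mu> (\<lambda>x. (max 0 (norm x - R))\<^sup>2)" "integrable \<nu> (\<lambda>x. (max 0 (norm x - R))\<^sup>2)"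
  shows "(wasserstein 2 \<mu> \<nu>)\<^sup>2 \<le> d\<^sup>2 + 16 * R\<^sup>2 * deficit \<mu> \<nu>
    + 8 * (LINT x|\<mu>. (max 0 (norm x - R))\<^sup>2) + 8 * (LINT x|\<nu>. (max 0 (norm x - R))\<^sup>2)"
proof -
  have \<mu>: "prob_space \<mu>" "sets \<mu> = sets borel" and \<nu>: "prob_space \<nu>" "sets \<nu> = sets borel"
    and sq: "integrable \<mu> (\<lambda>x. (norm x)\<^sup>2)" "integrable \<nu> (\<lambda>x. (norm x)\<^sup>2)" using P by (auto simp: prob_moment_2_iff)
  have [measurable_cong]: "sets \<mu> = sets borel" "sets \<nu> = sets borel" by fact+
  let ?D = "coupling_density \<mu> \<nu>" and ?\<rho> = "deficit \<mu> \<nu>"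
  let ?u = "leftover \<mu> \<nu>" and ?v = "leftover \<nu> \<mu>"
  define \<gamma> where "\<gamma> = density (\<mu> \<Otimes>\<^sub>M \<nu>) (\<lambda>z. ennreal (?D (fst z) (snd z)))"
  have \<gamma>: "\<gamma> \<in> couplings \<mu> \<nu>"
    unfolding \<gamma>_def
  proof (rule density_coupling[OF \<mu> \<nu>])
    show "AE x in \<mu>. (\<integral>\<^sup>+y. ennreal (?D (fst (x, y)) (snd (x, y))) \<partial>\<nu>) = 1"
      using coupling_density_marginal[OF \<mu> \<nu>] by simp
    show "AE y in \<nu>. (\<integral>\<^sup>+x. ennreal (?D (fst (x, y)) (snd (x, y))) \<partial>\<mu>) = 1"
      using coupling_density_marginal[OF \<nu> \<mu>] by (simp add: coupling_density_commute[of \<mu> \<nu>])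
  qed measurable
  have usq: "integrable \<mu> (\<lambda>x. (norm x)\<^sup>2 * ?u x)"
    by (rule Bochner_Integration.integrable_bound[OF sq(1)])
       (use leftover_nonneg leftover_le_1 in \<open>auto simp: abs_mult mult_left_le\<close>)
  have vsq: "integrable \<nu> (\<lambda>x. (norm x)\<^sup>2 * ?v x)"
    by (rule Bochner_Integration.integrable_bound[OF sq(2)])
       (use leftover_nonneg leftover_le_1 in \<open>auto simp: abs_mult mult_left_le\<close>)
  have left: "(LINT x|\<kappa>. (norm x)\<^sup>2 * leftover \<kappa> \<kappa>' x) \<le> 4 * R\<^sup>2 * deficit \<kappa> \<kappa>' + 4 * (LINT x|\<kappa>. (max 0 (norm x - R))\<^sup>2)"
    if \<kappa>: "prob_space \<kappa>" "sets \<kappa> = sets borel"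
      and i: "integrable \<kappa> (\<lambda>x. (norm x)\<^sup>2 * leftover \<kappa> \<kappa>' x)" "integrable \<kappa> (\<lambda>x. (max 0 (norm x - R))\<^sup>2)" for \<kappa> \<kappa>' :: "'a measure"
  proof -
    have "(LINT x|\<kappa>. (norm x)\<^sup>2 * leftover \<kappa> \<kappa>' x) \<le> (LINT x|\<kappa>. 4 * R\<^sup>2 * leftover \<kappa> \<kappa>' x + 4 * (max 0 (norm x - R))\<^sup>2)"
    proof (rule integral_mono[OF i(1)])
      show "integrable \<kappa> (\<lambda>x. 4 * R\<^sup>2 * leftover \<kappa> \<kappa>' x + 4 * (max 0 (norm x - R))\<^sup>2)"
        using i(2) integrable_leftover[OF \<kappa>] by simp
      fix x :: 'a
      let ?l = "leftover \<kappa> \<kappa>' x" and ?e = "(max 0 (norm x - R))\<^sup>2"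
      have "(norm x)\<^sup>2 * ?l \<le> (4 * R\<^sup>2 + 4 * ?e) * ?l"
        by (intro mult_right_mono excess_moment_bound R leftover_nonneg)
      also have "\<dots> = 4 * R\<^sup>2 * ?l + 4 * (?e * ?l)" by (simp add: algebra_simps)
      also have "?e * ?l \<le> ?e" by (intro mult_left_le leftover_le_1) simp
      finally show "(norm x)\<^sup>2 * ?l \<le> 4 * R\<^sup>2 * ?l + 4 * ?e" by simp
    qed
    also have "\<dots> = 4 * R\<^sup>2 * deficit \<kappa> \<kappa>' + 4 * (LINT x|\<kappa>. (max 0 (norm x - R))\<^sup>2)"
      using i(2) integrable_leftover[OF \<kappa>] by (simp add: integral_leftover[OF \<kappa>])
    finally show ?thesis .
  qed
  define c where "c k = overlap \<mu> \<nu> (h k) / ((LINT x|\<mu>. h k x) * (LINT x|\<nu>. h k x))" for k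
  have c: "0 \<le> c k" for k using overlap_nonneg mass_nonneg by (simp add: c_def)
  have c_le: "c k * ((LINT x|\<mu>. h k x) * (LINT x|\<nu>. h k x)) \<le> overlap \<mu> \<nu> (h k)" for k
    using overlap_nonneg[of \<mu> \<nu> k] by (simp add: c_def)
  have \<rho>: "0 \<le> ?\<rho>" by (rule deficit_nonneg[OF \<mu>])
  define G where "G z = (\<Sum>k<K. d\<^sup>2 * c k * (h k (fst z) * h k (snd z)))
    + (2 / ?\<rho>) * (((norm (fst z))\<^sup>2 * ?u (fst z)) * ?v (snd z))
    + (2 / ?\<rho>) * (?u (fst z) * ((norm (snd z))\<^sup>2 * ?v (snd z)))" for z
  note prod = integral_product_measure_mult[OF \<mu>(1) \<nu>(1)]
  note hi = integrable_h[OF \<mu>] integrable_h[OF \<nu>] integrable_leftover[OF \<mu>] integrable_leftover[OF \<nu>]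
  have intG: "integrable (\<mu> \<Otimes>\<^sub>M \<nu>) G"
    unfolding G_def by (intro Bochner_Integration.integrable_add Bochner_Integration.integrable_sum integrable_mult_right prod(1) usq vsq hi) auto
  have [measurable_cong]: "sets \<gamma> = sets (borel \<Otimes>\<^sub>M borel)" using \<gamma> by (simp add: couplings_def)
  have "(wasserstein 2 \<mu> \<nu>)\<^sup>2 \<le> (LINT z|\<gamma>. (norm (fst z - snd z))\<^sup>2)"
    using \<gamma> by (intro wasserstein_2_sq_le) (auto simp: couplings_def)
  also have "\<dots> = (LINT z|(\<mu> \<Otimes>\<^sub>M \<nu>). ?D (fst z) (snd z) * (norm (fst z - snd z))\<^sup>2)"
    unfolding \<gamma>_def using coupling_density_nonneg[OF \<mu>] by (subst integral_density) auto
  also have "\<dots> \<le> (LINT z|(\<mu> \<Otimes>\<^sub>M \<nu>). G z)"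
  proof (rule integral_mono'[OF intG])
    fix z :: "'a \<times> 'a"
    obtain x y where z: "z = (x, y)" by (cases z)
    have "c k * (h k x * h k y) * (norm (x - y))\<^sup>2 \<le> d\<^sup>2 * c k * (h k x * h k y)" if "k < K" for k
    proof (cases "h k x * h k y = 0")
      case False
      then have "(norm (x - y))\<^sup>2 \<le> d\<^sup>2" using diam[OF that, of x y] by (intro power_mono) (auto simp: dist_norm)
      then have "(c k * (h k x * h k y)) * (norm (x - y))\<^sup>2 \<le> (c k * (h k x * h k y)) * d\<^sup>2"
        using c h_nonneg by (intro mult_left_mono) auto
      then show ?thesis by (simp add: mult.commute mult.left_commute)
    qed auto
    then have 1: "(\<Sum>k<K. c k * (h k x * h k y)) * (norm (x - y))\<^sup>2 \<le> (\<Sum>k<K. d\<^sup>2 * c k * (h k x * h k y))"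
      unfolding sum_distrib_right by (intro sum_mono) auto
    have "(?u x * ?v y / ?\<rho>) * (norm (x - y))\<^sup>2 \<le> (?u x * ?v y / ?\<rho>) * (2 * (norm x)\<^sup>2 + 2 * (norm y)\<^sup>2)"
      using leftover_nonneg \<rho> by (intro mult_left_mono norm_diff_sq_le) auto
    also have "\<dots> = (2 / ?\<rho>) * (((norm x)\<^sup>2 * ?u x) * ?v y) + (2 / ?\<rho>) * (?u x * ((norm y)\<^sup>2 * ?v y))"
      by (simp add: distrib_left mult.commute mult.left_commute)
    finally show *: "?D (fst z) (snd z) * (norm (fst z - snd z))\<^sup>2 \<le> G z"
      using 1 unfolding z fst_conv snd_conv G_def coupling_density_def c_def[symmetric] distrib_right by linarith
    show "0 \<le> G z" using coupling_density_nonneg[OF \<mu>] by (intro order_trans[OF _ *]) simp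
  qed
  also have "(LINT z|(\<mu> \<Otimes>\<^sub>M \<nu>). G z) = (\<Sum>k<K. d\<^sup>2 * c k * ((LINT x|\<mu>. h k x) * (LINT x|\<nu>. h k x)))
    + (2 / ?\<rho>) * ((LINT x|\<mu>. (norm x)\<^sup>2 * ?u x) * ?\<rho>) + (2 / ?\<rho>) * (?\<rho> * (LINT x|\<nu>. (norm x)\<^sup>2 * ?v x))"
  proof -
    have a: "integrable (\<mu> \<Otimes>\<^sub>M \<nu>) (\<lambda>z. d\<^sup>2 * c k * (h k (fst z) * h k (snd z)))" if "k \<in> {..<K}" for k
      using that by (intro integrable_mult_right prod(1) hi) auto
    have Sa: "integrable (\<mu> \<Otimes>\<^sub>M \<nu>) (\<lambda>z. \<Sum>k<K. d\<^sup>2 * c k * (h k (fst z) * h k (snd z)))"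
      by (rule Bochner_Integration.integrable_sum[OF a])
    have b: "integrable (\<mu> \<Otimes>\<^sub>M \<nu>) (\<lambda>z. (2 / ?\<rho>) * (((norm (fst z))\<^sup>2 * ?u (fst z)) * ?v (snd z)))"
      by (intro integrable_mult_right prod(1) hi usq)
    have c: "integrable (\<mu> \<Otimes>\<^sub>M \<nu>) (\<lambda>z. (2 / ?\<rho>) * (?u (fst z) * ((norm (snd z))\<^sup>2 * ?v (snd z))))"
      by (intro integrable_mult_right prod(1) hi vsq)
    have "(LINT z|(\<mu> \<Otimes>\<^sub>M \<nu>). G z) = (\<Sum>k<K. LINT z|(\<mu> \<Otimes>\<^sub>M \<nu>). d\<^sup>2 * c k * (h k (fst z) * h k (snd z)))
      + (LINT z|(\<mu> \<Otimes>\<^sub>M \<nu>). (2 / ?\<rho>) * (((norm (fst z))\<^sup>2 * ?u (fst z)) * ?v (snd z)))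
      + (LINT z|(\<mu> \<Otimes>\<^sub>M \<nu>). (2 / ?\<rho>) * (?u (fst z) * ((norm (snd z))\<^sup>2 * ?v (snd z))))"
      unfolding G_def Bochner_Integration.integral_add[OF Bochner_Integration.integrable_add[OF Sa b] c]
        Bochner_Integration.integral_add[OF Sa b]
      by (subst Bochner_Integration.integral_sum) (rule a, assumption, rule refl)
    also have "(LINT z|(\<mu> \<Otimes>\<^sub>M \<nu>). (2 / ?\<rho>) * (((norm (fst z))\<^sup>2 * ?u (fst z)) * ?v (snd z)))
      = (2 / ?\<rho>) * ((LINT x|\<mu>. (norm x)\<^sup>2 * ?u x) * ?\<rho>)"
      unfolding integral_mult_right_zero prod(2)[OF usq hi(4)] integral_leftover[OF \<nu>] deficit_commute[of \<nu> \<mu>] ..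
    also have "(LINT z|(\<mu> \<Otimes>\<^sub>M \<nu>). (2 / ?\<rho>) * (?u (fst z) * ((norm (snd z))\<^sup>2 * ?v (snd z))))
      = (2 / ?\<rho>) * (?\<rho> * (LINT x|\<nu>. (norm x)\<^sup>2 * ?v x))"
      unfolding integral_mult_right_zero prod(2)[OF hi(3) vsq] integral_leftover[OF \<mu>] ..
    also have "(\<Sum>k<K. LINT z|(\<mu> \<Otimes>\<^sub>M \<nu>). d\<^sup>2 * c k * (h k (fst z) * h k (snd z)))
      = (\<Sum>k<K. d\<^sup>2 * c k * ((LINT x|\<mu>. h k x) * (LINT x|\<nu>. h k x)))"
      by (intro sum.cong refl) (simp only: integral_mult_right_zero prod(2)[OF hi(1,2)] lessThan_iff)
    finally show ?thesis .
  qed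
  also have "(2 / ?\<rho>) * ((LINT x|\<mu>. (norm x)\<^sup>2 * ?u x) * ?\<rho>) \<le> 2 * (LINT x|\<mu>. (norm x)\<^sup>2 * ?u x)"
    by (cases "?\<rho> = 0") (auto simp: leftover_nonneg)
  also have "(2 / ?\<rho>) * (?\<rho> * (LINT x|\<nu>. (norm x)\<^sup>2 * ?v x)) \<le> 2 * (LINT x|\<nu>. (norm x)\<^sup>2 * ?v x)"
    by (cases "?\<rho> = 0") (auto simp: leftover_nonneg)
  also have "(\<Sum>k<K. d\<^sup>2 * c k * ((LINT x|\<mu>. h k x) * (LINT x|\<nu>. h k x))) \<le> d\<^sup>2"
  proof -
    have "(\<Sum>k<K. d\<^sup>2 * c k * ((LINT x|\<mu>. h k x) * (LINT x|\<nu>. h k x))) \<le> (\<Sum>k<K. d\<^sup>2 * overlap \<mu> \<nu> (h k))"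
      unfolding mult.assoc using c_le by (intro sum_mono mult_left_mono) auto
    also have "\<dots> = d\<^sup>2 * (1 - ?\<rho>)" by (simp add: deficit_def sum_distrib_left)
    also have "\<dots> \<le> d\<^sup>2" using \<rho> by (simp add: mult_left_le)
    finally show ?thesis .
  qed
  finally show ?thesis
    using left[OF \<mu> usq int(1)] left[OF \<nu> vsq int(2)] by (simp add: deficit_commute[of \<nu> \<mu>])
qed

end

section \<open>Completeness of the Wasserstein space\<close>

text \<open>
  A triangle inequality up to the factor \<open>2\<close>, which suffices for all limits taken here and is
  immediate from the corresponding inequality for squared norms.
\<close>
lemma wasserstein_2_sq_quasi_triangle:
  assumes "\<mu> \<in> prob_moment 2" "\<nu> \<in> prob_moment 2" "\<rho> \<in> prob_moment 2"
  shows "(wasserstein 2 \<mu> \<rho>)\<^sup>2 \<le> 2 * (wasserstein 2 \<mu> \<nu>)\<^sup>2 + 2 * (wasserstein 2 \<nu> \<rho>)\<^sup>2"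
proof (rule field_le_epsilon)
  fix e :: real assume e: "e > 0"
  define m where "m i = (if i = 0 then \<mu> else if i = 1 then \<nu> else \<rho>)" for i :: nat
  have m: "m i \<in> prob_moment 2" for i using assms by (simp add: m_def)
  have e4: "e / 4 > 0" using e by simp
  obtain M :: "(nat \<Rightarrow> 'a) measure" where M: "prob_space M" and coord[measurable]: "\<And>i. (\<lambda>\<omega>. \<omega> i) \<in> borel_measurable M"
    and law: "\<And>i. distr M borel (\<lambda>\<omega>. \<omega> i) = m i"
    and cost: "\<And>i. (LINT \<omega>|M. (norm (\<omega> i - \<omega> (Suc i)))\<^sup>2) \<le> (wasserstein 2 (m i) (m (Suc i)))\<^sup>2 + e / 4"
    by (rule tree_realization[of m "\<lambda>i. i" "\<lambda>_. e / 4", OF m order_refl e4]) (rule that)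
  interpret prob_space M by fact
  have sq: "integrable M (\<lambda>\<omega>. (norm (\<omega> i))\<^sup>2)" for i
    by (rule integrable_of_law[OF coord law]) (use m[of i] in \<open>auto simp: prob_moment_2_iff\<close>)
  note diff = integrable_norm_diff_sq[OF coord coord sq sq]
  have "(wasserstein 2 \<mu> \<rho>)\<^sup>2 \<le> (LINT \<omega>|M. (norm (\<omega> 0 - \<omega> 2))\<^sup>2)"
    using law[of 0] law[of 2] by (intro wasserstein_2_sq_le[OF M]) (auto simp: m_def)
  also have "\<dots> \<le> (LINT \<omega>|M. 2 * (norm (\<omega> 0 - \<omega> 1))\<^sup>2 + 2 * (norm (\<omega> 1 - \<omega> 2))\<^sup>2)"
  proof (intro integral_mono)
    fix \<omega> :: "nat \<Rightarrow> 'a"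
    show "(norm (\<omega> 0 - \<omega> 2))\<^sup>2 \<le> 2 * (norm (\<omega> 0 - \<omega> 1))\<^sup>2 + 2 * (norm (\<omega> 1 - \<omega> 2))\<^sup>2"
      using norm_diff_sq_le[of "\<omega> 0 - \<omega> 1" "\<omega> 2 - \<omega> 1"] by (simp add: norm_minus_commute[of "\<omega> 2"])
  qed (use diff in auto)
  also have "\<dots> = 2 * (LINT \<omega>|M. (norm (\<omega> 0 - \<omega> 1))\<^sup>2) + 2 * (LINT \<omega>|M. (norm (\<omega> 1 - \<omega> 2))\<^sup>2)"
    using diff by simp
  also have "\<dots> \<le> 2 * (wasserstein 2 \<mu> \<nu>)\<^sup>2 + 2 * (wasserstein 2 \<nu> \<rho>)\<^sup>2 + e"
    using cost[of 0] cost[of 1] by (simp add: m_def numeral_2_eq_2)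
  finally show "(wasserstein 2 \<mu> \<rho>)\<^sup>2 \<le> 2 * (wasserstein 2 \<mu> \<nu>)\<^sup>2 + 2 * (wasserstein 2 \<nu> \<rho>)\<^sup>2 + e" .
qed

lemma geometric_steps_converge:
  fixes x :: "nat \<Rightarrow> 'a::banach"
  assumes step: "\<And>l. norm (x l - x (Suc l)) \<le> B * (1 / 2) ^ l" and B: "B \<ge> 0"
  shows "convergent x" "norm (x k - lim x) \<le> 2 * B * (1 / 2) ^ k"
proof -
  have tail: "norm (x k - x (k + n)) \<le> 2 * B * (1 / 2) ^ k - 2 * B * (1 / 2) ^ (k + n)" for k n
  proof (induction n)
    case (Suc n)
    have "norm (x k - x (k + Suc n)) \<le> norm (x k - x (k + n)) + norm (x (k + n) - x (Suc (k + n)))"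
      using norm_triangle_ineq[of "x k - x (k + n)" "x (k + n) - x (Suc (k + n))"] by simp
    also have "\<dots> \<le> 2 * B * (1 / 2) ^ k - 2 * B * (1 / 2) ^ (k + n) + B * (1 / 2) ^ (k + n)"
      by (intro add_mono Suc step)
    finally show ?case by simp
  qed simp
  have tail': "norm (x k - x n) \<le> 2 * B * (1 / 2) ^ k" if "k \<le> n" for k n
  proof -
    have "0 \<le> 2 * B * (1 / 2) ^ (k + (n - k))" using B by simp
    then show ?thesis using tail[of k "n - k"] that by simp
  qed
  have "Cauchy x"
  proof (rule CauchyI)
    fix e :: real assume e: "e > 0"
    have "(\<lambda>k. 2 * B * (1 / 2) ^ k) \<longlonglongrightarrow> 2 * B * 0" by (intro tendsto_intros LIMSEQ_power_zero) simp
    then have "eventually (\<lambda>k. 2 * B * (1 / 2) ^ k < e / 2) sequentially"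
      using e by (intro order_tendstoD) auto
    then obtain k where k: "2 * B * (1 / 2) ^ k < e / 2" by (auto simp: eventually_sequentially)
    have "norm (x m - x n) < e" if "k \<le> m" "k \<le> n" for m n
      using norm_triangle_ineq4[of "x k - x n" "x k - x m"] tail'[OF that(1)] tail'[OF that(2)] k by simp
    then show "\<exists>M. \<forall>m\<ge>M. \<forall>n\<ge>M. norm (x m - x n) < e" by blast
  qed
  then show c: "convergent x" by (simp add: Cauchy_convergent_iff)
  then have "(\<lambda>n. norm (x k - x n)) \<longlonglongrightarrow> norm (x k - lim x)"
    by (intro tendsto_intros) (simp add: convergent_LIMSEQ_iff)
  then show "norm (x k - lim x) \<le> 2 * B * (1 / 2) ^ k"
    by (rule LIMSEQ_le_const2) (use tail' in blast)
qed

text \<open>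
  Along a fast subsequence, realize the measures by random variables on one space, where the
  mean square of consecutive differences is at most \<open>2 * (1 / 16) ^ k\<close>. The random variables then
  converge almost surely and in mean square, and the law of the limit is the limit measure.
\<close>
lemma wasserstein_2_complete:
  fixes \<nu> :: "nat \<Rightarrow> 'a::euclidean_space measure"
  assumes \<nu>: "\<And>t. \<nu> t \<in> prob_moment 2"
    and Cauchy: "\<And>e. e > 0 \<Longrightarrow> \<exists>N. \<forall>s\<ge>N. \<forall>t\<ge>N. (wasserstein 2 (\<nu> s) (\<nu> t))\<^sup>2 \<le> e"
  obtains \<mu> where "\<mu> \<in> prob_moment 2" "(\<lambda>t. wasserstein 2 (\<nu> t) \<mu>) \<longlonglongrightarrow> 0"
proof -
  have "\<forall>k. \<exists>N. \<forall>s\<ge>N. \<forall>t\<ge>N. (wasserstein 2 (\<nu> s) (\<nu> t))\<^sup>2 \<le> (1 / 16) ^ k"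
    by (intro allI Cauchy) simp
  then obtain N where N: "\<And>k s t. N k \<le> s \<Longrightarrow> N k \<le> t \<Longrightarrow> (wasserstein 2 (\<nu> s) (\<nu> t))\<^sup>2 \<le> (1 / 16) ^ k"
    by metis
  define r where "r k = (\<Sum>j\<le>k. N j)" for k
  have r: "N k \<le> r k" "N k \<le> r (Suc k)" for k
    unfolding r_def using member_le_sum[of k "{..k}" N] member_le_sum[of k "{..Suc k}" N] by auto
  have e: "0 < (1 / 16 :: real) ^ k" for k by simp
  obtain M :: "(nat \<Rightarrow> 'a) measure" where M: "prob_space M" and coord[measurable]: "\<And>i. (\<lambda>\<omega>. \<omega> i) \<in> borel_measurable M"
    and law: "\<And>i. distr M borel (\<lambda>\<omega>. \<omega> i) = \<nu> (r i)"
    and cost: "\<And>i. (LINT \<omega>|M. (norm (\<omega> i - \<omega> (Suc i)))\<^sup>2) \<le> (wasserstein 2 (\<nu> (r i)) (\<nu> (r (Suc i))))\<^sup>2 + (1 / 16) ^ i"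
    by (rule tree_realization[of "\<lambda>i. \<nu> (r i)" "\<lambda>i. i" "\<lambda>i. (1 / 16) ^ i", OF \<nu> order_refl e]) (rule that)
  interpret prob_space M by fact
  have sq: "integrable M (\<lambda>\<omega>. (norm (\<omega> i))\<^sup>2)" for i
    by (rule integrable_of_law[OF coord law]) (use \<nu>[of "r i"] in \<open>auto simp: prob_moment_2_iff\<close>)
  note diff = integrable_norm_diff_sq[OF coord coord sq sq]
  \<comment> \<open>The weights \<open>4 ^ l\<close> leave the expectation of \<open>S\<close> finite, and wherever \<open>S\<close> is finite they
    bound the \<open>l\<close>-th step by \<open>sqrt S * (1 / 2) ^ l\<close>.\<close>
  define S where "S \<omega> = (\<Sum>l. ennreal (4 ^ l * (norm (\<omega> l - \<omega> (Suc l)))\<^sup>2))" for \<omega> :: "nat \<Rightarrow> 'a"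
  have S[measurable]: "S \<in> borel_measurable M" unfolding S_def by measurable
  have "(\<integral>\<^sup>+\<omega>. S \<omega> \<partial>M) = (\<Sum>l. \<integral>\<^sup>+\<omega>. ennreal (4 ^ l * (norm (\<omega> l - \<omega> (Suc l)))\<^sup>2) \<partial>M)"
    unfolding S_def by (rule nn_integral_suminf) measurable
  also have "\<dots> \<le> (\<Sum>l. ennreal (2 * (1 / 4) ^ l))"
  proof (intro suminf_le summableI)
    fix l
    have "(LINT \<omega>|M. (norm (\<omega> l - \<omega> (Suc l)))\<^sup>2) \<le> 2 * (1 / 16) ^ l"
      using cost[of l] N[OF r] by (smt (verit))
    then have "4 ^ l * (LINT \<omega>|M. (norm (\<omega> l - \<omega> (Suc l)))\<^sup>2) \<le> 4 ^ l * (2 * (1 / 16) ^ l)"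
      by (intro mult_left_mono) auto
    also have "\<dots> = 2 * (4 * (1 / 16)) ^ l" unfolding power_mult_distrib by simp
    finally have "(LINT \<omega>|M. 4 ^ l * (norm (\<omega> l - \<omega> (Suc l)))\<^sup>2) \<le> 2 * (1 / 4) ^ l" by simp
    then show "(\<integral>\<^sup>+\<omega>. ennreal (4 ^ l * (norm (\<omega> l - \<omega> (Suc l)))\<^sup>2) \<partial>M) \<le> ennreal (2 * (1 / 4) ^ l)"
      using diff by (subst nn_integral_eq_integral) (auto intro!: ennreal_leI)
  qed
  also have "\<dots> < \<infinity>"
  proof -
    have "summable (\<lambda>l. 2 * (1 / 4 :: real) ^ l)" by (intro summable_mult summable_geometric) simp
    then have "(\<Sum>l. ennreal (2 * (1 / 4) ^ l)) = ennreal (\<Sum>l. 2 * (1 / 4) ^ l)"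
      by (intro suminf_ennreal2) auto
    then show ?thesis by simp
  qed
  finally have Sfin: "(\<integral>\<^sup>+\<omega>. S \<omega> \<partial>M) < \<infinity>" .
  then obtain C where C: "C \<ge> 0" "(\<integral>\<^sup>+\<omega>. S \<omega> \<partial>M) = ennreal C"
    by (cases "\<integral>\<^sup>+\<omega>. S \<omega> \<partial>M") auto
  define X where "X \<omega> = lim \<omega>" for \<omega> :: "nat \<Rightarrow> 'a"
  have X[measurable]: "X \<in> borel_measurable M"
    unfolding X_def using borel_measurable_lim_metric[of "\<lambda>i \<omega>. \<omega> i" M] by simp
  have "AE \<omega> in M. S \<omega> \<noteq> \<infinity>" using Sfin by (intro nn_integral_PInf_AE) auto
  then have close: "AE \<omega> in M. \<forall>k. ennreal ((norm (\<omega> k - X \<omega>))\<^sup>2) \<le> ennreal (4 * (1 / 4) ^ k) * S \<omega>"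
  proof eventually_elim
    fix \<omega> assume "S \<omega> \<noteq> \<infinity>"
    then obtain s where s: "s \<ge> 0" "S \<omega> = ennreal s" by (cases "S \<omega>") auto
    have step: "norm (\<omega> l - \<omega> (Suc l)) \<le> sqrt s * (1 / 2) ^ l" for l
    proof -
      have "(\<Sum>l\<in>{l}. ennreal (4 ^ l * (norm (\<omega> l - \<omega> (Suc l)))\<^sup>2)) \<le> S \<omega>"
        unfolding S_def by (rule sum_le_suminf) (rule summableI, simp, rule zero_le)
      then have "ennreal (4 ^ l * (norm (\<omega> l - \<omega> (Suc l)))\<^sup>2) \<le> ennreal s" unfolding s(2) by simp
      then have "4 ^ l * (norm (\<omega> l - \<omega> (Suc l)))\<^sup>2 \<le> s" using s(1) ennreal_le_iff by blast
      moreover have "(4::real) ^ l = (2 ^ l)\<^sup>2" by (simp add: power_even_eq[symmetric] power_mult)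
      ultimately have "(2 ^ l * norm (\<omega> l - \<omega> (Suc l)))\<^sup>2 \<le> s" by (simp add: power_mult_distrib)
      then have "2 ^ l * norm (\<omega> l - \<omega> (Suc l)) \<le> sqrt s" by (rule real_le_rsqrt)
      then show ?thesis by (simp add: power_divide field_simps)
    qed
    show "\<forall>k. ennreal ((norm (\<omega> k - X \<omega>))\<^sup>2) \<le> ennreal (4 * (1 / 4) ^ k) * S \<omega>"
    proof
      fix k
      have "norm (\<omega> k - X \<omega>) \<le> 2 * sqrt s * (1 / 2) ^ k"
        unfolding X_def using s by (intro geometric_steps_converge(2) step) auto
      then have "(norm (\<omega> k - X \<omega>))\<^sup>2 \<le> (2 * sqrt s * (1 / 2) ^ k)\<^sup>2" by (rule power_mono) simp
      also have "\<dots> = 4 * (1 / 4) ^ k * s"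
      proof -
        have p: "((1 / 2 :: real) ^ k)\<^sup>2 = (1 / 4) ^ k"
          by (simp add: power2_eq_square power_mult_distrib[symmetric])
        show ?thesis unfolding power_mult_distrib p using s by simp
      qed
      finally show "ennreal ((norm (\<omega> k - X \<omega>))\<^sup>2) \<le> ennreal (4 * (1 / 4) ^ k) * S \<omega>"
        using s by (simp add: ennreal_mult[symmetric] ennreal_leI)
    qed
  qed
  have nn: "(\<integral>\<^sup>+\<omega>. ennreal ((norm (\<omega> k - X \<omega>))\<^sup>2) \<partial>M) \<le> ennreal (4 * (1 / 4) ^ k * C)" for k
  proof -
    have "(\<integral>\<^sup>+\<omega>. ennreal ((norm (\<omega> k - X \<omega>))\<^sup>2) \<partial>M) \<le> (\<integral>\<^sup>+\<omega>. ennreal (4 * (1 / 4) ^ k) * S \<omega> \<partial>M)"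
      using close by (intro nn_integral_mono_AE) (auto elim: eventually_mono)
    also have "\<dots> = ennreal (4 * (1 / 4) ^ k * C)"
      using C by (subst nn_integral_cmult) (auto simp: ennreal_mult)
    finally show ?thesis .
  qed
  have sqX: "integrable M (\<lambda>\<omega>. (norm (X \<omega>))\<^sup>2)"
  proof (rule Bochner_Integration.integrable_bound)
    have "integrable M (\<lambda>\<omega>. (norm (\<omega> 0 - X \<omega>))\<^sup>2)"
      using nn[of 0] by (intro integrableI_bounded) (auto simp: le_less_trans)
    then show "integrable M (\<lambda>\<omega>. 2 * (norm (\<omega> 0))\<^sup>2 + 2 * (norm (\<omega> 0 - X \<omega>))\<^sup>2)" using sq by simp
    have "(norm (X \<omega>))\<^sup>2 \<le> 2 * (norm (\<omega> 0))\<^sup>2 + 2 * (norm (\<omega> 0 - X \<omega>))\<^sup>2" for \<omega>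
      using norm_diff_sq_le[of "\<omega> 0" "\<omega> 0 - X \<omega>"] by simp
    then show "AE \<omega> in M. norm ((norm (X \<omega>))\<^sup>2) \<le> norm (2 * (norm (\<omega> 0))\<^sup>2 + 2 * (norm (\<omega> 0 - X \<omega>))\<^sup>2)"
      by simp
  qed measurable
  define \<mu> where "\<mu> = distr M borel X"
  have \<mu>: "\<mu> \<in> prob_moment 2"
    unfolding prob_moment_2_iff \<mu>_def using sqX by (auto intro: prob_space_distr simp: integrable_distr_eq)
  have sub: "(wasserstein 2 (\<nu> (r k)) \<mu>)\<^sup>2 \<le> 4 * (1 / 4) ^ k * C" for k
  proof -
    have "(wasserstein 2 (\<nu> (r k)) \<mu>)\<^sup>2 \<le> (LINT \<omega>|M. (norm (\<omega> k - X \<omega>))\<^sup>2)"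
      by (rule wasserstein_2_sq_le[OF M coord X law]) (simp add: \<mu>_def)
    also have "\<dots> \<le> 4 * (1 / 4) ^ k * C" using nn[of k] C(1) by (intro integral_real_bounded) auto
    finally show ?thesis .
  qed
  have "(\<lambda>t. (wasserstein 2 (\<nu> t) \<mu>)\<^sup>2) \<longlonglongrightarrow> 0"
  proof (rule LIMSEQ_I)
    fix e :: real assume e: "e > 0"
    have "(\<lambda>k. 2 * (1 / 16) ^ k + 2 * (4 * (1 / 4) ^ k * C)) \<longlonglongrightarrow> 2 * 0 + 2 * (4 * 0 * C)"
      by (intro tendsto_intros LIMSEQ_power_zero) auto
    then have "eventually (\<lambda>k. 2 * (1 / 16) ^ k + 2 * (4 * (1 / 4) ^ k * C) < e) sequentially"
      using e by (intro order_tendstoD) auto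
    then obtain k where k: "2 * (1 / 16) ^ k + 2 * (4 * (1 / 4) ^ k * C) < e" by (auto simp: eventually_sequentially)
    have "(wasserstein 2 (\<nu> t) \<mu>)\<^sup>2 < e" if "N k \<le> t" for t
      using wasserstein_2_sq_quasi_triangle[OF \<nu>[of t] \<nu>[of "r k"] \<mu>] N[OF that r(1)] sub[of k] k by linarith
    then show "\<exists>no. \<forall>t\<ge>no. norm ((wasserstein 2 (\<nu> t) \<mu>)\<^sup>2 - 0) < e" by auto
  qed
  then have "(\<lambda>t. sqrt ((wasserstein 2 (\<nu> t) \<mu>)\<^sup>2)) \<longlonglongrightarrow> sqrt 0" by (rule tendsto_real_sqrt)
  then have "(\<lambda>t. wasserstein 2 (\<nu> t) \<mu>) \<longlonglongrightarrow> 0" using wasserstein_2_nonneg[OF \<nu> \<mu>] by simp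
  then show ?thesis using that \<mu> by blast
qed

section \<open>Scalar consensus on a time-varying network\<close>

text \<open>
  Let \<open>A t\<close> be the maximum of the values at time \<open>t\<close>; it decreases to some limit \<open>M\<close>. Suppose that agent \<open>i\<close> lies
  below \<open>A s\<close> by some gap at time \<open>s\<close>. Averaging passes a fraction \<open>\<delta>\<close> of a gap
  on to all neighbors in each step, and self-loops preserve it up to the same factor.
  Every jointly connected window enlarges the set of agents that have a gap, so after a
  time \<open>T\<close>, which does not depend on \<open>s\<close>, all agents have it up to the factor \<open>\<delta> ^ T\<close>. Then the maximum itself has
  dropped by \<open>\<delta> ^ T\<close> times the gap. As \<open>A s\<close> exceeds \<open>M\<close> by less and less, all gaps tend to zero.
\<close>
lemma (in network) averaging_below_consensus:
  fixes a :: "nat \<Rightarrow> nat \<Rightarrow> real"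
  assumes V: "finite V" "V \<noteq> {}"
    and step: "\<And>i t. i \<in> V \<Longrightarrow> a i (Suc t) \<le> (\<Sum>j\<in>neighbors V (E t) i. w i j t * a j t)"
    and bdd: "\<And>i t. i \<in> V \<Longrightarrow> b \<le> a i t"
  shows "\<exists>M. \<forall>i\<in>V. (\<lambda>t. a i t) \<longlonglongrightarrow> M"
proof -
  define A where "A t = Max ((\<lambda>i. a i t) ` V)" for t
  have le_A: "a i t \<le> A t" if "i \<in> V" for i t using that V by (auto simp: A_def)
  have A_le: "A t \<le> c" if "\<And>i. i \<in> V \<Longrightarrow> a i t \<le> c" for t c using that V by (auto simp: A_def)
  have finN: "finite (neighbors V (E t) i)" for i t using V by (auto simp: neighbors_def)
  have wnn: "0 \<le> w i j t" if "j \<in> neighbors V (E t) i" for i j t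
    using weight_pos[of i j t] that by (auto simp: neighbors_def less_imp_le)
  have gap: "w i j t * (c - a j t) \<le> c - a i (Suc t)"
    if "i \<in> V" "A t \<le> c" "j \<in> neighbors V (E t) i" for i j t c
  proof -
    have "w i j t * (c - a j t) \<le> (\<Sum>j\<in>neighbors V (E t) i. w i j t * (c - a j t))"
    proof (rule member_le_sum[OF that(3) _ finN])
      fix k assume "k \<in> neighbors V (E t) i - {j}"
      then show "0 \<le> w i k t * (c - a k t)" using wnn[of k t i] le_A[of k t] that(2)
        by (intro mult_nonneg_nonneg) (auto simp: neighbors_def)
    qed
    also have "\<dots> = c - (\<Sum>j\<in>neighbors V (E t) i. w i j t * a j t)"
      using weight_sum[OF that(1), of t]
      by (simp add: right_diff_distrib sum_subtractf sum_distrib_right[symmetric])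
    finally show ?thesis using step[OF that(1), of t] by linarith
  qed
  have self: "i \<in> neighbors V (E t) i" if "i \<in> V" for i t
    using that self_loops by (auto simp: neighbors_def)
  have A_dec: "A (Suc t) \<le> A t" for t
  proof (rule A_le)
    fix i assume i: "i \<in> V"
    have "0 \<le> w i i t * (A t - a i t)" using wnn[OF self[OF i]] le_A[OF i, of t] by simp
    then show "a i (Suc t) \<le> A t" using gap[OF i order_refl self[OF i]] by (meson diff_ge_0_iff_ge order_trans)
  qed
  have A_mono: "A t \<le> A s" if "s \<le> t" for s t
    using decseq_SucI[of A, OF A_dec] that by (auto simp: decseq_def)
  obtain i0 where "i0 \<in> V" using V by blast
  then have "b \<le> A t" for t using bdd[of i0 t] le_A[of i0 t] by linarith
  then obtain M where M: "A \<longlonglongrightarrow> M" "\<And>t. M \<le> A t"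
    using decseq_convergent[of A b] decseq_SucI[of A, OF A_dec] by blast
  obtain \<delta> where \<delta>: "0 < \<delta>" "\<delta> < 1" "\<And>i j t. i \<in> V \<Longrightarrow> j \<in> neighbors V (E t) i \<Longrightarrow> \<delta> \<le> w i j t"
    using weight_lower_bound by blast
  obtain \<tau> where \<tau>0: "\<tau> 0 = 0" and \<tau>: "strict_mono \<tau>" and \<tau>_bdd: "bdd_above (range (\<lambda>i. \<tau> (Suc i) - \<tau> i))"
    and \<tau>_conn: "\<And>i. connected_graph V (\<Union>t\<in>{\<tau> i..<\<tau> (Suc i)}. E t)"
    using jointly_connected by blast
  obtain L where L: "\<And>i. \<tau> (Suc i) - \<tau> i \<le> L"
    using \<tau>_bdd by (auto simp: bdd_above_def)
  have \<tau>_step: "\<tau> (Suc i) \<le> \<tau> i + L" for i using L[of i] by linarith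
  define T where "T = L + card V * L"
  have spread: "\<delta> ^ T * (A s - a i s) \<le> A s - M" if i: "i \<in> V" for i s
  proof -
    define e where "e = A s - a i s"
    have e: "e \<ge> 0" using le_A[OF i] by (simp add: e_def)
    \<comment> \<open>The agents that at time \<open>t\<close> are still below \<open>A s\<close> by the discounted gap.\<close>
    define S where "S t = {k \<in> V. \<delta> ^ (t - s) * e \<le> A s - a k t}" for t
    have grow: "k \<in> S (Suc t)" if t: "s \<le> t" and j: "j \<in> S t" and k: "(k, j) \<in> E t" for t j k
    proof -
      have kV: "k \<in> V" "j \<in> V" using edges[of t] k by auto
      then have jn: "j \<in> neighbors V (E t) k" using k by (auto simp: neighbors_def)
      have nn: "0 \<le> A s - a j t" using le_A[OF kV(2), of t] A_mono[OF t] by linarith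
      have "\<delta> ^ (Suc t - s) * e = \<delta> * (\<delta> ^ (t - s) * e)" using t by (simp add: Suc_diff_le)
      also have "\<dots> \<le> \<delta> * (A s - a j t)" using j \<delta> by (intro mult_left_mono) (auto simp: S_def)
      also have "\<dots> \<le> w k j t * (A s - a j t)" using \<delta>(3)[OF kV(1) jn] nn by (intro mult_right_mono) auto
      also have "\<dots> \<le> A s - a k (Suc t)" by (rule gap[OF kV(1) A_mono[OF t] jn])
      finally show ?thesis using kV by (simp add: S_def)
    qed
    have S_mono: "S t \<subseteq> S t'" if "s \<le> t" "t \<le> t'" for t t'
      using that(2,1)
    proof (induction rule: dec_induct)
      case (step n)
      have "S n \<subseteq> S (Suc n)"
      proof
        fix k assume "k \<in> S n"
        moreover from this have "(k, k) \<in> E n" using self_loops by (auto simp: S_def)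
        ultimately show "k \<in> S (Suc n)" using grow[of n k k] step by simp
      qed
      then show ?case using step by blast
    qed simp
    have S_V: "S t \<subseteq> V" for t by (auto simp: S_def)
    have i_S: "i \<in> S s" using i by (simp add: S_def e_def)
    have window: "S (\<tau> r) = V \<or> S (\<tau> r) \<subset> S (\<tau> (Suc r))" if r: "s \<le> \<tau> r" for r
    proof (rule disjCI)
      assume stuck: "\<not> S (\<tau> r) \<subset> S (\<tau> (Suc r))"
      have mono_r: "\<tau> r \<le> \<tau> (Suc r)" using \<tau> by (simp add: strict_mono_less_eq)
      have eq: "S (\<tau> (Suc r)) = S (\<tau> r)" using stuck S_mono[OF r mono_r] by blast
      have "k \<in> S (\<tau> r)" if "k \<in> V" for k
      proof -
        have "(i, k) \<in> (\<Union>t\<in>{\<tau> r..<\<tau> (Suc r)}. E t)\<^sup>*" using \<tau>_conn[of r] i that by (simp add: connected_graph_def)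
        then show ?thesis
        proof (induction rule: rtrancl_induct)
          case base
          then show ?case using i_S S_mono[OF order_refl r] by blast
        next
          case (step u v)
          then obtain t where t: "\<tau> r \<le> t" "t < \<tau> (Suc r)" "(u, v) \<in> E t" by auto
          then have "(v, u) \<in> E t" using sym_edges[of t] by (meson symD)
          moreover have "u \<in> S t" using step.IH S_mono[OF r t(1)] by blast
          ultimately have "v \<in> S (Suc t)" using grow[of t u v] r t by simp
          then show ?case using S_mono[of "Suc t" "\<tau> (Suc r)"] r t eq by auto
        qed
      qed
      then show "S (\<tau> r) = V" using S_V by blast
    qed
    \<comment> \<open>The first window that starts after \<open>s\<close>; it starts no later than \<open>s + L\<close>.\<close>
    obtain r where r: "s \<le> \<tau> r" "\<tau> r \<le> s + L"
    proof (cases "s = 0")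
      case True then show ?thesis using that[of 0] \<tau>0 by simp
    next
      case False
      define r where "r = (LEAST r. s \<le> \<tau> r)"
      have r1: "s \<le> \<tau> r" unfolding r_def by (rule LeastI[of _ s]) (rule strict_mono_imp_increasing[OF \<tau>])
      then obtain r' where r': "r = Suc r'" using False \<tau>0 by (cases r) auto
      then have "\<not> s \<le> \<tau> r'" unfolding r_def by (intro not_less_Least) simp
      then show ?thesis using that[OF r1] \<tau>_step[of r'] r' by simp
    qed
    have \<tau>_add: "\<tau> (r + m) \<le> \<tau> r + m * L" for m
    proof (induction m)
      case (Suc m)
      then show ?case using \<tau>_step[of "r + m"] by simp
    qed simp
    have sm: "s \<le> \<tau> (r + m)" for m using r(1) \<tau> by (meson le_add1 order_trans strict_mono_less_eq)
    have count: "S (\<tau> (r + m)) = V \<or> m < card (S (\<tau> (r + m)))" for m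
    proof (induction m)
      case 0
      have "i \<in> S (\<tau> r)" using i_S S_mono[OF order_refl r(1)] by blast
      then show ?case using V(1) S_V[of "\<tau> r"] by (auto simp: card_gt_0_iff finite_subset)
    next
      case (Suc m)
      have sub: "S (\<tau> (r + m)) \<subseteq> S (\<tau> (r + Suc m))" using sm \<tau> by (intro S_mono) (auto simp: strict_mono_less_eq)
      show ?case
      proof (cases "S (\<tau> (r + m)) = V")
        case True then show ?thesis using sub S_V by blast
      next
        case False
        then have "S (\<tau> (r + m)) \<subset> S (\<tau> (r + Suc m))" using window[OF sm[of m]] by simp
        then have "card (S (\<tau> (r + m))) < card (S (\<tau> (r + Suc m)))"
          using V(1) S_V by (meson finite_subset psubset_card_mono)
        then show ?thesis using Suc False by linarith
      qed
    qed
    have "card (S (\<tau> (r + card V))) \<le> card V" using V(1) S_V by (simp add: card_mono)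
    then have full: "S (\<tau> (r + card V)) = V" using count[of "card V"] by linarith
    have "\<tau> (r + card V) \<le> s + T" using \<tau>_add[of "card V"] r(2) by (simp add: T_def)
    then have "S (s + T) = V" using S_mono[OF sm] full S_V by blast
    then have "k \<in> S (s + T)" if "k \<in> V" for k using that by simp
    then have "a k (s + T) \<le> A s - \<delta> ^ T * e" if "k \<in> V" for k using that by (force simp: S_def)
    then have "A (s + T) \<le> A s - \<delta> ^ T * e" by (rule A_le)
    then show ?thesis using M(2)[of "s + T"] by (simp add: e_def)
  qed
  have "(\<lambda>t. a i t) \<longlonglongrightarrow> M" if i: "i \<in> V" for i
  proof (rule tendsto_sandwich)
    have "A t - (A t - M) / \<delta> ^ T \<le> a i t" for t
    proof -
      have "A t - a i t \<le> (A t - M) / \<delta> ^ T"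
        using spread[OF i, of t] \<delta>(1) by (simp add: pos_le_divide_eq mult.commute)
      then show ?thesis by linarith
    qed
    then show "eventually (\<lambda>t. A t - (A t - M) / \<delta> ^ T \<le> a i t) sequentially" by simp
    show "eventually (\<lambda>t. a i t \<le> A t) sequentially" using le_A[OF i] by simp
    have "(\<lambda>t. A t - (A t - M) / \<delta> ^ T) \<longlonglongrightarrow> M - (M - M) / \<delta> ^ T"
      using \<delta>(1) by (intro tendsto_intros M(1)) auto
    then show "(\<lambda>t. A t - (A t - M) / \<delta> ^ T) \<longlonglongrightarrow> M" by simp
  qed (rule M(1))
  then show ?thesis by blast
qed

section \<open>Convergence of barycentric averaging\<close>

lemma excess_integrable:
  "0 \<le> R \<Longrightarrow> \<mu> \<in> prob_moment 2 \<Longrightarrow> integrable \<mu> (\<lambda>x. (max 0 (norm x - R))\<^sup>2)"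
  by (intro subgradient_test_function_integrable subgradient_test_function_excess)

text \<open>
  Uniform integrability of \<open>(norm x)\<^sup>2\<close>, phrased with the convex functions that are propagated by
  barycenters.
\<close>
definition uniformly_square_integrable :: "'a::euclidean_space measure set \<Rightarrow> bool" where
  "uniformly_square_integrable \<M> \<longleftrightarrow>
    (\<forall>e>0. \<exists>R\<ge>0. \<forall>\<mu>\<in>\<M>. (LINT x|\<mu>. (max 0 (norm x - R))\<^sup>2) \<le> e)"

lemma finite_imp_uniformly_square_integrable:
  assumes fin: "finite \<M>" and P: "\<M> \<subseteq> prob_moment 2"
  shows "uniformly_square_integrable \<M>"
  unfolding uniformly_square_integrable_def
proof (intro allI impI)
  fix e :: real assume e: "e > 0"
  have "(\<lambda>n. LINT x|\<mu>. (max 0 (norm x - real n))\<^sup>2) \<longlonglongrightarrow> (LINT x|\<mu>. 0)" if \<mu>: "\<mu> \<in> \<M>" for \<mu>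
  proof (rule integral_dominated_convergence)
    have s: "sets \<mu> = sets borel" and i: "integrable \<mu> (\<lambda>x. (norm x)\<^sup>2)"
      using P \<mu> by (auto simp: prob_moment_2_iff)
    show "integrable \<mu> (\<lambda>x. (norm x)\<^sup>2)" by (rule i)
    show "(\<lambda>x. (max 0 (norm x - real n))\<^sup>2) \<in> borel_measurable \<mu>" for n
      using excess_integrable[of "real n" \<mu>] P \<mu> by auto
    show "AE x in \<mu>. (\<lambda>n. (max 0 (norm x - real n))\<^sup>2) \<longlonglongrightarrow> 0"
    proof (rule AE_I2)
      fix x :: 'a
      have "eventually (\<lambda>n. norm x \<le> real n) sequentially"
        using filterlim_real_sequentially by (simp add: filterlim_at_top)
      then have "eventually (\<lambda>n. (max 0 (norm x - real n))\<^sup>2 = 0) sequentially" by eventually_elim simp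
      then show "(\<lambda>n. (max 0 (norm x - real n))\<^sup>2) \<longlonglongrightarrow> 0" by (rule tendsto_eventually)
    qed
    show "AE x in \<mu>. norm ((max 0 (norm x - real n))\<^sup>2) \<le> (norm x)\<^sup>2" for n
      by (rule AE_I2) (auto intro!: power_mono)
  qed simp
  then have "eventually (\<lambda>n. (LINT x|\<mu>. (max 0 (norm x - real n))\<^sup>2) < e) sequentially" if "\<mu> \<in> \<M>" for \<mu>
    using that e by (intro order_tendstoD) auto
  then have "eventually (\<lambda>n. \<forall>\<mu>\<in>\<M>. (LINT x|\<mu>. (max 0 (norm x - real n))\<^sup>2) < e) sequentially"
    using fin by (simp add: eventually_ball_finite)
  then obtain n where n: "\<forall>\<mu>\<in>\<M>. (LINT x|\<mu>. (max 0 (norm x - real n))\<^sup>2) < e" by (auto simp: eventually_sequentially)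
  then show "\<exists>R\<ge>0. \<forall>\<mu>\<in>\<M>. (LINT x|\<mu>. (max 0 (norm x - R))\<^sup>2) \<le> e"
    by (intro exI[of _ "real n"]) (auto intro: less_imp_le)
qed

text \<open>
  On a uniformly square integrable set of measures, finitely many \<open>bounded_C11\<close> functions control the
  Wasserstein distance: take a partition of unity of small diameter on a ball that carries almost all mass.
  The radius \<open>R\<close> is chosen first and fixes the admissible deficit \<open>r\<close>; only then is the radius
  \<open>R'\<close> of the partitioned ball chosen.
\<close>
lemma wasserstein_2_small_if_bumps_agree:
  fixes \<M> :: "'a::euclidean_space measure set"
  assumes P: "\<M> \<subseteq> prob_moment 2" and ui: "uniformly_square_integrable \<M>" and e: "e > 0"
  obtains K and h :: "nat \<Rightarrow> 'a \<Rightarrow> real" and \<eta> where "\<eta> > 0" "\<And>k. bounded_C11 (h k)"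
    "\<forall>\<mu>\<in>\<M>. \<forall>\<nu>\<in>\<M>. (\<forall>k<K. \<bar>(LINT x|\<mu>. h k x) - (LINT x|\<nu>. h k x)\<bar> \<le> \<eta>)
       \<longrightarrow> (wasserstein 2 \<mu> \<nu>)\<^sup>2 \<le> e"
proof -
  have "e / 64 > 0" using e by simp
  then obtain R where R: "R \<ge> 0" "\<And>\<mu>. \<mu> \<in> \<M> \<Longrightarrow> (LINT x|\<mu>. (max 0 (norm x - R))\<^sup>2) \<le> e / 64"
    using ui unfolding uniformly_square_integrable_def by blast
  define r where "r = e / (64 * (R\<^sup>2 + 1))"
  have r: "r > 0" "16 * R\<^sup>2 * r \<le> e / 4"
    using e by (auto simp: r_def divide_simps add_pos_nonneg add_nonneg_pos)
  then have "r / 2 > 0" by simp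
  then obtain R' where R': "R' \<ge> 0" "\<And>\<mu>. \<mu> \<in> \<M> \<Longrightarrow> (LINT x|\<mu>. (max 0 (norm x - R'))\<^sup>2) \<le> r / 2"
    using ui unfolding uniformly_square_integrable_def by blast
  define d where "d = sqrt (e / 4)"
  have d: "d > 0" "d\<^sup>2 = e / 4" using e by (auto simp: d_def)
  obtain K :: nat and h :: "nat \<Rightarrow> 'a \<Rightarrow> real"
    where h: "\<And>k. bounded_C11 (h k)" "\<And>k x. 0 \<le> h k x" "\<And>x. (\<Sum>k<K. h k x) \<le> 1"
    "\<And>x. norm x \<le> R' + 1 \<Longrightarrow> (\<Sum>k<K. h k x) = 1"
    "\<And>k x y. h k x \<noteq> 0 \<Longrightarrow> h k y \<noteq> 0 \<Longrightarrow> dist x y < d"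
    by (rule smooth_partition[OF d(1)]) (rule that)
  interpret bump_family h K
    using h(1-3) by unfold_locales (auto intro: bounded_C11_measurable)
  define \<eta> where "\<eta> = r / (2 * (real K + 1))"
  have \<eta>: "\<eta> > 0" using r by (simp add: \<eta>_def add_nonneg_pos)
  have K\<eta>: "real K * \<eta> \<le> r / 2"
  proof -
    have half: "a * (r / (2 * a)) = r / 2" if "a > 0" for a :: real using that by simp
    have "real K * \<eta> \<le> (real K + 1) * \<eta>" using \<eta> by (intro mult_right_mono) auto
    also have "\<dots> = r / 2" unfolding \<eta>_def by (rule half) (simp add: add_nonneg_pos)
    finally show ?thesis .
  qed
  have small: "(wasserstein 2 \<mu> \<nu>)\<^sup>2 \<le> e"
    if m: "\<mu> \<in> \<M>" "\<nu> \<in> \<M>" and close: "\<And>k. k < K \<Longrightarrow> \<bar>(LINT x|\<mu>. h k x) - (LINT x|\<nu>. h k x)\<bar> \<le> \<eta>" for \<mu> \<nu>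
  proof -
    have \<mu>: "\<mu> \<in> prob_moment 2" "prob_space \<mu>" "sets \<mu> = sets borel" and \<nu>: "\<nu> \<in> prob_moment 2"
      using P m by (auto simp: prob_moment_2_iff)
    interpret \<mu>: prob_space \<mu> by (rule \<mu>)
    note comb = integrable_h_combination[OF \<mu>(2,3), of "\<lambda>_. 1", simplified]
    have "deficit \<mu> \<nu> \<le> 1 - (\<Sum>k<K. (LINT x|\<mu>. h k x) - \<eta>)"
      unfolding deficit_def overlap_def using close by (intro diff_left_mono sum_mono) (force simp: abs_le_iff)
    also have "\<dots> = (LINT x|\<mu>. 1 - (\<Sum>k<K. h k x)) + real K * \<eta>"
      using integral_h_combination[OF \<mu>(2,3), of "\<lambda>_. 1"] comb
      by (simp add: sum_subtractf \<mu>.prob_space)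
    also have "(LINT x|\<mu>. 1 - (\<Sum>k<K. h k x)) \<le> (LINT x|\<mu>. (max 0 (norm x - R'))\<^sup>2)"
    proof (rule integral_mono)
      show "1 - (\<Sum>k<K. h k x) \<le> (max 0 (norm x - R'))\<^sup>2" for x
      proof (cases "norm x \<le> R' + 1")
        case True
        then show ?thesis using h(4) by simp
      next
        case False
        then have "1 \<le> (max 0 (norm x - R'))\<^sup>2" by (intro one_le_power) auto
        moreover have "0 \<le> (\<Sum>k<K. h k x)" using h(2) by (intro sum_nonneg) auto
        ultimately show ?thesis by linarith
      qed
      show "integrable \<mu> (\<lambda>x. 1 - (\<Sum>k<K. h k x))" using comb by simp
    qed (rule excess_integrable[OF R'(1) \<mu>(1)])
    also have "\<dots> \<le> r / 2" by (rule R'(2)[OF m(1)])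
    finally have def: "deficit \<mu> \<nu> \<le> r" using K\<eta> by simp
    have "(wasserstein 2 \<mu> \<nu>)\<^sup>2 \<le> d\<^sup>2 + 16 * R\<^sup>2 * deficit \<mu> \<nu>
      + 8 * (LINT x|\<mu>. (max 0 (norm x - R))\<^sup>2) + 8 * (LINT x|\<nu>. (max 0 (norm x - R))\<^sup>2)"
      using h(5) d(1) by (intro wasserstein_2_sq_le_deficit \<mu>(1) \<nu> R(1) excess_integrable) (auto intro: less_imp_le)
    also have "\<dots> \<le> e / 4 + 16 * R\<^sup>2 * r + 8 * (e / 64) + 8 * (e / 64)"
      unfolding d(2) using def R(2)[OF m(1)] R(2)[OF m(2)] by (intro add_mono mult_left_mono) auto
    also have "\<dots> \<le> e" using r(2) e by simp
    finally show ?thesis .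
  qed
  show ?thesis
    by (rule that[OF \<eta> h(1), of K], intro ballI impI, rule small) auto
qed

lemma prob_moment_2_if_ge:
  assumes "\<mu> \<in> prob_moment q" "2 \<le> q"
  shows "\<mu> \<in> prob_moment 2"
proof -
  have p: "prob_space \<mu>" "sets \<mu> = sets borel" "integrable \<mu> (\<lambda>x. norm x powr q)"
    using assms by (auto simp: prob_moment_def)
  interpret prob_space \<mu> by fact
  have [measurable_cong]: "sets \<mu> = sets borel" by fact
  have "integrable \<mu> (\<lambda>x. (norm x)\<^sup>2)"
  proof (rule Bochner_Integration.integrable_bound)
    show "integrable \<mu> (\<lambda>x. 1 + norm x powr q)" using p(3) by simp
    have "(norm x)\<^sup>2 \<le> 1 + norm x powr q" for x :: 'a
    proof (cases "norm x \<le> 1")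
      case True
      then have "(norm x)\<^sup>2 \<le> 1" by (simp add: power_le_one)
      then show ?thesis by (simp add: add_increasing2)
    next
      case False
      then have "norm x powr 2 \<le> norm x powr q" using assms(2) by (intro powr_mono) auto
      then show ?thesis using False by (simp add: powr_numeral)
    qed
    then show "AE x in \<mu>. norm ((norm x)\<^sup>2) \<le> norm (1 + norm x powr q)" by simp
  qed measurable
  then show ?thesis using p by (simp add: prob_moment_2_iff)
qed

context network
begin

text \<open>
  All measures stay in one uniformly square integrable set, because the integrals of the excess functions
  never exceed their initial maximum. On this set, the common limits of the bump integrals make
  any two agents close to each other at any two late times. This contains both the Cauchy property
  and the merging of the agents.
\<close>
lemma barycentric_averaging_converges:
  fixes \<mu> :: "nat \<Rightarrow> nat \<Rightarrow> 'a::euclidean_space measure"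
  assumes V: "finite V" "V \<noteq> {}"
    and init: "\<And>i. i \<in> V \<Longrightarrow> \<mu> i 0 \<in> prob_moment 2"
    and update: "\<And>i t. i \<in> V \<Longrightarrow>
      \<mu> i (Suc t) \<in> barycenters (neighbors V (E t) i) (\<lambda>j. \<mu> j t) (\<lambda>j. w i j t)"
  shows "\<exists>\<mu>s \<in> prob_moment 2. \<forall>i\<in>V. (\<lambda>t. wasserstein 2 (\<mu> i t) \<mu>s) \<longlonglongrightarrow> 0"
proof -
  have P: "\<mu> i t \<in> prob_moment 2" if "i \<in> V" for i t
    using init[OF that] update[OF that] by (cases t) (auto simp: barycenters_def is_arg_min_def)
  have prob: "prob_space (\<mu> i t)" "sets (\<mu> i t) = sets borel" if "i \<in> V" for i t
    using P[OF that] by (auto simp: prob_moment_2_iff)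
  have N: "finite (neighbors V (E t) i)" "neighbors V (E t) i \<subseteq> V" for i t
    using V by (auto simp: neighbors_def)
  have wnn: "0 \<le> w i j t" if "j \<in> neighbors V (E t) i" for i j t
    using weight_pos[of i j t] that by (auto simp: neighbors_def less_imp_le)
  have jensen: "(LINT x|\<mu> i (Suc t). \<phi> x) \<le> (\<Sum>j\<in>neighbors V (E t) i. w i j t * (LINT x|\<mu> j t. \<phi> x))"
    if "i \<in> V" "subgradient_test_function \<phi>" for \<phi> i t
    using N by (intro barycenter_jensen[OF update[OF that(1)]] that wnn weight_sum P) (auto dest: subsetD[OF N(2)])
  have common_limit: "\<exists>M. \<forall>i\<in>V. (\<lambda>t. LINT x|\<mu> i t. \<phi> x) \<longlonglongrightarrow> M"
    if \<phi>: "subgradient_test_function \<phi>" and b: "\<And>x. b \<le> \<phi> x" for \<phi> b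
  proof (rule averaging_below_consensus[OF V])
    show "(LINT x|\<mu> i (Suc t). \<phi> x) \<le> (\<Sum>j\<in>neighbors V (E t) i. w i j t * (LINT x|\<mu> j t. \<phi> x))" if "i \<in> V" for i t
      by (rule jensen[OF that \<phi>])
    show "b \<le> (LINT x|\<mu> i t. \<phi> x)" if "i \<in> V" for i t
    proof -
      interpret prob_space "\<mu> i t" by (rule prob[OF that])
      show ?thesis
        using integral_mono[OF _ subgradient_test_function_integrable[OF \<phi> P[OF that, of t]], of "\<lambda>_. b"] b
        by (simp add: prob_space)
    qed
  qed
  \<comment> \<open>Subtracting the common limit of the second moments removes the convexifying term.\<close>
  have C11_limit: "\<exists>M. \<forall>i\<in>V. (\<lambda>t. LINT x|\<mu> i t. f x) \<longlonglongrightarrow> M" if f: "bounded_C11 f" for f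
  proof -
    obtain C where C: "0 \<le> C" "\<And>x. \<bar>f x\<bar> \<le> C" "subgradient_test_function (\<lambda>x. f x + C * (norm x)\<^sup>2)"
      by (rule bounded_C11_plus_norm_sq[OF f]) (rule that)
    have "- C \<le> f x + C * (norm x)\<^sup>2" for x using C(2)[of x] C(1) by (simp add: abs_le_iff add_increasing2)
    then obtain M1 where M1: "\<And>i. i \<in> V \<Longrightarrow> (\<lambda>t. LINT x|\<mu> i t. f x + C * (norm x)\<^sup>2) \<longlonglongrightarrow> M1"
      using common_limit[OF C(3)] by blast
    obtain M2 where M2: "\<And>i. i \<in> V \<Longrightarrow> (\<lambda>t. LINT x|\<mu> i t. (norm x)\<^sup>2) \<longlonglongrightarrow> M2"
      using common_limit[OF subgradient_test_function_norm_sq, of 0] by auto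
    have "(\<lambda>t. LINT x|\<mu> i t. f x) \<longlonglongrightarrow> M1 - C * M2" if i: "i \<in> V" for i
    proof -
      have "(LINT x|\<mu> i t. f x) = (LINT x|\<mu> i t. f x + C * (norm x)\<^sup>2) - C * (LINT x|\<mu> i t. (norm x)\<^sup>2)" for t
        using P[OF i, of t] bounded_C11_integrable[OF f prob[OF i]] by (simp add: prob_moment_2_iff)
      then show ?thesis using tendsto_diff[OF M1[OF i] tendsto_mult_left[OF M2[OF i], of C]] by simp
    qed
    then show ?thesis by blast
  qed
  define \<M> where "\<M> = {\<mu> i t |i t. i \<in> V}"
  have \<M>: "\<M> \<subseteq> prob_moment 2" using P by (auto simp: \<M>_def)
  have ui: "uniformly_square_integrable \<M>"
    unfolding uniformly_square_integrable_def
  proof (intro allI impI)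
    fix e :: real assume "e > 0"
    moreover have "uniformly_square_integrable ((\<lambda>i. \<mu> i 0) ` V)"
      using V P by (intro finite_imp_uniformly_square_integrable) auto
    ultimately obtain R where R: "R \<ge> 0" "\<And>i. i \<in> V \<Longrightarrow> (LINT x|\<mu> i 0. (max 0 (norm x - R))\<^sup>2) \<le> e"
      unfolding uniformly_square_integrable_def by auto
    have "(LINT x|\<mu> i t. (max 0 (norm x - R))\<^sup>2) \<le> e" if "i \<in> V" for i t
      using that
    proof (induction t arbitrary: i)
      case (Suc t)
      have "(LINT x|\<mu> i (Suc t). (max 0 (norm x - R))\<^sup>2)
        \<le> (\<Sum>j\<in>neighbors V (E t) i. w i j t * (LINT x|\<mu> j t. (max 0 (norm x - R))\<^sup>2))"
        by (rule jensen[OF Suc.prems subgradient_test_function_excess[OF R(1)]])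
      also have "\<dots> \<le> (\<Sum>j\<in>neighbors V (E t) i. w i j t * e)"
        using N by (intro sum_mono mult_left_mono Suc.IH wnn) (auto dest: subsetD[OF N(2)])
      also have "\<dots> = e" using weight_sum[OF Suc.prems] by (simp add: sum_distrib_right[symmetric])
      finally show ?case .
    qed (rule R(2))
    then show "\<exists>R\<ge>0. \<forall>\<mu>\<in>\<M>. (LINT x|\<mu>. (max 0 (norm x - R))\<^sup>2) \<le> e"
      using R(1) by (auto simp: \<M>_def)
  qed
  have merge: "\<exists>T. \<forall>s\<ge>T. \<forall>t\<ge>T. \<forall>i\<in>V. \<forall>j\<in>V. (wasserstein 2 (\<mu> i s) (\<mu> j t))\<^sup>2 \<le> e" if e: "e > 0" for e :: real
  proof -
    obtain K and h :: "nat \<Rightarrow> 'a \<Rightarrow> real" and \<eta> where h: "\<eta> > 0" "\<And>k. bounded_C11 (h k)"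
      "\<forall>\<mu>\<in>\<M>. \<forall>\<nu>\<in>\<M>. (\<forall>k<K. \<bar>(LINT x|\<mu>. h k x) - (LINT x|\<nu>. h k x)\<bar> \<le> \<eta>)
         \<longrightarrow> (wasserstein 2 \<mu> \<nu>)\<^sup>2 \<le> e"
      by (rule wasserstein_2_small_if_bumps_agree[OF \<M> ui e]) (rule that)
    obtain M where M: "\<And>k i. i \<in> V \<Longrightarrow> (\<lambda>t. LINT x|\<mu> i t. h k x) \<longlonglongrightarrow> M k"
      using C11_limit[OF h(2)] by metis
    have "eventually (\<lambda>t. \<forall>k\<in>{..<K}. \<forall>i\<in>V. dist (LINT x|\<mu> i t. h k x) (M k) < \<eta> / 2) sequentially"
      using V(1) h(1) by (intro eventually_ball_finite ballI tendstoD M) auto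
    then obtain T where T: "\<And>t k i. T \<le> t \<Longrightarrow> k < K \<Longrightarrow> i \<in> V \<Longrightarrow> dist (LINT x|\<mu> i t. h k x) (M k) < \<eta> / 2"
      by (auto simp: eventually_sequentially)
    have "(wasserstein 2 (\<mu> i s) (\<mu> j t))\<^sup>2 \<le> e" if "T \<le> s" "T \<le> t" "i \<in> V" "j \<in> V" for i j s t
    proof (rule h(3)[rule_format])
      show "\<mu> i s \<in> \<M>" "\<mu> j t \<in> \<M>" using that by (auto simp: \<M>_def)
      fix k assume "k < K"
      then show "\<bar>(LINT x|\<mu> i s. h k x) - (LINT x|\<mu> j t. h k x)\<bar> \<le> \<eta>"
        using T[OF that(1) _ that(3), of k] T[OF that(2) _ that(4), of k] unfolding dist_real_def by linarith
    qed
    then show ?thesis by blast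
  qed
  obtain i0 where i0: "i0 \<in> V" using V by blast
  have "\<exists>N. \<forall>s\<ge>N. \<forall>t\<ge>N. (wasserstein 2 (\<mu> i0 s) (\<mu> i0 t))\<^sup>2 \<le> e" if "e > 0" for e
    using merge[OF that] i0 by blast
  then obtain \<mu>s where \<mu>s: "\<mu>s \<in> prob_moment 2" "(\<lambda>t. wasserstein 2 (\<mu> i0 t) \<mu>s) \<longlonglongrightarrow> 0"
    using wasserstein_2_complete[of "\<mu> i0", OF P[OF i0]] by blast
  have "(\<lambda>t. wasserstein 2 (\<mu> i t) \<mu>s) \<longlonglongrightarrow> 0" if i: "i \<in> V" for i
  proof -
    have "(\<lambda>t. (wasserstein 2 (\<mu> i t) (\<mu> i0 t))\<^sup>2) \<longlonglongrightarrow> 0"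
    proof (rule LIMSEQ_I)
      fix e :: real assume "e > 0"
      then obtain T where T: "\<forall>s\<ge>T. \<forall>t\<ge>T. \<forall>i\<in>V. \<forall>j\<in>V. (wasserstein 2 (\<mu> i s) (\<mu> j t))\<^sup>2 \<le> e / 2"
        using merge[OF half_gt_zero] by blast
      have "(wasserstein 2 (\<mu> i t) (\<mu> i0 t))\<^sup>2 \<le> e / 2" if "T \<le> t" for t using T that i i0 by blast
      then have "(wasserstein 2 (\<mu> i t) (\<mu> i0 t))\<^sup>2 < e" if "T \<le> t" for t
        using that \<open>e > 0\<close> by force
      then show "\<exists>T. \<forall>t\<ge>T. norm ((wasserstein 2 (\<mu> i t) (\<mu> i0 t))\<^sup>2 - 0) < e" by auto
    qed
    then have "(\<lambda>t. 2 * (wasserstein 2 (\<mu> i t) (\<mu> i0 t))\<^sup>2 + 2 * (wasserstein 2 (\<mu> i0 t) \<mu>s)\<^sup>2) \<longlonglongrightarrow> 2 * 0 + 2 * 0\<^sup>2"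
      by (intro tendsto_intros \<mu>s(2))
    then have lim: "(\<lambda>t. 2 * (wasserstein 2 (\<mu> i t) (\<mu> i0 t))\<^sup>2 + 2 * (wasserstein 2 (\<mu> i0 t) \<mu>s)\<^sup>2) \<longlonglongrightarrow> 0"
      by simp
    have "(\<lambda>t. (wasserstein 2 (\<mu> i t) \<mu>s)\<^sup>2) \<longlonglongrightarrow> 0"
      by (rule Lim_null_comparison[OF _ lim])
         (use wasserstein_2_sq_quasi_triangle[OF P[OF i] P[OF i0] \<mu>s(1)] in simp)
    then have "(\<lambda>t. sqrt ((wasserstein 2 (\<mu> i t) \<mu>s)\<^sup>2)) \<longlonglongrightarrow> sqrt 0" by (rule tendsto_real_sqrt)
    then show ?thesis using wasserstein_2_nonneg[OF P[OF i] \<mu>s(1)] by simp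
  qed
  then show ?thesis using \<mu>s(1) by blast
qed

end

theorem theorem2p4:
  fixes n :: nat
    and E :: "nat \<Rightarrow> (nat \<times> nat) set"
    and w :: "nat \<Rightarrow> nat \<Rightarrow> nat \<Rightarrow> real"
    and \<mu> :: "nat \<Rightarrow> nat \<Rightarrow> (real ^ 'd) measure"
    and q :: real
  assumes "n \<ge> 1"
    and "network {1..n} E w"
    and "q > 2"
    and "\<And>i. i \<in> {1..n} \<Longrightarrow> \<mu> i 0 \<in> prob_moment_ac q"
    and "\<And>i t. i \<in> {1..n} \<Longrightarrow>
      \<mu> i (Suc t) \<in>
        barycenters (neighbors {1..n} (E t) i) (\<lambda>j. \<mu> j t) (\<lambda>j. w i j t)"
  shows "\<exists>\<mu>s \<in> prob_moment 2. \<forall>i\<in>{1..n}.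
    (\<lambda>t. wasserstein 2 (\<mu> i t) \<mu>s) \<longlonglongrightarrow> 0"
proof (rule network.barycentric_averaging_converges[OF assms(2)])
  show "\<mu> i 0 \<in> prob_moment 2" if "i \<in> {1..n}" for i
    using assms(4)[OF that] assms(3) by (intro prob_moment_2_if_ge[of _ q]) (auto simp: prob_moment_ac_def)
qed (use assms in auto)

end
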